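(* Let $X_1,X_2,\dots$ be i.i.d. with distribution function $F_0$ having a density $f_0\in\mathcal{P}_1$, symmetric about $\theta_0\in\mathbb{R}$, and write $g_0=f_0(\cdot+\theta_0)$, $\psi_0=\log g_0$. Let $(\hat\theta_n,\hat\psi_n)$ be the MLE, $\hat g_n=e^{\hat\psi_n}$. Then $\theta^*(F_0)=\theta_0$ and $f^*(F_0)=f_0$ (so that $g^*(F_0)=g_0$ and $\psi^*(F_0)=\psi_0$), and as $n\to\infty$, $L(\mathbb{F}_n)\to L(F_0)$ almost surely and: (a) $\hat\theta_n\to\theta_0$ almost surely. (b) $\hat\psi_n(x)\to\psi_0(x)$ almost surely, for all $x\in\mathrm{int}(\mathrm{dom}(\psi_0))$. (c) Almost surely, $\limsup_n\hat\psi_n(x)\le\psi_0(x)$ for all $x\in\mathbb{R}$. (d) $\hat g_n(x)\to g_0(x)$ almost surely, for all $x\in\mathbb{R}$. (e) There exists $\alpha>0$ such that for all $\alpha_1<\alpha$, $\int e^{\alpha_1|x|}|\hat g_n(x)-g_0(x)|dx\to0$ almost surely; moreover, if $g_0$ is continuous on $\mathbb{R}$, then $\sup_{x\in\mathbb{R}}e^{\alpha_1|x|}|\hat g_n(x)-g_0(x)|\to0$ almost surely.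
   Context: $\mathcal{C}$: functions $\varphi:\mathbb{R}\to[-\infty,\infty)$ that are concave, closed and proper; $\mathcal{SC}_0$: the $\psi\in\mathcal{C}$ symmetric about $0$; $\mathrm{dom}(\psi)=\{x:\psi(x)>-\infty\}$. $\mathcal{P}_1$: probability densities on $\mathbb{R}$ that are symmetric about some point, bounded, and have finite first absolute moment. For a distribution function $F$, $\Psi(\theta,\psi,F)=\int\psi(x-\theta)dF(x)-\int e^{\psi(x-\theta)}dx$, $L(F)=\sup_{\theta\in\mathbb{R},\psi\in\mathcal{SC}_0}\Psi(\theta,\psi,F)$, $(\theta^*(F),\psi^*(F))=\arg\max_{\theta\in\mathbb{R},\psi\in\mathcal{SC}_0}\Psi(\theta,\psi,F)$, $g^*(F)=e^{\psi^*(F)}$, and $f^*(F)=g^*(F)(\cdot-\theta^*(F))$. $\mathbb{F}_n$ is the empirical distribution function of $X_1,\dots,X_n$, and the MLE $(\hat\theta_n,\hat\psi_n)$ is a maximizer of $\Psi(\theta,\psi,\mathbb{F}_n)$ over $\mathbb{R}\times\mathcal{SC}_0$ (any version if not unique).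
   Formalization: ψ_0 = log g_0 is assumed to lie in SC_0 (f_0 log-concave, closed version), as ψ*(F_0)=ψ_0 forces; (d) is claimed only at continuity points of g_0, since it fails at jump endpoints of the support, e.g. the uniform density on [-1,1] at x=1. *)

theory Defs
  imports "HOL-Probability.Probability"
begin

text \<open>Exponential and logarithm with the conventions \<open>e\<close> to the power \<open>-\<infinity>\<close> equals 0 and
  \<open>log 0 = -\<infinity>\<close>.  \<open>exp_ext\<close> is only used at arguments different from \<open>\<infinity>\<close>, and \<open>log_ext\<close> only at
  nonnegative ones.\<close>

definition exp_ext :: "ereal \<Rightarrow> real" where
  "exp_ext y = (if y = -\<infinity> then 0 else exp (real_of_ereal y))"

definition log_ext :: "real \<Rightarrow> ereal" where
  "log_ext y = (if y = 0 then -\<infinity> else ereal (ln y))"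

definition hypograph :: "(real \<Rightarrow> ereal) \<Rightarrow> (real \<times> real) set" where
  "hypograph \<phi> = {(x, r). ereal r \<le> \<phi> x}"

definition effective_domain :: "(real \<Rightarrow> ereal) \<Rightarrow> real set" where
  "effective_domain \<phi> = {x. \<phi> x > -\<infinity>}"

definition CC :: "(real \<Rightarrow> ereal) set" where
  "CC = {\<phi>. (\<forall>x. \<phi> x < \<infinity>) \<and> effective_domain \<phi> \<noteq> {}
            \<and> convex (hypograph \<phi>) \<and> closed (hypograph \<phi>)}"

definition SC0 :: "(real \<Rightarrow> ereal) set" where
  "SC0 = {\<psi> \<in> CC. \<forall>x. \<psi> (- x) = \<psi> x}"

definition P1 :: "(real \<Rightarrow> real) set" where
  "P1 = {f. f \<in> borel_measurable borel \<and> (\<forall>x. 0 \<le> f x)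
          \<and> (\<integral>\<^sup>+ x. ennreal (f x) \<partial>lborel) = 1
          \<and> (\<exists>c. \<forall>x. f (c + x) = f (c - x))
          \<and> (\<exists>B. \<forall>x. f x \<le> B)
          \<and> integrable lborel (\<lambda>x. \<bar>x\<bar> * f x)}"

text \<open>Integral of an extended real function, as the integral of the positive part minus that of the
  negative part.  Elements of \<open>SC0\<close> are bounded above, so against a finite measure the form
  \<open>\<infinity> - \<infinity>\<close> does not arise.\<close>

definition ext_integral :: "real measure \<Rightarrow> (real \<Rightarrow> ereal) \<Rightarrow> ereal" where
  "ext_integral \<mu> h = enn2ereal (\<integral>\<^sup>+ x. e2ennreal (h x) \<partial>\<mu>) - enn2ereal (\<integral>\<^sup>+ x. e2ennreal (- h x) \<partial>\<mu>)"

text \<open>\<open>F\<close> is a distribution function; \<open>interval_measure F\<close> is its Lebesgue-Stieltjes measure.\<close>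

definition Psi :: "real \<Rightarrow> (real \<Rightarrow> ereal) \<Rightarrow> (real \<Rightarrow> real) \<Rightarrow> ereal" where
  "Psi \<theta> \<psi> F = ext_integral (interval_measure F) (\<lambda>x. \<psi> (x - \<theta>))
             - enn2ereal (\<integral>\<^sup>+ x. ennreal (exp_ext (\<psi> (x - \<theta>))) \<partial>lborel)"

definition L_crit :: "(real \<Rightarrow> real) \<Rightarrow> ereal" where
  "L_crit F = (SUP (\<theta>, \<psi>) \<in> UNIV \<times> SC0. Psi \<theta> \<psi> F)"

definition is_maximizer :: "(real \<Rightarrow> real) \<Rightarrow> real \<times> (real \<Rightarrow> ereal) \<Rightarrow> bool" where
  "is_maximizer F = is_arg_max (\<lambda>(\<theta>, \<psi>). Psi \<theta> \<psi> F) (\<lambda>p. p \<in> UNIV \<times> SC0)"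

text \<open>\<open>arg_max\<close> makes an arbitrary choice, so these are meaningful only when \<open>is_maximizer F\<close> holds
  for exactly one pair.\<close>

definition star :: "(real \<Rightarrow> real) \<Rightarrow> real \<times> (real \<Rightarrow> ereal)" where
  "star F = arg_max (\<lambda>(\<theta>, \<psi>). Psi \<theta> \<psi> F) (\<lambda>p. p \<in> UNIV \<times> SC0)"

definition theta_star :: "(real \<Rightarrow> real) \<Rightarrow> real" where
  "theta_star F = fst (star F)"

definition psi_star :: "(real \<Rightarrow> real) \<Rightarrow> real \<Rightarrow> ereal" where
  "psi_star F = snd (star F)"

definition g_star :: "(real \<Rightarrow> real) \<Rightarrow> real \<Rightarrow> real" where
  "g_star F x = exp_ext (psi_star F x)"

definition f_star :: "(real \<Rightarrow> real) \<Rightarrow> real \<Rightarrow> real" where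
  "f_star F x = g_star F (x - theta_star F)"

definition ecdf :: "(nat \<Rightarrow> 'a \<Rightarrow> real) \<Rightarrow> nat \<Rightarrow> 'a \<Rightarrow> real \<Rightarrow> real" where
  "ecdf X n \<omega> x = real (card {i \<in> {1..n}. X i \<omega> \<le> x}) / real n"

end

theory Submission
  imports Defs
begin

text \<open>Everything is deterministic on the almost sure event that the empirical distribution functions
  converge at the rationals and the average log-likelihood of \<open>f0\<close> converges to \<open>\<integral>f0 ln f0\<close>; both are
  strong laws for square integrable variables.  On that event, optimality bounds the log-likelihood
  of the estimator from below.  Since a symmetric log-concave density with peak \<open>exp m\<close> is at most
  \<open>exp (m + 1 - \<bar>x\<bar> / r)\<close> with \<open>r = exp (1 - m)\<close>, this bound confines the peak, the centre and the tails
  to a compact range.  The densities are monotone on each side of the centre, so Helly's theorem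
  gives convergent subsequences.  Under a Skorohod coupling of the empirical distributions with the
  true one, Fatou's lemma shows that every limit is a sub-density with expected log-likelihood at
  least \<open>\<integral>f0 ln f0\<close>, hence equals \<open>f0\<close> by Gibbs' inequality.\<close>

section \<open>A strong law of large numbers\<close>

text \<open>Centre and shape both move with \<open>n\<close>, so \<open>ln (g n)\<close> is
  integrated against a changing measure and weak convergence alone does not pass to the limit. The
  coupling turns it into pointwise convergence, and monotone functions tolerate moving arguments
  wherever the limit is continuous; the exceptional points are countable, hence null for a law with
  a density. \<open>ln (g n)\<close> has no lower bound, so Fatou's lemma can only be applied to
  \<open>C - ln (g n)\<close>; this is why the peak is bounded before any limit is taken. Mass may
  be lost in the limit, so Gibbs' inequality is stated with both total masses in it. It identifies a
  density and not a pair, and the centre needs its own uniqueness argument. Since all subsequential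
  limits agree, pointwise strong laws take the place of a uniform law over log-concave functions.
  With \<open>L0 = \<integral>g0 ln g0\<close>, the peak is eventually at least
  \<open>exp (L0 - 1)\<close>; the tail bound for \<open>m = L0 - 1\<close> has
  \<open>r = exp (2 - L0)\<close>, and \<open>1 / r\<close> is the rate \<open>\<alpha>\<close> of
  the theorem.\<close>

lemma averages_tendsto_of_squares:
  fixes S :: "nat \<Rightarrow> real"
  assumes mono: "mono S" and nonneg: "\<And>n. 0 \<le> S n"
    and lim: "(\<lambda>k. S (k\<^sup>2) / real (k\<^sup>2)) \<longlonglongrightarrow> m"
  shows "(\<lambda>n. S n / real n) \<longlonglongrightarrow> m"
proof -
  \<comment> \<open>Here \<open>n\<close> lies between the squares of \<open>r n\<close> and
    \<open>r n + 1\<close>. Monotonicity traps \<open>S n / n\<close> between the averages at these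
    two squares, up to the factor \<open>(r n / (r n + 1))^2\<close> and its inverse, which tend to
    1.\<close>
  define r where "r n = nat \<lfloor>sqrt (real n)\<rfloor>" for n :: nat
  have r_le: "(r n)\<^sup>2 \<le> n" for n
  proof -
    have "real (r n) \<le> sqrt (real n)" by (simp add: r_def)
    then have "(real (r n))\<^sup>2 \<le> (sqrt (real n))\<^sup>2" by (intro power_mono) auto
    then have "real ((r n)\<^sup>2) \<le> real n" by simp
    then show ?thesis by (simp only: of_nat_le_iff)
  qed
  have r_gt: "n \<le> (Suc (r n))\<^sup>2" for n
  proof -
    have "sqrt (real n) \<le> real (Suc (r n))"
      by (simp add: r_def) linarith
    then have "(sqrt (real n))\<^sup>2 \<le> (real (Suc (r n)))\<^sup>2" by (intro power_mono) auto
    then have "real n \<le> real ((Suc (r n))\<^sup>2)" by simp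
    then show ?thesis by (simp only: of_nat_le_iff)
  qed
  have r_top: "filterlim r at_top sequentially"
    unfolding filterlim_at_top
  proof (intro allI)
    fix Z :: nat
    show "\<forall>\<^sub>F n in sequentially. Z \<le> r n"
      using eventually_ge_at_top[of "Z\<^sup>2"]
    proof eventually_elim
      case (elim n)
      have "real Z = sqrt (real (Z\<^sup>2))" by simp
      also have "\<dots> \<le> sqrt (real n)" using elim by (simp only: real_sqrt_le_iff of_nat_le_iff)
      finally show ?case unfolding r_def by linarith
    qed
  qed
  have ratio: "(\<lambda>k. (real k / real (Suc k))\<^sup>2) \<longlonglongrightarrow> 1"
    using tendsto_power[OF LIMSEQ_n_over_Suc_n[where 'a=real], of 2] by simp
  have ratio': "(\<lambda>k. (real (Suc k) / real k)\<^sup>2) \<longlonglongrightarrow> 1"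
    using tendsto_power[OF LIMSEQ_Suc_n_over_n[where 'a=real], of 2] by simp
  have lo: "(\<lambda>k. S (k\<^sup>2) / real (k\<^sup>2) * (real k / real (Suc k))\<^sup>2) \<longlonglongrightarrow> m"
    using tendsto_mult[OF lim ratio] by simp
  have hi: "(\<lambda>k. S ((Suc k)\<^sup>2) / real ((Suc k)\<^sup>2) * (real (Suc k) / real k)\<^sup>2) \<longlonglongrightarrow> m"
    using tendsto_mult[OF LIMSEQ_Suc[OF lim] ratio'] by simp
  show ?thesis
  proof (rule tendsto_sandwich[OF _ _ filterlim_compose[OF lo r_top] filterlim_compose[OF hi r_top]])
    have ev: "\<forall>\<^sub>F n in sequentially. 1 \<le> r n"
      using r_top unfolding filterlim_at_top by blast
    show "\<forall>\<^sub>F n in sequentially. S ((r n)\<^sup>2) / real ((r n)\<^sup>2) * (real (r n) / real (Suc (r n)))\<^sup>2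
              \<le> S n / real n"
      using ev eventually_gt_at_top[of 0]
    proof eventually_elim
      case (elim n)
      have "S ((r n)\<^sup>2) / real ((r n)\<^sup>2) * (real (r n) / real (Suc (r n)))\<^sup>2
          = S ((r n)\<^sup>2) / real ((Suc (r n))\<^sup>2)"
        using elim by (simp add: power_divide)
      also have "\<dots> \<le> S n / real ((Suc (r n))\<^sup>2)"
        using monoD[OF mono r_le[of n]] by (intro divide_right_mono) auto
      also have "\<dots> \<le> S n / real n"
        using r_gt[of n] elim nonneg[of n] by (intro divide_left_mono) (auto simp: of_nat_le_iff simp del: of_nat_power of_nat_Suc)
      finally show ?case .
    qed
    show "\<forall>\<^sub>F n in sequentially. S n / real n
              \<le> S ((Suc (r n))\<^sup>2) / real ((Suc (r n))\<^sup>2) * (real (Suc (r n)) / real (r n))\<^sup>2"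
      using ev eventually_gt_at_top[of 0]
    proof eventually_elim
      case (elim n)
      have "S n / real n \<le> S ((Suc (r n))\<^sup>2) / real n"
        using monoD[OF mono r_gt[of n]] by (intro divide_right_mono) auto
      also have "\<dots> \<le> S ((Suc (r n))\<^sup>2) / real ((r n)\<^sup>2)"
        using r_le[of n] elim nonneg by (intro divide_left_mono) (auto simp: of_nat_le_iff simp del: of_nat_power of_nat_Suc)
      also have "\<dots> = S ((Suc (r n))\<^sup>2) / real ((Suc (r n))\<^sup>2) * (real (Suc (r n)) / real (r n))\<^sup>2"
        using elim by (simp add: power_divide del: of_nat_Suc)
      finally show ?case .
    qed
  qed
qed

text \<open>Independent summands are uncorrelated, so a sum of \<open>n\<close> centred terms has
  second moment \<open>n * s\<close>, and averages over \<open>k^2\<close> terms have the summable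
  variances \<open>s / k^2\<close>. Nonnegativity makes the partial sums increasing, which fills the
  gaps between consecutive squares.\<close>

lemma (in prob_space) strong_law_nonneg_square_integrable:
  fixes X :: "nat \<Rightarrow> 'a \<Rightarrow> real"
  assumes indep: "indep_vars (\<lambda>_. borel) X {1..}"
    and nonneg: "\<And>i \<omega>. 0 \<le> X i \<omega>"
    and sq: "\<And>i. i \<ge> 1 \<Longrightarrow> integrable M (\<lambda>\<omega>. (X i \<omega>)\<^sup>2)"
    and mean: "\<And>i. i \<ge> 1 \<Longrightarrow> expectation (X i) = m"
    and second: "\<And>i. i \<ge> 1 \<Longrightarrow> expectation (\<lambda>\<omega>. (X i \<omega>)\<^sup>2) = v"
  shows "AE \<omega> in M. (\<lambda>n. (\<Sum>i\<in>{1..n}. X i \<omega>) / real n) \<longlonglongrightarrow> m"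
proof -
  have meas: "X i \<in> borel_measurable M" if "i \<ge> 1" for i
    using indep that unfolding indep_vars_def by auto
  have int: "integrable M (X i)" if "i \<ge> 1" for i
    by (rule square_integrable_imp_integrable[OF meas[OF that] sq[OF that]])
  define Z where "Z i \<omega> = X i \<omega> - m" for i \<omega>
  define s where "s = v - m\<^sup>2"
  have Z_int: "integrable M (Z i)" if "i \<ge> 1" for i
    unfolding Z_def using int[OF that] by auto
  have Z_meas: "Z i \<in> borel_measurable M" if "i \<ge> 1" for i
    using Z_int[OF that] by auto
  have Z_mean: "expectation (Z i) = 0" if "i \<ge> 1" for i
    unfolding Z_def using int[OF that] mean[OF that] prob_space by simp
  have Z_indep: "indep_vars (\<lambda>_. borel) Z {1..}"
    unfolding Z_def by (rule indep_vars_compose2[OF indep]) auto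
  have Z_prod: "integrable M (\<lambda>\<omega>. Z i \<omega> * Z j \<omega>) \<and>
      expectation (\<lambda>\<omega>. Z i \<omega> * Z j \<omega>) = (if i = j then s else 0)" if ij: "i \<ge> 1" "j \<ge> 1" for i j
  proof (cases "i = j")
    case True
    have eq: "Z i \<omega> * Z j \<omega> = (X i \<omega>)\<^sup>2 - 2 * m * X i \<omega> + m\<^sup>2" for \<omega>
      using True by (simp add: Z_def power2_eq_square algebra_simps)
    show ?thesis
      unfolding eq using True int[OF ij(1)] sq[OF ij(1)] mean[OF ij(1)] second[OF ij(1)] prob_space
      by (simp add: s_def power2_eq_square)
  next
    case False
    have sub: "indep_vars (\<lambda>_. borel) Z {i, j}"
      by (rule indep_vars_subset[OF Z_indep]) (use ij in auto)
    show ?thesis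
      using indep_vars_lebesgue_integral[OF _ sub] indep_vars_integrable[OF _ sub] False
        Z_int Z_mean ij by auto
  qed
  have sum_sq: "integrable M (\<lambda>\<omega>. (\<Sum>i\<in>{1..n}. Z i \<omega>)\<^sup>2) \<and>
      expectation (\<lambda>\<omega>. (\<Sum>i\<in>{1..n}. Z i \<omega>)\<^sup>2) = real n * s" for n
  proof -
    have eq: "(\<Sum>i\<in>{1..n}. Z i \<omega>)\<^sup>2 = (\<Sum>i\<in>{1..n}. \<Sum>j\<in>{1..n}. Z i \<omega> * Z j \<omega>)" for \<omega>
      by (simp add: power2_eq_square sum_product)
    have ints: "integrable M (\<lambda>\<omega>. \<Sum>j\<in>{1..n}. Z i \<omega> * Z j \<omega>)" if "i \<in> {1..n}" for i
      using that Z_prod by (intro Bochner_Integration.integrable_sum) auto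
    have "expectation (\<lambda>\<omega>. \<Sum>i\<in>{1..n}. \<Sum>j\<in>{1..n}. Z i \<omega> * Z j \<omega>)
        = (\<Sum>i\<in>{1..n}. expectation (\<lambda>\<omega>. \<Sum>j\<in>{1..n}. Z i \<omega> * Z j \<omega>))"
      by (rule Bochner_Integration.integral_sum[OF ints])
    also have "\<dots> = (\<Sum>i\<in>{1..n}. \<Sum>j\<in>{1..n}. expectation (\<lambda>\<omega>. Z i \<omega> * Z j \<omega>))"
      by (intro sum.cong refl Bochner_Integration.integral_sum) (use Z_prod in auto)
    also have "\<dots> = (\<Sum>i\<in>{1..n}. \<Sum>j\<in>{1..n}. if i = j then s else 0)"
      by (intro sum.cong refl) (use Z_prod in auto)
    also have "\<dots> = real n * s" by simp
    finally show ?thesis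
      unfolding eq using ints by (auto intro: Bochner_Integration.integrable_sum)
  qed
  have "s \<ge> 0"
    using sum_sq[of 1] Bochner_Integration.integral_nonneg[of M "\<lambda>\<omega>. (\<Sum>i\<in>{1..1}. Z i \<omega>)\<^sup>2"] by simp
  \<comment> \<open>The index \<open>Suc k\<close> keeps the denominator away from 0.\<close>
  define T where "T k \<omega> = (\<Sum>i\<in>{1..(Suc k)\<^sup>2}. Z i \<omega>) / real ((Suc k)\<^sup>2)" for k \<omega>
  have T_meas: "T k \<in> borel_measurable M" for k
    unfolding T_def by (intro borel_measurable_divide borel_measurable_sum) (auto intro: Z_meas)
  have T_int: "(\<integral>\<^sup>+\<omega>. ennreal ((T k \<omega>)\<^sup>2) \<partial>M) = ennreal (s * inverse ((real (Suc k))\<^sup>2))" for k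
  proof -
    have eq: "(T k \<omega>)\<^sup>2 = (\<Sum>i\<in>{1..(Suc k)\<^sup>2}. Z i \<omega>)\<^sup>2 / (real ((Suc k)\<^sup>2))\<^sup>2" for \<omega>
      by (simp add: T_def power_divide)
    have "(\<integral>\<^sup>+\<omega>. ennreal ((T k \<omega>)\<^sup>2) \<partial>M) = ennreal (expectation (\<lambda>\<omega>. (T k \<omega>)\<^sup>2))"
      unfolding eq using sum_sq[of "(Suc k)\<^sup>2"] by (intro nn_integral_eq_integral) auto
    also have "expectation (\<lambda>\<omega>. (T k \<omega>)\<^sup>2) = real ((Suc k)\<^sup>2) * s / (real ((Suc k)\<^sup>2))\<^sup>2"
      unfolding eq using sum_sq[of "(Suc k)\<^sup>2"] by simp
    also have "\<dots> = s * inverse ((real (Suc k))\<^sup>2)"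
      unfolding of_nat_power by (simp add: divide_simps power2_eq_square del: of_nat_Suc)
    finally show ?thesis .
  qed
  \<comment> \<open>In place of Borel-Cantelli: the whole series of squares has finite expectation,
    so it converges almost surely and its terms tend to 0.\<close>
  have "(\<integral>\<^sup>+\<omega>. (\<Sum>k. ennreal ((T k \<omega>)\<^sup>2)) \<partial>M) = (\<Sum>k. \<integral>\<^sup>+\<omega>. ennreal ((T k \<omega>)\<^sup>2) \<partial>M)"
    using T_meas by (intro nn_integral_suminf) auto
  also have "\<dots> = (\<Sum>k. ennreal (s * inverse ((real (Suc k))\<^sup>2)))"
    by (simp only: T_int)
  also have "\<dots> < \<infinity>"
  proof -
    have "summable (\<lambda>k. s * inverse ((real (Suc k))\<^sup>2))"
      by (intro summable_mult) (use inverse_power_summable[of 2, where 'a=real] in \<open>subst summable_Suc_iff, simp\<close>)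
    then show ?thesis
      using \<open>s \<ge> 0\<close> by (subst suminf_ennreal2) auto
  qed
  finally have "AE \<omega> in M. (\<Sum>k. ennreal ((T k \<omega>)\<^sup>2)) \<noteq> \<infinity>"
    using T_meas by (intro nn_integral_PInf_AE) auto
  then show ?thesis
  proof eventually_elim
    case (elim \<omega>)
    have "summable (\<lambda>k. (T k \<omega>)\<^sup>2)"
      using elim by (intro summable_suminf_not_top) auto
    then have "(\<lambda>k. (T k \<omega>)\<^sup>2) \<longlonglongrightarrow> 0" by (rule summable_LIMSEQ_zero)
    then have "T_0": "(\<lambda>k. T k \<omega>) \<longlonglongrightarrow> 0"
      by (simp add: tendsto_null_power tendsto_power_zero power2_eq_square)
         (use tendsto_real_sqrt[of "\<lambda>k. (T k \<omega>)\<^sup>2" 0 sequentially] in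
           \<open>simp add: power2_eq_square tendsto_rabs_zero_iff real_sqrt_mult_self flip: abs_square_eq_1\<close>)
    have "(\<Sum>i\<in>{1..(Suc k)\<^sup>2}. X i \<omega>) / real ((Suc k)\<^sup>2) = T k \<omega> + m" for k
      by (simp add: T_def Z_def sum_subtractf field_simps del: of_nat_power of_nat_Suc)
    then have "(\<lambda>k. (\<Sum>i\<in>{1..(Suc k)\<^sup>2}. X i \<omega>) / real ((Suc k)\<^sup>2)) \<longlonglongrightarrow> m"
      using tendsto_add[OF T_0 tendsto_const[of m]] by simp
    then have "(\<lambda>k. (\<Sum>i\<in>{1..k\<^sup>2}. X i \<omega>) / real (k\<^sup>2)) \<longlonglongrightarrow> m"
      by (rule LIMSEQ_imp_Suc)
    then show ?case
      by (rule averages_tendsto_of_squares[rotated 2])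
         (auto intro!: monoI sum_mono2 sum_nonneg nonneg)
  qed
qed

section \<open>Symmetric log-concave densities\<close>

text \<open>The functions \<open>exp \<psi>\<close> with \<open>\<psi>\<close> in \<open>SC0\<close>, described without extended reals.  Of the closedness
  of the hypograph only right-continuity on the negative half-line is kept: there \<open>g\<close> is increasing,
  so this is the same as upper semicontinuity.\<close>

definition slc :: "(real \<Rightarrow> real) \<Rightarrow> bool" where
  "slc g \<longleftrightarrow> (\<forall>x. 0 \<le> g x) \<and> (\<forall>x. g (- x) = g x) \<and> 0 < g 0 \<and>
     (\<forall>x y t. 0 < g x \<longrightarrow> 0 < g y \<longrightarrow> 0 \<le> t \<longrightarrow> t \<le> 1 \<longrightarrow>
        exp ((1 - t) * ln (g x) + t * ln (g y)) \<le> g ((1 - t) * x + t * y)) \<and>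
     (\<forall>x<0. (g \<longlongrightarrow> g x) (at_right x))"

text \<open>A monotone, right-continuous function determining \<open>g\<close>, to which Helly's theorem applies.\<close>

definition left_branch :: "(real \<Rightarrow> real) \<Rightarrow> real \<Rightarrow> real" where
  "left_branch g x = g (min x 0)"

context
  fixes g :: "real \<Rightarrow> real"
  assumes slc: "slc g"
begin

lemma slc_nonneg: "0 \<le> g x" and slc_sym: "g (- x) = g x" and slc_pos0: "0 < g 0"
  and slc_conc: "0 < g x \<Longrightarrow> 0 < g y \<Longrightarrow> 0 \<le> t \<Longrightarrow> t \<le> 1 \<Longrightarrow>
        exp ((1 - t) * ln (g x) + t * ln (g y)) \<le> g ((1 - t) * x + t * y)"
  and slc_rcont: "x < 0 \<Longrightarrow> (g \<longlongrightarrow> g x) (at_right x)"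
  using slc unfolding slc_def by auto

lemma slc_abs: "g \<bar>x\<bar> = g x"
  using slc_sym by (auto simp: abs_if)

lemma slc_conc_ln:
  assumes "0 < g x" "0 < g y" "0 \<le> t" "t \<le> 1"
  shows "0 < g ((1 - t) * x + t * y)"
    and "(1 - t) * ln (g x) + t * ln (g y) \<le> ln (g ((1 - t) * x + t * y))"
proof -
  show pos: "0 < g ((1 - t) * x + t * y)"
    using slc_conc[OF assms] exp_gt_zero less_le_trans by blast
  show "(1 - t) * ln (g x) + t * ln (g y) \<le> ln (g ((1 - t) * x + t * y))"
    using slc_conc[OF assms] pos by (simp add: ln_ge_iff)
qed

lemma slc_le_0: "g x \<le> g 0"
proof (cases "g x > 0")
  case True
  \<comment> \<open>\<open>0\<close> is the midpoint of \<open>x\<close> and \<open>- x\<close>, and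
    \<open>g\<close> takes the same value at both ends.\<close>
  have "(1 - 1/2) * ln (g x) + 1/2 * ln (g (- x)) \<le> ln (g ((1 - 1/2) * x + 1/2 * (- x)))"
    by (rule slc_conc_ln) (use True slc_sym in auto)
  then have "ln (g x) \<le> ln (g 0)" by (simp add: slc_sym)
  then show ?thesis using True slc_pos0 by simp
next
  case False
  then show ?thesis using slc_pos0 by linarith
qed

lemma slc_antimono:
  assumes "\<bar>x\<bar> \<le> \<bar>y\<bar>"
  shows "g y \<le> g x"
proof (cases "g y > 0 \<and> y \<noteq> 0")
  case True
  \<comment> \<open>\<open>\<bar>x\<bar>\<close> is a convex combination of 0, where
    \<open>ln g\<close> is largest, and \<open>\<bar>y\<bar>\<close>.\<close>
  define t where "t = \<bar>x\<bar> / \<bar>y\<bar>"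
  have t: "0 \<le> t" "t \<le> 1" using assms True by (auto simp: t_def divide_le_eq)
  have eq: "(1 - t) * 0 + t * \<bar>y\<bar> = \<bar>x\<bar>" using True by (simp add: t_def)
  have gy: "0 < g \<bar>y\<bar>" using True slc_abs by simp
  have pos: "0 < g x"
    using slc_conc_ln(1)[OF slc_pos0 gy t] unfolding eq slc_abs .
  have "ln (g y) \<le> (1 - t) * ln (g 0) + t * ln (g y)"
  proof -
    have "ln (g y) \<le> ln (g 0)" using slc_le_0[of y] True slc_pos0 by simp
    then have "(1 - t) * ln (g y) \<le> (1 - t) * ln (g 0)" using t by (intro mult_left_mono) auto
    then show ?thesis by (simp add: algebra_simps)
  qed
  also have "\<dots> \<le> ln (g x)"
    using slc_conc_ln(2)[OF slc_pos0 gy t] unfolding eq slc_abs .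
  finally show ?thesis using True pos by simp
next
  case False
  then show ?thesis
    using slc_nonneg[of y] slc_nonneg[of x] assms by (cases "y = 0") auto
qed

lemma slc_left_branch: "g x = left_branch g (- \<bar>x\<bar>)"
  by (auto simp: left_branch_def slc_sym abs_if)

lemma left_branch_mono: "mono (left_branch g)"
  unfolding left_branch_def by (intro monoI slc_antimono) auto

lemma left_branch_bounds: "0 \<le> left_branch g x" "left_branch g x \<le> g 0"
  by (auto simp: left_branch_def slc_nonneg slc_le_0)

lemma left_branch_rcont: "continuous (at_right x) (left_branch g)"
proof (cases "x < 0")
  case True
  have "(g \<longlongrightarrow> g x) (at_right x)" by (rule slc_rcont[OF True])
  moreover have "\<forall>\<^sub>F y in at_right x. g y = left_branch g y"
    unfolding eventually_at_right_field left_branch_def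
    by (intro exI[of _ 0]) (use True in auto)
  ultimately have "(left_branch g \<longlongrightarrow> g x) (at_right x)"
    by (rule Lim_transform_eventually)
  then show ?thesis using True by (simp add: continuous_within left_branch_def)
next
  case False
  have "\<forall>\<^sub>F y in at_right x. left_branch g y = g 0"
    unfolding eventually_at_right_field left_branch_def
    by (intro exI[of _ "x + 1"]) (use False in \<open>auto simp: min_def\<close>)
  then have "(left_branch g \<longlongrightarrow> g 0) (at_right x)" by (rule tendsto_eventually)
  moreover have "left_branch g x = g 0" using False by (simp add: left_branch_def min_def)
  ultimately show ?thesis by (simp add: continuous_within)
qed

lemma slc_measurable: "g \<in> borel_measurable borel"
proof -
  have "left_branch g \<in> borel_measurable borel"
    by (rule borel_measurable_mono[OF left_branch_mono])
  then have "(\<lambda>x. left_branch g (- \<bar>x\<bar>)) \<in> borel_measurable borel" by measurable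
  then show ?thesis by (simp add: slc_left_branch[symmetric])
qed

lemma slc_int_lower:
  assumes int: "(\<integral>\<^sup>+x. ennreal (g x) \<partial>lborel) = 1" and c: "\<And>y. \<bar>y\<bar> \<le> r \<Longrightarrow> c \<le> g y" and "0 \<le> r" "0 \<le> c"
  shows "2 * r * c \<le> 1"
proof -
  have "ennreal (2 * r * c) = (\<integral>\<^sup>+x. ennreal c * indicator {-r..r} x \<partial>lborel)"
    using \<open>0 \<le> r\<close> \<open>0 \<le> c\<close> by (simp add: nn_integral_cmult_indicator ennreal_mult mult.commute)
  also have "\<dots> \<le> (\<integral>\<^sup>+x. ennreal (g x) \<partial>lborel)"
    by (intro nn_integral_mono) (auto simp: indicator_def intro!: ennreal_leI c)
  finally show ?thesis using int by (simp add: ennreal_le_1)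
qed

text \<open>Unimodality and symmetry give \<open>2 \<bar>x\<bar> g x \<le> \<integral>g = 1\<close>, so \<open>ln g\<close> has dropped by at least 1 at
  distance \<open>exp (1 - ln (g 0))\<close>; concavity propagates this slope outwards.\<close>

lemma slc_exp_decay:
  assumes int: "(\<integral>\<^sup>+x. ennreal (g x) \<partial>lborel) = 1" and r: "exp (1 - ln (g 0)) \<le> r"
  shows "g x \<le> exp (ln (g 0) + 1 - \<bar>x\<bar> / r)"
proof -
  have r0: "0 < r" using r exp_gt_zero less_le_trans by blast
  have g0: "exp (ln (g 0)) = g 0" using slc_pos0 by simp
  show ?thesis
  proof (cases "\<bar>x\<bar> \<le> r")
    case True
    have "g x \<le> g 0" by (rule slc_le_0)
    also have "\<dots> = exp (ln (g 0))" using g0 by simp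
    also have "\<dots> \<le> exp (ln (g 0) + 1 - \<bar>x\<bar> / r)" using True r0 by (simp add: divide_le_eq)
    finally show ?thesis .
  next
    case False
    show ?thesis
    proof (cases "g x > 0")
      case True
      define t where "t = r / \<bar>x\<bar>"
      have t: "0 < t" "t \<le> 1" using r0 False by (auto simp: t_def)
      have gx: "0 < g \<bar>x\<bar>" using True slc_abs by simp
      have eq: "(1 - t) * 0 + t * \<bar>x\<bar> = r" using False r0 by (simp add: t_def)
      have pos: "0 < g r" using slc_conc_ln(1)[OF slc_pos0 gx, of t] t unfolding eq by simp
      have A: "(1 - t) * ln (g 0) + t * ln (g x) \<le> ln (g r)"
        using slc_conc_ln(2)[OF slc_pos0 gx, of t] t unfolding eq slc_abs by simp
      have "2 * r * g r \<le> 1"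
        using int by (rule slc_int_lower) (use r0 slc_nonneg in \<open>auto intro!: slc_antimono\<close>)
      \<comment> \<open>A factor 2 is given away here; the hypothesis on \<open>r\<close> enters as
        \<open>1 / r \<le> exp (ln (g 0) - 1)\<close>.\<close>
      then have "g r \<le> 1 / r * (1 / 2)" using r0 by (simp add: field_simps)
      also have "\<dots> \<le> 1 / r" using r0 by (intro mult_left_le) auto
      also have "\<dots> \<le> 1 / exp (1 - ln (g 0))" using r r0 by (intro divide_left_mono) auto
      also have "\<dots> = exp (ln (g 0) - 1)" by (simp add: exp_diff)
      finally have "ln (g r) \<le> ln (g 0) - 1" using pos by (metis ln_exp ln_le_cancel_iff exp_gt_zero)
      with A have "t * ln (g x) \<le> t * ln (g 0) - 1" by (simp add: algebra_simps)
      then have "t * (ln (g x) - ln (g 0)) \<le> - 1" by (simp add: algebra_simps)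
      then have "ln (g x) - ln (g 0) \<le> - 1 / t" using t by (simp add: field_simps)
      then have "ln (g x) \<le> ln (g 0) + 1 - \<bar>x\<bar> / r" by (simp add: t_def)
      then have "exp (ln (g x)) \<le> exp (ln (g 0) + 1 - \<bar>x\<bar> / r)" by (simp only: exp_le_cancel_iff)
      then show ?thesis using True by simp
    next
      case False
      then show ?thesis by (meson exp_ge_zero le_less_linear order_trans)
    qed
  qed
qed

text \<open>Shrinking by \<open>t\<close> reduces a drop \<open>t\<close> of \<open>ln g\<close> to
  a drop of at most 1: by concavity \<open>g\<close> is at least \<open>exp (ln (g 0) - 1)\<close>
  at \<open>\<bar>x\<bar> / t\<close>, hence on the whole interval of that radius, and the rectangle
  under it has area at most 1. The width grows linearly in \<open>t\<close> but shrinks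
  exponentially in \<open>ln (g 0)\<close>, which is what rules out high peaks later.\<close>

lemma slc_level_set_width:
  assumes int: "(\<integral>\<^sup>+x. ennreal (g x) \<partial>lborel) = 1" and "1 \<le> t" and gx: "0 < g x"
    and lev: "ln (g 0) - t \<le> ln (g x)"
  shows "\<bar>x\<bar> \<le> t * exp (1 - ln (g 0))"
proof -
  have t1: "0 \<le> 1 / t" "1 / t \<le> 1" using \<open>1 \<le> t\<close> by auto
  have gx': "0 < g \<bar>x\<bar>" using gx slc_abs by simp
  have "ln (g 0) - 1 \<le> (1 - 1 / t) * ln (g 0) + 1 / t * ln (g x)"
  proof -
    have "1 / t * (ln (g 0) - t) \<le> 1 / t * ln (g x)" using lev t1 by (intro mult_left_mono) auto
    then show ?thesis using \<open>1 \<le> t\<close> by (simp add: algebra_simps)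
  qed
  also have "\<dots> \<le> ln (g (\<bar>x\<bar> / t))"
    using slc_conc_ln(2)[OF slc_pos0 gx' t1] by (simp add: slc_abs)
  finally have le: "exp (ln (g 0) - 1) \<le> g (\<bar>x\<bar> / t)"
    using slc_conc_ln(1)[OF slc_pos0 gx' t1] by (simp add: ln_ge_iff)
  have "2 * (\<bar>x\<bar> / t) * exp (ln (g 0) - 1) \<le> 1"
  proof (rule slc_int_lower[OF int])
    fix y assume "\<bar>y\<bar> \<le> \<bar>x\<bar> / t"
    then have "g (\<bar>x\<bar> / t) \<le> g y" using \<open>1 \<le> t\<close> by (intro slc_antimono) auto
    then show "exp (ln (g 0) - 1) \<le> g y" using le by linarith
  qed (use \<open>1 \<le> t\<close> in auto)
  then have "(\<bar>x\<bar> / t) * exp (ln (g 0) - 1) \<le> 1"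
    using \<open>1 \<le> t\<close> by (simp add: field_simps)
  moreover have "exp (ln (g 0) - 1) = 1 / exp (1 - ln (g 0))" by (simp add: exp_diff)
  ultimately have "\<bar>x\<bar> / t \<le> exp (1 - ln (g 0))"
    by (simp only: mult_1_right times_divide_eq_right pos_divide_le_eq[OF exp_gt_zero] mult_1_left)
  then show ?thesis using \<open>1 \<le> t\<close> by (simp add: field_simps)
qed

end

section \<open>Monotone functions, continuity points and the limit at the peak\<close>

lemma nn_integral_lborel_shift:
  fixes f :: "real \<Rightarrow> ennreal"
  assumes "f \<in> borel_measurable borel"
  shows "(\<integral>\<^sup>+x. f (x - t) \<partial>lborel) = (\<integral>\<^sup>+x. f x \<partial>lborel)"
  using nn_integral_real_affine[OF assms, of 1 "- t"] by (simp add: add.commute[of "- t"] cong: nn_integral_cong)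

text \<open>Continuity points of \<open>H\<close> are dense, so \<open>z0\<close> is enclosed by two
  of them at which \<open>H\<close> is within \<open>e / 2\<close> of \<open>H z0\<close>; once
  \<open>z n\<close> lies between them, monotonicity traps \<open>h n (z n)\<close>. It serves
  twice: for data points minus the estimated centre, and for the points of largest deviation in the
  uniform convergence.\<close>

lemma mono_tendsto_at_moving_point:
  fixes h :: "nat \<Rightarrow> real \<Rightarrow> real"
  assumes mono: "\<And>n. mono (h n)" and H: "mono H"
    and conv: "\<And>x. isCont H x \<Longrightarrow> (\<lambda>n. h n x) \<longlonglongrightarrow> H x"
    and z: "z \<longlonglongrightarrow> z0" and cont: "isCont H z0"
  shows "(\<lambda>n. h n (z n)) \<longlonglongrightarrow> H z0"
proof (rule LIMSEQ_I)
  fix e :: real assume "0 < e"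
  have cnt: "countable {x. \<not> isCont H x}" by (rule mono_ctble_discont[OF H])
  have pick: "\<exists>x\<in>{a<..<b}. isCont H x" if "a < b" for a b :: real
  proof -
    have "uncountable {a<..<b}" using that by (simp add: uncountable_open_interval)
    then have "\<not> {a<..<b} \<subseteq> {x. \<not> isCont H x}" using cnt countable_subset by blast
    then show ?thesis by auto
  qed
  obtain d where d: "d > 0" "\<And>x. \<bar>x - z0\<bar> < d \<Longrightarrow> \<bar>H x - H z0\<bar> < e / 2"
    using cont \<open>0 < e\<close> unfolding continuous_at_eps_delta dist_real_def by (metis half_gt_zero)
  obtain a where a: "z0 - d < a" "a < z0" "isCont H a" using pick[of "z0 - d" z0] d by auto
  obtain b where b: "z0 < b" "b < z0 + d" "isCont H b" using pick[of z0 "z0 + d"] d by auto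
  have "\<forall>\<^sub>F n in sequentially. a < z n" "\<forall>\<^sub>F n in sequentially. z n < b"
    using z a b by (auto dest: order_tendstoD)
  moreover have "\<forall>\<^sub>F n in sequentially. \<bar>h n a - H a\<bar> < e / 2"
    using tendstoD[OF conv[OF a(3)], of "e/2"] \<open>0 < e\<close> by (simp add: dist_real_def)
  moreover have "\<forall>\<^sub>F n in sequentially. \<bar>h n b - H b\<bar> < e / 2"
    using tendstoD[OF conv[OF b(3)], of "e/2"] \<open>0 < e\<close> by (simp add: dist_real_def)
  ultimately have "\<forall>\<^sub>F n in sequentially. \<bar>h n (z n) - H z0\<bar> < e"
  proof eventually_elim
    case (elim n)
    have "h n a \<le> h n (z n)" "h n (z n) \<le> h n b"
      using elim monoD[OF mono] by auto
    moreover have "\<bar>H a - H z0\<bar> < e / 2" "\<bar>H b - H z0\<bar> < e / 2" using a b d(2)[of a] d(2)[of b] by auto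
    ultimately show ?case using elim by linarith
  qed
  then show "\<exists>no. \<forall>n\<ge>no. norm (h n (z n) - H z0) < e"
    by (simp add: eventually_sequentially)
qed

text \<open>By right-continuity a nonzero difference at \<open>z\<close> persists on an interval to
  its right, which is not a null set. The bound \<open>b\<close> confines the comparison to a
  half-line; both uses take \<open>b = 0\<close>, the range where \<open>left_branch\<close> carries
  information.\<close>

lemma right_continuous_eq_of_AE:
  fixes F G :: "real \<Rightarrow> real"
  assumes F: "continuous (at_right z) F" and G: "continuous (at_right z) G"
    and ae: "AE x in lborel. x < b \<longrightarrow> F x = G x" and "z < b"
  shows "F z = G z"
proof (rule ccontr)
  assume "F z \<noteq> G z"
  have "((\<lambda>x. F x - G x) \<longlongrightarrow> F z - G z) (at_right z)"
    using F G by (auto intro!: tendsto_diff simp: continuous_within)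
  then have "\<forall>\<^sub>F x in at_right z. F x - G x \<noteq> 0"
    by (rule tendsto_imp_eventually_ne) (use \<open>F z \<noteq> G z\<close> in auto)
  then obtain c where c: "c > z" "\<And>x. z < x \<Longrightarrow> x < c \<Longrightarrow> F x \<noteq> G x"
    unfolding eventually_at_right_field by auto
  define c' where "c' = min c b"
  have "AE x in lborel. x \<notin> {z<..<c'}"
    using ae by eventually_elim (use c in \<open>auto simp: c'_def\<close>)
  then have "emeasure lborel {z<..<c'} = 0"
    by (subst (asm) AE_iff_measurable[of "{z<..<c'}"]) auto
  then show False using c \<open>z < b\<close> by (auto simp: c'_def)
qed

lemma tendsto_if_subseq:
  fixes x :: "nat \<Rightarrow> 'b::metric_space"
  assumes "\<And>r :: nat \<Rightarrow> nat. strict_mono r \<Longrightarrow> \<exists>s. strict_mono (s :: nat \<Rightarrow> nat) \<and> (\<lambda>n. x (r (s n))) \<longlonglongrightarrow> l"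
  shows "x \<longlonglongrightarrow> l"
proof (rule ccontr)
  assume "\<not> x \<longlonglongrightarrow> l"
  then obtain e where e: "e > 0" "\<not> (\<forall>\<^sub>F n in sequentially. dist (x n) l < e)"
    unfolding tendsto_iff by auto
  then have "\<exists>\<^sub>F n in sequentially. e \<le> dist (x n) l"
    by (simp add: not_eventually not_less)
  then have inf: "infinite {n. e \<le> dist (x n) l}"
    by (simp add: cofinite_eq_sequentially[symmetric] frequently_cofinite)
  obtain r :: "nat \<Rightarrow> nat" where r: "strict_mono r" "\<And>n. r n \<in> {n. e \<le> dist (x n) l}"
    using infinite_enumerate[OF inf] by blast
  obtain s where s: "strict_mono (s :: nat \<Rightarrow> nat)" "(\<lambda>n. x (r (s n))) \<longlonglongrightarrow> l"
    using assms[OF r(1)] by blast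
  have "\<forall>\<^sub>F n in sequentially. dist (x (r (s n))) l < e" using s(2) e(1) by (rule tendstoD)
  then obtain n where "dist (x (r (s n))) l < e" by (auto simp: eventually_sequentially)
  with r(2)[of "s n"] show False by simp
qed

text \<open>Each \<open>c\<close> in \<open>S\<close> excludes only countably many \<open>x\<close>,
  while an interval is uncountable. Several multiples are handled at once because the argument at
  the peak needs both \<open>x\<close> and \<open>2 * x\<close> to be continuity points.\<close>

lemma isCont_point_between:
  fixes h :: "real \<Rightarrow> real"
  assumes h: "mono h" and "a < b" and "finite S" "0 \<notin> S"
  shows "\<exists>x\<in>{a<..<b}. \<forall>c\<in>S. isCont h (c * x)"
proof -
  have "countable {x. \<not> isCont h (c * x)}" if "c \<in> S" for c
  proof (rule countable_subset)
    have "c \<noteq> 0" using that assms by auto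
    then show "{x. \<not> isCont h (c * x)} \<subseteq> (\<lambda>y. y / c) ` {x. \<not> isCont h x}"
      by (auto simp: image_iff intro!: exI[of _ "c * _"])
    show "countable ((\<lambda>y. y / c) ` {x. \<not> isCont h x})"
      using mono_ctble_discont[OF h] by simp
  qed
  then have "countable (\<Union>c\<in>S. {x. \<not> isCont h (c * x)})"
    using \<open>finite S\<close> by (intro countable_UN) (auto intro: countable_finite)
  moreover have "uncountable {a<..<b}" using \<open>a < b\<close> by (simp add: uncountable_open_interval)
  ultimately have "\<not> {a<..<b} \<subseteq> (\<Union>c\<in>S. {x. \<not> isCont h (c * x)})"
    using countable_subset by blast
  then show ?thesis by auto
qed

lemma slc_pos_somewhere:
  assumes "slc g" "(\<integral>\<^sup>+x. ennreal (g x) \<partial>lborel) = 1"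
  shows "\<exists>x<0. 0 < g x"
proof (rule ccontr)
  assume "\<not> ?thesis"
  then have neg: "g x = 0" if "x < 0" for x using that slc_nonneg[OF assms(1), of x] by fastforce
  have "g x = 0" if "x \<noteq> 0" for x
    using neg[of x] neg[of "- x"] that slc_sym[OF assms(1), of x] by (cases "x < 0") auto
  then have "AE x in lborel. ennreal (g x) = 0"
    using AE_lborel_singleton[of "0::real"] by (auto elim!: eventually_mono)
  then have "(\<integral>\<^sup>+x. ennreal (g x) \<partial>lborel) = (\<integral>\<^sup>+x. 0 \<partial>(lborel :: real measure))"
    by (rule nn_integral_cong_AE)
  then show False using assms(2) by simp
qed

text \<open>\<open>- ln g\<close> is convex on an open convex set, hence continuous there; jumps of
  \<open>g\<close> can only sit at the ends of its support.\<close>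

lemma slc_isCont_interior:
  assumes g: "slc g" and x: "x \<in> interior {x. 0 < g x}"
  shows "isCont g x"
proof -
  let ?S = "interior {x. 0 < g x}"
  have conv: "convex {x. 0 < g x}"
    unfolding convex_alt by (auto intro: slc_conc_ln(1)[OF g, simplified])
  have pos: "0 < g y" if "y \<in> ?S" for y using that interior_subset by blast
  have "convex_on ?S (\<lambda>x. - ln (g x))"
  proof (rule convex_onI)
    fix t y z :: real assume "0 < t" "t < 1" "y \<in> ?S" "z \<in> ?S"
    then show "- ln (g ((1 - t) *\<^sub>R y + t *\<^sub>R z)) \<le> (1 - t) * - ln (g y) + t * - ln (g z)"
      using slc_conc_ln(2)[OF g pos pos, of y z t] by simp
  qed (rule convex_interior[OF conv])
  then have "continuous_on ?S (\<lambda>x. - ln (g x))"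
    by (rule convex_on_continuous[OF open_interior])
  then have "continuous_on ?S (\<lambda>x. exp (- (- ln (g x))))"
    by (rule continuous_on_exp[OF continuous_on_minus])
  then have "continuous_on ?S g"
    by (rule continuous_on_eq) (auto simp: pos)
  then show ?thesis
    using x by (auto simp: continuous_on_eq_continuous_at[OF open_interior])
qed

lemma slc_isCont_0:
  assumes "slc g" "(\<integral>\<^sup>+x. ennreal (g x) \<partial>lborel) = 1"
  shows "isCont g 0"
proof (rule slc_isCont_interior[OF assms(1)])
  obtain y where y: "y < 0" "0 < g y" using slc_pos_somewhere[OF assms] by blast
  have "{y<..<-y} \<subseteq> {x. 0 < g x}"
    using y by (auto intro!: less_le_trans[OF y(2) slc_antimono[OF assms(1)]])
  then show "0 \<in> interior {x. 0 < g x}"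
    using y by (intro interiorI[of "{y<..<-y}"]) auto
qed

text \<open>Convergence left of 0 leaves room for ever thinner spikes at 0. Log-concavity forbids
  them: \<open>x\<close> is the midpoint of 0 and \<open>2 * x\<close>, so
  \<open>g n 0 * g n (2 * x) \<le> (g n x)^2\<close>. The resulting upper bound for
  \<open>g n 0\<close> tends to \<open>(g0 x)^2 / g0 (2 * x)\<close>, which is close to
  \<open>g0 0\<close> for small \<open>x\<close> because \<open>g0\<close> is continuous at 0. The
  lower bound is just \<open>g n x \<le> g n 0\<close>.\<close>

lemma slc_tendsto_0:
  assumes g: "\<And>n. slc (g n)" and g0: "slc g0" "(\<integral>\<^sup>+x. ennreal (g0 x) \<partial>lborel) = 1"
    and conv: "\<And>x. x < 0 \<Longrightarrow> isCont (left_branch g0) x \<Longrightarrow> (\<lambda>n. g n x) \<longlonglongrightarrow> g0 x"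
  shows "(\<lambda>n. g n 0) \<longlonglongrightarrow> g0 0"
proof (rule LIMSEQ_I)
  fix e :: real assume e: "0 < e"
  have "isCont (\<lambda>x. g0 x) 0" by (rule slc_isCont_0[OF g0])
  then have c1: "(g0 \<longlongrightarrow> g0 0) (at_left 0)"
    by (simp add: isCont_def filterlim_at_split)
  have "isCont (\<lambda>x. g0 (2 * x)) 0"
    by (rule isCont_o2[where f="\<lambda>x. 2 * x" and g=g0]) (use slc_isCont_0[OF g0] in auto)
  then have c2: "((\<lambda>x. g0 (2 * x)) \<longlongrightarrow> g0 0) (at_left 0)"
    by (simp add: isCont_def filterlim_at_split)
  have c3: "((\<lambda>x. (g0 x)\<^sup>2 / g0 (2 * x)) \<longlongrightarrow> (g0 0)\<^sup>2 / g0 0) (at_left 0)"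
    using slc_pos0[OF g0(1)] by (intro tendsto_intros c1 c2) auto
  have c3': "((\<lambda>x. (g0 x)\<^sup>2 / g0 (2 * x)) \<longlongrightarrow> g0 0) (at_left 0)"
    using c3 slc_pos0[OF g0(1)] by (simp add: power2_eq_square)
  have "\<forall>\<^sub>F x in at_left 0. g0 0 - e < g0 x \<and> 0 < g0 (2 * x) \<and> (g0 x)\<^sup>2 / g0 (2 * x) < g0 0 + e"
    using order_tendstoD(1)[OF c1, of "g0 0 - e"] order_tendstoD(1)[OF c2, of 0]
      order_tendstoD(2)[OF c3', of "g0 0 + e"] slc_pos0[OF g0(1)] e by (auto intro!: eventually_conj)
  then obtain b where b: "b < 0" and bx: "\<And>x. b < x \<Longrightarrow> x < 0 \<Longrightarrow>
      g0 0 - e < g0 x \<and> 0 < g0 (2 * x) \<and> (g0 x)\<^sup>2 / g0 (2 * x) < g0 0 + e"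
    unfolding eventually_at_left_field by auto
  obtain x where x: "b < x" "x < 0" "isCont (left_branch g0) x" "isCont (left_branch g0) (2 * x)"
    using isCont_point_between[OF left_branch_mono[OF g0(1)] b, of "{1, 2}"] by auto
  have l1: "(\<lambda>n. g n x) \<longlonglongrightarrow> g0 x" using conv x by auto
  have l2: "(\<lambda>n. g n (2 * x)) \<longlonglongrightarrow> g0 (2 * x)" using conv x by auto
  have pos: "0 < g0 (2 * x)" using bx x by auto
  have l3: "(\<lambda>n. (g n x)\<^sup>2 / g n (2 * x)) \<longlonglongrightarrow> (g0 x)\<^sup>2 / g0 (2 * x)"
    using pos by (intro tendsto_intros l1 l2) auto
  have "\<forall>\<^sub>F n in sequentially. g0 0 - e < g n x" using order_tendstoD(1)[OF l1] bx x by auto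
  moreover have "\<forall>\<^sub>F n in sequentially. (g n x)\<^sup>2 / g n (2 * x) < g0 0 + e"
    using order_tendstoD(2)[OF l3] bx x by auto
  moreover have "\<forall>\<^sub>F n in sequentially. 0 < g n (2 * x)" using order_tendstoD(1)[OF l2 pos] by auto
  ultimately have "\<forall>\<^sub>F n in sequentially. norm (g n 0 - g0 0) < e"
  proof eventually_elim
    case (elim n)
    have "0 < g n x" using elim slc_antimono[OF g, of x "2 * x" n] by linarith
    have "(1 - 1/2) * ln (g n 0) + 1/2 * ln (g n (2 * x)) \<le> ln (g n ((1 - 1/2) * 0 + 1/2 * (2 * x)))"
      by (rule slc_conc_ln[OF g]) (use elim slc_pos0[OF g] in auto)
    then have "ln (g n 0 * g n (2 * x)) \<le> ln ((g n x)\<^sup>2)"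
      using elim slc_pos0[OF g, of n] \<open>0 < g n x\<close> by (simp add: ln_mult ln_realpow)
    then have "g n 0 * g n (2 * x) \<le> (g n x)\<^sup>2"
      using elim slc_pos0[OF g, of n] \<open>0 < g n x\<close> by (subst (asm) ln_le_cancel_iff) auto
    then have "g n 0 \<le> (g n x)\<^sup>2 / g n (2 * x)" using elim by (simp add: le_divide_eq)
    moreover have "g n x \<le> g n 0" by (rule slc_le_0[OF g])
    ultimately show ?case using elim by auto
  qed
  then show "\<exists>no. \<forall>n\<ge>no. norm (g n 0 - g0 0) < e" by (simp add: eventually_sequentially)
qed

section \<open>Integrability of the entropy, equality in Gibbs' inequality, uniqueness of the
  centre\<close>

lemma integrable_exp_minus_abs:
  assumes "0 < b"
  shows "integrable lborel (\<lambda>x::real. exp (- b * \<bar>x\<bar>))"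
proof -
  interpret prob_space "density lborel (exponential_density b)"
    by (rule prob_space_exponential_density[OF assms])
  have dens: "integrable lborel (exponential_density b)"
  proof (rule integrableI_nn_integral_finite)
    show "(\<integral>\<^sup>+x. ennreal (exponential_density b x) \<partial>lborel) = ennreal 1"
      using emeasure_space_1 by (simp add: emeasure_density cong: nn_integral_cong)
  qed (use assms in \<open>auto simp: exponential_density_def\<close>)
  \<comment> \<open>The reflected density covers the negative half-line.\<close>
  then have dens': "integrable lborel (\<lambda>x. exponential_density b (0 + (-1) * x))"
    by (intro lborel_integrable_real_affine) auto
  show ?thesis
  proof (rule Bochner_Integration.integrable_bound)
    show "integrable lborel (\<lambda>x. 1 / b * (exponential_density b x + exponential_density b (0 + (-1) * x)))"
      by (intro integrable_mult_right Bochner_Integration.integrable_add dens dens')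
    show "AE x in lborel. norm (exp (- b * \<bar>x\<bar>)) \<le> norm (1 / b * (exponential_density b x + exponential_density b (0 + (-1) * x)))"
    proof (intro AE_I2)
      fix x :: real
      have "b * exp (- b * \<bar>x\<bar>) \<le> exponential_density b x + exponential_density b (0 + (-1) * x)"
        using assms by (auto simp: exponential_density_def abs_if mult.commute)
      then show "norm (exp (- b * \<bar>x\<bar>)) \<le> norm (1 / b * (exponential_density b x + exponential_density b (0 + (-1) * x)))"
        using assms by (simp add: le_divide_eq mult.commute order_trans[OF _ abs_ge_self])
    qed
  qed auto
qed

text \<open>With \<open>y = s^4\<close> the logarithm is \<open>4 * ln s\<close>, and
  \<open>\<bar>ln s\<bar> \<le> s + 1 / s\<close>. Fourth roots are taken so that a factor
  \<open>sqrt y\<close> is left over: for bounded \<open>y\<close> the right side is at most a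
  multiple of \<open>sqrt y\<close>, and exponential decay survives a square root at half the
  rate.\<close>

lemma x_ln_sq_le:
  fixes y :: real assumes "0 \<le> y"
  shows "y * (ln y)\<^sup>2 \<le> 16 * sqrt y * (1 + sqrt y)\<^sup>2"
proof (cases "y = 0")
  case False
  define s where "s = sqrt (sqrt y)"
  have s: "0 < s" "sqrt y = s\<^sup>2" "y = s ^ 4"
    using False assms by (auto simp: s_def) (metis (no_types) power2_eq_square real_sqrt_pow2 assms real_sqrt_ge_zero power4_eq_xxxx mult.assoc)
  have ln: "ln y = 4 * ln s" using s by (simp add: ln_realpow)
  have "ln s \<le> s" using s(1) ln_le_minus_one[of s] by linarith
  moreover have "- ln s \<le> 1 / s" using s(1) ln_le_minus_one[of "1 / s"] by (simp add: ln_div)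
  moreover have "0 < 1 / s" using s by simp
  ultimately have "\<bar>ln s\<bar> \<le> s + 1 / s" using s(1) by linarith
  then have "(ln s)\<^sup>2 \<le> (s + 1 / s)\<^sup>2" by (simp add: abs_le_square_iff[symmetric])
  then have "y * (ln y)\<^sup>2 \<le> y * (16 * (s + 1 / s)\<^sup>2)"
    unfolding ln using assms by (intro mult_left_mono) (auto simp: power_mult_distrib)
  also have "\<dots> = 16 * s\<^sup>2 * (1 + s\<^sup>2)\<^sup>2"
    unfolding s(3) using s(1) by (simp add: field_simps power2_eq_square power4_eq_xxxx)
  finally show ?thesis by (simp add: s(2))
qed simp

text \<open>The squared logarithm is the second moment that the strong law for \<open>ln g0\<close>
  asks for. It is dominated by a multiple of \<open>sqrt (g x)\<close>, hence by an exponential of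
  half the decay rate; the first power then follows from
  \<open>\<bar>u\<bar> \<le> 1 + u^2\<close>.\<close>

lemma slc_entropy_integrable:
  assumes "slc g" "(\<integral>\<^sup>+x. ennreal (g x) \<partial>lborel) = 1"
  shows "integrable lborel (\<lambda>x. g x * (ln (g x))\<^sup>2)" and "integrable lborel (\<lambda>x. g x * ln (g x))"
proof -
  have [measurable]: "g \<in> borel_measurable borel" by (rule slc_measurable[OF assms(1)])
  define r where "r = exp (1 - ln (g 0))"
  define K where "K = 16 * (1 + sqrt (g 0))\<^sup>2 * exp ((ln (g 0) + 1) / 2)"
  have r: "0 < r" by (simp add: r_def)
  have bound: "g x * (ln (g x))\<^sup>2 \<le> K * exp (- (1 / (2 * r)) * \<bar>x\<bar>)" for x
  proof -
    have nn: "0 \<le> g x" "0 \<le> g 0" by (auto simp: slc_nonneg[OF assms(1)])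
    have "g x * (ln (g x))\<^sup>2 \<le> 16 * sqrt (g x) * (1 + sqrt (g x))\<^sup>2" by (rule x_ln_sq_le[OF nn(1)])
    also have "\<dots> \<le> 16 * sqrt (g x) * (1 + sqrt (g 0))\<^sup>2"
      using nn slc_le_0[OF assms(1), of x] by (intro mult_left_mono power_mono) auto
    also have "\<dots> = 16 * (1 + sqrt (g 0))\<^sup>2 * sqrt (g x)" by simp
    also have "\<dots> \<le> 16 * (1 + sqrt (g 0))\<^sup>2 * (exp ((ln (g 0) + 1) / 2) * exp (- (1 / (2 * r)) * \<bar>x\<bar>))"
    proof (intro mult_left_mono)
      have "sqrt (g x) \<le> sqrt (exp (ln (g 0) + 1 - \<bar>x\<bar> / r))"
        using slc_exp_decay[OF assms, of r x] by (simp add: r_def)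
      also have "\<dots> = exp ((ln (g 0) + 1) / 2) * exp (- (1 / (2 * r)) * \<bar>x\<bar>)"
        by (rule real_sqrt_unique) (auto simp: power2_eq_square exp_add[symmetric] field_simps)
      finally show "sqrt (g x) \<le> exp ((ln (g 0) + 1) / 2) * exp (- (1 / (2 * r)) * \<bar>x\<bar>)" .
    qed auto
    finally show ?thesis by (simp add: K_def mult_ac)
  qed
  show sq: "integrable lborel (\<lambda>x. g x * (ln (g x))\<^sup>2)"
  proof (rule Bochner_Integration.integrable_bound)
    show "integrable lborel (\<lambda>x. K * exp (- (1 / (2 * r)) * \<bar>x\<bar>))"
      using r by (intro integrable_mult_right integrable_exp_minus_abs) auto
    show "AE x in lborel. norm (g x * (ln (g x))\<^sup>2) \<le> norm (K * exp (- (1 / (2 * r)) * \<bar>x\<bar>))"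
      using bound slc_nonneg[OF assms(1)] by (auto simp: abs_of_nonneg intro: order_trans[OF _ abs_ge_self])
  qed auto
  have g: "integrable lborel g"
    using assms by (intro integrableI_nn_integral_finite[where x=1]) (auto simp: slc_nonneg)
  show "integrable lborel (\<lambda>x. g x * ln (g x))"
  proof (rule Bochner_Integration.integrable_bound[OF Bochner_Integration.integrable_add[OF g sq]])
    have "\<bar>u\<bar> \<le> 1 + u\<^sup>2" for u :: real
      using zero_le_power2[of "\<bar>u\<bar> - 1"] zero_le_power2[of u]
      by (simp add: power2_diff)
    then have "g x * \<bar>ln (g x)\<bar> \<le> g x * (1 + (ln (g x))\<^sup>2)" for x
      by (intro mult_left_mono slc_nonneg[OF assms(1)]) auto
    then show "AE x in lborel. norm (g x * ln (g x)) \<le> norm (g x + g x * (ln (g x))\<^sup>2)"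
      using slc_nonneg[OF assms(1)] by (auto simp: abs_mult algebra_simps)
  qed auto
qed

text \<open>Where \<open>f\<close> is positive, the integrand \<open>D\<close> is \<open>f\<close>
  times \<open>q - 1 - ln q\<close> with \<open>q = k / f\<close>, which is nonnegative and vanishes
  only for \<open>q = 1\<close>; where \<open>f\<close> vanishes, \<open>D\<close> is
  \<open>k\<close>. The hypothesis \<open>ge\<close> says that \<open>D\<close> has integral at most
  0. No mass is fixed to 1, so the lemma applies to limits that may have lost mass and to
  competitors in the criterion, which subtracts the mass itself.\<close>

lemma gibbs_equality:
  fixes f k :: "real \<Rightarrow> real"
  assumes f: "integrable lborel f" "\<And>x. 0 \<le> f x" and k: "integrable lborel k" "\<And>x. 0 \<le> k x"
    and pos: "AE x in lborel. 0 < f x \<longrightarrow> 0 < k x"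
    and int: "integrable lborel (\<lambda>x. f x * ln (f x))" "integrable lborel (\<lambda>x. f x * ln (k x))"
    and ge: "(\<integral>x. f x * ln (f x) \<partial>lborel) + (\<integral>x. k x \<partial>lborel) - (\<integral>x. f x \<partial>lborel)
              \<le> (\<integral>x. f x * ln (k x) \<partial>lborel)"
  shows "AE x in lborel. k x = f x"
proof -
  define D where "D x = k x - f x - f x * ln (k x) + f x * ln (f x)" for x
  have Deq: "D x = f x * (k x / f x - 1 - ln (k x / f x))" if "0 < f x" "0 < k x" for x
    using that by (simp add: D_def ln_div algebra_simps)
  have D_nonneg: "AE x in lborel. 0 \<le> D x"
    using pos
  proof eventually_elim
    case (elim x)
    show ?case
    proof (cases "0 < f x")
      case True
      have "ln (k x / f x) \<le> k x / f x - 1" by (rule ln_le_minus_one) (use True elim in auto)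
      then show ?thesis using Deq[of x] True elim by simp
    next
      case False
      then show ?thesis using f(2)[of x] k(2)[of x] by (simp add: D_def not_less)
    qed
  qed
  have D_int: "integrable lborel D"
    unfolding D_def using f k int by auto
  have "(\<integral>x. D x \<partial>lborel) = (\<integral>x. k x \<partial>lborel) - (\<integral>x. f x \<partial>lborel) - (\<integral>x. f x * ln (k x) \<partial>lborel)
      + (\<integral>x. f x * ln (f x) \<partial>lborel)"
    unfolding D_def using f k int by simp
  then have "(\<integral>x. D x \<partial>lborel) \<le> 0" using ge by simp
  moreover have "0 \<le> (\<integral>x. D x \<partial>lborel)" using D_nonneg by (rule integral_nonneg_AE)
  ultimately have "AE x in lborel. D x = 0"
    using integral_nonneg_eq_0_iff_AE[OF D_int D_nonneg] by simp
  then show ?thesis using pos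
  proof eventually_elim
    case (elim x)
    show ?case
    proof (cases "0 < f x")
      case True
      then have "ln (k x / f x) = k x / f x - 1" using Deq[of x] elim by simp
      then have "k x / f x = 1" using True elim by (intro ln_eq_minus_one) auto
      then show ?thesis using True by simp
    next
      case False
      then have "f x = 0" using f(2)[of x] by simp
      then show ?thesis using elim by (simp add: D_def)
    qed
  qed
qed

text \<open>Two centres of symmetry would make the density periodic, contradicting its decay.\<close>

lemma slc_centre_unique:
  assumes g: "slc g" "(\<integral>\<^sup>+x. ennreal (g x) \<partial>lborel) = 1"
    and ae: "AE x in lborel. K \<bar>x - b\<bar> = g (x - a)"
  shows "a = (b::real)"
proof (rule ccontr)
  assume "a \<noteq> b"
  have [measurable]: "g \<in> borel_measurable borel" by (rule slc_measurable[OF g(1)])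
  \<comment> \<open>Reflection at \<open>a\<close> followed by reflection at \<open>b\<close> is the
    translation by \<open>d\<close>.\<close>
  define d where "d = 2 * (b - a)"
  obtain N where N: "N \<in> null_sets lborel" "{x. K \<bar>x - b\<bar> \<noteq> g (x - a)} \<subseteq> N"
    using ae unfolding eventually_ae_filter by auto
  have AEN: "AE x in lborel. x \<notin> N" using N(1) by (rule AE_not_in)
  have Nm: "N \<in> sets borel" using N(1) by auto
  have shift: "AE x in lborel. t + c * x \<notin> N" if "c \<noteq> 0" for t c :: real
    using AEN that Nm by (intro AE_borel_affine) auto
  \<comment> \<open>The symmetry about \<open>b\<close> holds only off a null set, so the whole
    orbit \<open>x + n * d\<close> and its mirror images must avoid \<open>N\<close> at once; these
    are countably many affine conditions.\<close>
  have "AE x in lborel. \<forall>n::nat. (x + real n * d) + a \<notin> N \<and> 2 * b - (x + real n * d) - a \<notin> N"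
    unfolding AE_all_countable
  proof
    fix n
    show "AE x in lborel. (x + real n * d) + a \<notin> N \<and> 2 * b - (x + real n * d) - a \<notin> N"
      using shift[of 1 "real n * d + a", OF one_neq_zero]
        shift[of "-1" "2 * b - real n * d - a", OF iffD2[OF neg_equal_0_iff_equal[THEN arg_cong[where f=Not]] one_neq_zero]]
      by eventually_elim (auto simp: algebra_simps)
  qed
  then have "AE x in lborel. g x = 0"
  proof eventually_elim
    case (elim x)
    have per: "g (y - d) = g y" if "y + a \<notin> N" "2 * b - y - a \<notin> N" for y
    proof -
      have "g y = K \<bar>y + a - b\<bar>" using that(1) N(2) by force
      also have "\<bar>y + a - b\<bar> = \<bar>(2 * b - y - a) - b\<bar>" by simp
      also have "K \<dots> = g (2 * b - y - a - a)" using that(2) N(2) by force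
      also have "\<dots> = g (y - d)" using slc_sym[OF g(1), of "y - d"] by (simp add: d_def algebra_simps)
      finally show ?thesis by simp
    qed
    have it: "g (x + real n * d) = g (x - d)" for n
    proof (induction n)
      case 0
      then show ?case using per[of x] elim[rule_format, of 0] by simp
    next
      case (Suc n)
      have eq: "g (x + real (Suc n) * d - d) = g (x + real (Suc n) * d)"
        by (rule per) (use elim[rule_format, of "Suc n"] in auto)
      have "x + real (Suc n) * d - d = x + real n * d" by (simp add: algebra_simps)
      then show ?case using eq Suc by (simp only:)
    qed
    have gx: "g (x - d) = g x" using per[of x] elim[rule_format, of 0] by simp
    define r where "r = exp (1 - ln (g 0))"
    have r: "0 < r" by (simp add: r_def)
    have bd: "g x \<le> exp (ln (g 0) + 1 - \<bar>x + real n * d\<bar> / r)" for n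
      using slc_exp_decay[OF g, of r "x + real n * d"] it[of n] gx by (simp add: r_def)
    have "(\<lambda>n. exp (ln (g 0) + 1 - \<bar>x + real n * d\<bar> / r)) \<longlonglongrightarrow> 0"
    proof -
      have "d \<noteq> 0" using \<open>a \<noteq> b\<close> by (simp add: d_def)
      have "filterlim (\<lambda>n. real n * (\<bar>d\<bar> / r)) at_top sequentially"
        using \<open>d \<noteq> 0\<close> r
        by (intro filterlim_at_top_mult_tendsto_pos[OF tendsto_const _ filterlim_real_sequentially]) auto
      then have "filterlim (\<lambda>n. (- \<bar>x\<bar> / r - ln (g 0) - 1) + real n * (\<bar>d\<bar> / r)) at_top sequentially"
        by (rule filterlim_tendsto_add_at_top[OF tendsto_const])
      then have "filterlim (\<lambda>n. \<bar>x + real n * d\<bar> / r - ln (g 0) - 1) at_top sequentially"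
      proof (rule filterlim_at_top_mono, intro always_eventually allI)
        fix n
        have "real n * \<bar>d\<bar> - \<bar>x\<bar> \<le> \<bar>x + real n * d\<bar>"
          using abs_mult[of "real n" d] by simp
        then have "(real n * \<bar>d\<bar> - \<bar>x\<bar>) / r \<le> \<bar>x + real n * d\<bar> / r" using r by (intro divide_right_mono) auto
        then show "(- \<bar>x\<bar> / r - ln (g 0) - 1) + real n * (\<bar>d\<bar> / r) \<le> \<bar>x + real n * d\<bar> / r - ln (g 0) - 1"
          by (simp add: diff_divide_distrib)
      qed
      then have "filterlim (\<lambda>n. - (\<bar>x + real n * d\<bar> / r - ln (g 0) - 1)) at_bot sequentially"
        by (simp add: filterlim_uminus_at_bot)
      then have "(\<lambda>n. exp (- (\<bar>x + real n * d\<bar> / r - ln (g 0) - 1))) \<longlonglongrightarrow> 0"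
        by (rule filterlim_compose[OF exp_at_bot])
      then show ?thesis by (simp add: algebra_simps)
    qed
    then have "g x \<le> 0" using bd by (intro LIMSEQ_le_const) auto
    then show ?case using slc_nonneg[OF g(1), of x] by simp
  qed
  then have "(\<integral>\<^sup>+x. ennreal (g x) \<partial>lborel) = (\<integral>\<^sup>+x. 0 \<partial>(lborel :: real measure))"
    by (intro nn_integral_cong_AE) (auto elim: eventually_mono)
  then show False using g(2) by simp
qed

section \<open>Consistency under a coupling\<close>

lemma (in prob_space) prob_tendsto_0:
  assumes meas: "\<And>n. {\<omega> \<in> space M. P n \<omega>} \<in> events"
    and ev: "\<And>\<omega>. \<omega> \<in> space M \<Longrightarrow> \<forall>\<^sub>F n in sequentially. \<not> P n \<omega>"
  shows "(\<lambda>n. prob {\<omega> \<in> space M. P n \<omega>}) \<longlonglongrightarrow> 0"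
proof -
  have "(\<lambda>n. \<integral>\<omega>. indicator {\<omega> \<in> space M. P n \<omega>} \<omega> \<partial>M) \<longlonglongrightarrow> (\<integral>\<omega>. (0::real) \<partial>M)"
  proof (rule integral_dominated_convergence[where w="\<lambda>_. 1"])
    show "AE \<omega> in M. (\<lambda>n. indicator {\<omega> \<in> space M. P n \<omega>} \<omega> :: real) \<longlonglongrightarrow> 0"
    proof (rule AE_I2)
      fix \<omega> assume "\<omega> \<in> space M"
      from ev[OF this] show "(\<lambda>n. indicator {\<omega> \<in> space M. P n \<omega>} \<omega> :: real) \<longlonglongrightarrow> 0"
        by (rule tendsto_eventually[OF eventually_mono]) auto
    qed
  qed (use meas in auto)
  then show ?thesis using meas by simp
qed

text \<open>\<open>Y n\<close> stands for a draw from the \<open>n\<close>-th empirical distribution and \<open>Y0\<close> for a draw from the true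
  one, realised by Skorohod's theorem on one space with pointwise convergence.  \<open>a n\<close> is the average
  log-likelihood of the truth, which the estimator cannot fall below.\<close>

locale coupled_sample = prob_space N for N :: "'c measure" +
  fixes Y :: "nat \<Rightarrow> 'c \<Rightarrow> real" and Y0 :: "'c \<Rightarrow> real" and g0 :: "real \<Rightarrow> real" and \<theta>0 :: real
    and g :: "nat \<Rightarrow> real \<Rightarrow> real" and \<theta> :: "nat \<Rightarrow> real" and a :: "nat \<Rightarrow> real"
  assumes Y_meas [measurable]: "\<And>n. Y n \<in> borel_measurable N"
    and Y0_meas [measurable]: "Y0 \<in> borel_measurable N"
    and Y_lim: "\<And>\<omega>. \<omega> \<in> space N \<Longrightarrow> (\<lambda>n. Y n \<omega>) \<longlonglongrightarrow> Y0 \<omega>"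
    and Y0_distr: "distr N borel Y0 = density lborel (\<lambda>x. ennreal (g0 (x - \<theta>0)))"
    and g0: "slc g0" and g0_int: "(\<integral>\<^sup>+x. ennreal (g0 x) \<partial>lborel) = 1"
    and g: "\<And>n. slc (g n)" and g_int: "\<And>n. (\<integral>\<^sup>+x. ennreal (g n x) \<partial>lborel) = 1"
    and pos: "\<And>n. AE \<omega> in N. 0 < g n (Y n \<omega> - \<theta> n)"
    and ln_int: "\<And>n. integrable N (\<lambda>\<omega>. ln (g n (Y n \<omega> - \<theta> n)))"
    and a_le: "\<And>n. a n \<le> (\<integral>\<omega>. ln (g n (Y n \<omega> - \<theta> n)) \<partial>N)"
    and a_lim: "a \<longlonglongrightarrow> (\<integral>x. g0 x * ln (g0 x) \<partial>lborel)"
begin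

definition A :: "nat \<Rightarrow> real" where
  "A n = (\<integral>\<omega>. ln (g n (Y n \<omega> - \<theta> n)) \<partial>N)"

definition L0 :: real where
  "L0 = (\<integral>x. g0 x * ln (g0 x) \<partial>lborel)"

definition R :: real where
  "R = exp (2 - L0)"

lemma R_pos: "0 < R" by (simp add: R_def)

lemma g0_meas [measurable]: "g0 \<in> borel_measurable borel" by (rule slc_measurable[OF g0])
lemma g_meas [measurable]: "g n \<in> borel_measurable borel" by (rule slc_measurable[OF g])

lemma A_ge: "\<forall>\<^sub>F n in sequentially. L0 - 1 \<le> A n"
proof -
  have "\<forall>\<^sub>F n in sequentially. L0 - 1 < a n"
    using a_lim by (rule order_tendstoD) (simp add: L0_def)
  then show ?thesis
  proof eventually_elim
    case (elim n)
    then show ?case using a_le[of n] by (simp add: A_def)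
  qed
qed

lemma A_le_peak: "A n \<le> ln (g n 0)"
proof -
  have "AE \<omega> in N. ln (g n (Y n \<omega> - \<theta> n)) \<le> ln (g n 0)"
    using pos[of n] by eventually_elim (use slc_le_0[OF g, of n] slc_pos0[OF g, of n] in auto)
  then show ?thesis unfolding A_def using ln_int[of n] by (intro integral_le_const)
qed

text \<open>A two-valued bound for the log-likelihood integrates to this. The sign of
  \<open>d\<close> is left open: a tall peak gives a gain on a rare event (\<open>d > 0\<close>), a
  remote centre a loss on a frequent one (\<open>d < 0\<close>).\<close>

lemma A_le_of_event:
  assumes E: "{\<omega> \<in> space N. E \<omega>} \<in> events"
    and le: "\<And>\<omega>. 0 < g n (Y n \<omega> - \<theta> n) \<Longrightarrow> ln (g n (Y n \<omega> - \<theta> n)) \<le> (if E \<omega> then c + d else c)"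
  shows "A n \<le> c + d * prob {\<omega> \<in> space N. E \<omega>}"
proof -
  have "A n \<le> (\<integral>\<omega>. c + d * indicator {\<omega> \<in> space N. E \<omega>} \<omega> \<partial>N)"
    unfolding A_def
  proof (rule integral_mono_AE[OF ln_int])
    show "integrable N (\<lambda>\<omega>. c + d * indicator {\<omega> \<in> space N. E \<omega>} \<omega>)"
      using E by (auto intro!: integrable_mult_right integrable_real_indicator simp: less_top[symmetric])
    show "AE \<omega> in N. ln (g n (Y n \<omega> - \<theta> n)) \<le> c + d * indicator {\<omega> \<in> space N. E \<omega>} \<omega>"
      using pos[of n] AE_space by eventually_elim (use le in \<open>fastforce simp: indicator_def\<close>)
  qed
  also have "\<dots> = c + d * prob {\<omega> \<in> space N. E \<omega>}"
    using E by (subst Bochner_Integration.integral_add)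
      (auto intro!: integrable_mult_right integrable_real_indicator simp: prob_space less_top[symmetric])
  finally show ?thesis .
qed

lemma Y_near_Y0:
  assumes "0 < \<delta>"
  shows "(\<lambda>n. prob {\<omega> \<in> space N. \<delta> < \<bar>Y n \<omega> - Y0 \<omega>\<bar>}) \<longlonglongrightarrow> 0"
proof (rule prob_tendsto_0)
  fix \<omega> assume "\<omega> \<in> space N"
  from tendstoD[OF Y_lim[OF this] assms]
  show "\<forall>\<^sub>F n in sequentially. \<not> \<delta> < \<bar>Y n \<omega> - Y0 \<omega>\<bar>"
    by (rule eventually_mono) (simp add: dist_real_def)
qed measurable

text \<open>The true density is bounded by \<open>g0 0\<close>. The bound is uniform in the location
  \<open>t\<close>, as it has to be: it is applied at \<open>\<theta> n\<close> while nothing is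
  known yet about the centres.\<close>

lemma Y0_interval:
  assumes "0 \<le> w"
  shows "prob {\<omega> \<in> space N. \<bar>Y0 \<omega> - t\<bar> \<le> w} \<le> 2 * w * g0 0"
proof -
  have "emeasure N {\<omega> \<in> space N. \<bar>Y0 \<omega> - t\<bar> \<le> w} = emeasure (distr N borel Y0) {t - w..t + w}"
    by (subst emeasure_distr) (auto intro!: arg_cong[where f="emeasure N"])
  also have "\<dots> = (\<integral>\<^sup>+x. ennreal (g0 (x - \<theta>0)) * indicator {t - w..t + w} x \<partial>lborel)"
    unfolding Y0_distr by (subst emeasure_density) auto
  also have "\<dots> \<le> (\<integral>\<^sup>+x. ennreal (g0 0) * indicator {t - w..t + w} x \<partial>lborel)"
    by (intro nn_integral_mono mult_right_mono ennreal_leI slc_le_0[OF g0]) auto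
  also have "\<dots> = ennreal (2 * w * g0 0)"
    using assms slc_nonneg[OF g0, of 0]
    by (simp add: nn_integral_cmult_indicator ennreal_mult[symmetric] mult.commute)
  finally show ?thesis
    using assms slc_nonneg[OF g0, of 0] by (simp add: emeasure_eq_measure)
qed

text \<open>If the peak \<open>m = ln (g n 0)\<close> is large, the set where \<open>ln (g n) \<ge> - 2 m\<close> is too short to carry more than
  half of the sample, and the log-likelihood is at most \<open>- m / 2\<close>.\<close>

lemma peak_bounded: "\<exists>C. \<forall>\<^sub>F n in sequentially. ln (g n 0) \<le> C"
proof -
  define B where "B = g0 0"
  have B: "0 < B" unfolding B_def by (rule slc_pos0[OF g0])
  \<comment> \<open>\<open>3 * m * exp (1 - m)\<close> is the width that
    \<open>slc_level_set_width\<close> gives for a drop of \<open>3 * m\<close> from the peak. Below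
    \<open>1 / (16 * B)\<close>, and with the same allowance for \<open>Y n\<close> against
    \<open>Y0\<close>, an interval has probability at most 1/4; another 1/4 is spent on the event
    that they differ by more.\<close>
  have "((\<lambda>m. 3 * exp 1 * (m ^ 1 / exp m)) \<longlongrightarrow> 3 * exp 1 * (0::real)) at_top"
    by (intro tendsto_intros tendsto_power_div_exp_0)
  then have "((\<lambda>m::real. 3 * m * exp (1 - m)) \<longlongrightarrow> 0) at_top"
    by (simp add: exp_diff mult_ac)
  then have "\<forall>\<^sub>F m in at_top. 3 * m * exp (1 - m) < 1 / (16 * B)"
    by (rule order_tendstoD) (use B in auto)
  then obtain C0 where C0: "\<And>m. C0 \<le> m \<Longrightarrow> 3 * m * exp (1 - m) < 1 / (16 * B)"
    unfolding eventually_at_top_linorder by auto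
  \<comment> \<open>Beyond \<open>3 - 2 * L0\<close> the bound \<open>- m / 2\<close> falls below
    \<open>L0 - 1\<close>, contradicting \<open>A_ge\<close>; \<open>m \<ge> 1\<close> makes the
    drop \<open>3 * m\<close> admissible for the level set bound.\<close>
  define C where "C = max C0 (max 1 (3 - 2 * L0))"
  have "\<forall>\<^sub>F n in sequentially. prob {\<omega> \<in> space N. 1 / (16 * B) < \<bar>Y n \<omega> - Y0 \<omega>\<bar>} < 1 / 4"
    by (rule order_tendstoD[OF Y_near_Y0]) (use B in auto)
  then have "\<forall>\<^sub>F n in sequentially. ln (g n 0) \<le> C"
    using A_ge
  proof eventually_elim
    case (elim n)
    show ?case
    proof (rule ccontr)
      define m where "m = ln (g n 0)"
      define w where "w = 3 * m * exp (1 - m)"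
      assume "\<not> ln (g n 0) \<le> C"
      then have m: "C0 \<le> m" "1 \<le> m" "3 - 2 * L0 < m" by (auto simp: C_def m_def)
      have w: "0 \<le> w" "w < 1 / (16 * B)" using C0[OF m(1)] m by (auto simp: w_def)
      let ?E = "{\<omega> \<in> space N. \<bar>Y n \<omega> - \<theta> n\<bar> \<le> w}"
      have "prob ?E \<le> prob ({\<omega> \<in> space N. 1 / (16 * B) < \<bar>Y n \<omega> - Y0 \<omega>\<bar>}
              \<union> {\<omega> \<in> space N. \<bar>Y0 \<omega> - \<theta> n\<bar> \<le> w + 1 / (16 * B)})"
        by (intro finite_measure_mono) auto
      also have "\<dots> \<le> prob {\<omega> \<in> space N. 1 / (16 * B) < \<bar>Y n \<omega> - Y0 \<omega>\<bar>}
              + prob {\<omega> \<in> space N. \<bar>Y0 \<omega> - \<theta> n\<bar> \<le> w + 1 / (16 * B)}"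
        by (intro measure_Un_le) auto
      also have "\<dots> \<le> 1 / 4 + 2 * (w + 1 / (16 * B)) * B"
        unfolding B_def by (intro add_mono Y0_interval) (use elim w B in \<open>auto simp: B_def\<close>)
      also have "\<dots> \<le> 1 / 4 + 2 * (1 / (16 * B) + 1 / (16 * B)) * B"
        using w B by (intro add_left_mono mult_right_mono mult_left_mono add_mono) auto
      also have "\<dots> = 1 / 2" using B by (simp add: field_simps)
      finally have half: "prob ?E \<le> 1 / 2" .
      have "A n \<le> (m - 3 * m) + 3 * m * prob ?E"
      proof (rule A_le_of_event)
        fix \<omega> assume p: "0 < g n (Y n \<omega> - \<theta> n)"
        show "ln (g n (Y n \<omega> - \<theta> n)) \<le> (if \<bar>Y n \<omega> - \<theta> n\<bar> \<le> w then m - 3 * m + 3 * m else m - 3 * m)"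
        proof (cases "\<bar>Y n \<omega> - \<theta> n\<bar> \<le> w")
          case True
          then show ?thesis
            using p slc_le_0[OF g, of n "Y n \<omega> - \<theta> n"] slc_pos0[OF g, of n] by (simp add: m_def)
        next
          case False
          have "\<not> m - 3 * m \<le> ln (g n (Y n \<omega> - \<theta> n))"
          proof
            assume "m - 3 * m \<le> ln (g n (Y n \<omega> - \<theta> n))"
            then have "\<bar>Y n \<omega> - \<theta> n\<bar> \<le> w"
              using slc_level_set_width[OF g g_int, of "3 * m" n "Y n \<omega> - \<theta> n"] m p
              by (simp add: w_def m_def)
            with False show False ..
          qed
          then show ?thesis using False by simp
        qed
      qed measurable
      also have "\<dots> \<le> (m - 3 * m) + 3 * m * (1 / 2)"
        using half m by (intro add_left_mono mult_left_mono) auto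
      finally show False using elim(2) m by simp
    qed
  qed
  then show ?thesis by blast
qed

lemma decay: "\<forall>\<^sub>F n in sequentially. \<forall>x. g n x \<le> exp (ln (g n 0) + 1 - \<bar>x\<bar> / R)"
  using A_ge
proof eventually_elim
  case (elim n)
  have "exp (1 - ln (g n 0)) \<le> R"
    using elim A_le_peak[of n] by (simp add: R_def)
  then show ?case using slc_exp_decay[OF g g_int] by blast
qed

lemma Y_tight: "\<exists>S. \<forall>\<^sub>F n in sequentially. 1 / 2 \<le> prob {\<omega> \<in> space N. \<bar>Y n \<omega>\<bar> \<le> S}"
proof -
  have "(\<lambda>k. prob {\<omega> \<in> space N. real k < \<bar>Y0 \<omega>\<bar>}) \<longlonglongrightarrow> 0"
  proof (rule prob_tendsto_0)
    fix \<omega>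
    obtain k0 where "\<bar>Y0 \<omega>\<bar> \<le> real k0" using real_arch_simple by blast
    then show "\<forall>\<^sub>F k in sequentially. \<not> real k < \<bar>Y0 \<omega>\<bar>"
      by (auto simp: eventually_sequentially intro!: exI[of _ k0])
  qed measurable
  then have "\<forall>\<^sub>F k in sequentially. prob {\<omega> \<in> space N. real k < \<bar>Y0 \<omega>\<bar>} < 1 / 4"
    by (rule order_tendstoD) auto
  then obtain k :: nat where k: "prob {\<omega> \<in> space N. real k < \<bar>Y0 \<omega>\<bar>} < 1 / 4"
    by (auto simp: eventually_sequentially)
  have "\<forall>\<^sub>F n in sequentially. prob {\<omega> \<in> space N. 1 < \<bar>Y n \<omega> - Y0 \<omega>\<bar>} < 1 / 4"
    by (rule order_tendstoD[OF Y_near_Y0]) auto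
  then have "\<forall>\<^sub>F n in sequentially. 1 / 2 \<le> prob {\<omega> \<in> space N. \<bar>Y n \<omega>\<bar> \<le> real k + 1}"
  proof eventually_elim
    case (elim n)
    have "1 - prob {\<omega> \<in> space N. \<bar>Y n \<omega>\<bar> \<le> real k + 1} = prob (space N - {\<omega> \<in> space N. \<bar>Y n \<omega>\<bar> \<le> real k + 1})"
      by (rule prob_compl[symmetric]) measurable
    also have "\<dots> \<le> prob ({\<omega> \<in> space N. 1 < \<bar>Y n \<omega> - Y0 \<omega>\<bar>} \<union> {\<omega> \<in> space N. real k < \<bar>Y0 \<omega>\<bar>})"
      by (intro finite_measure_mono) auto
    also have "\<dots> \<le> prob {\<omega> \<in> space N. 1 < \<bar>Y n \<omega> - Y0 \<omega>\<bar>} + prob {\<omega> \<in> space N. real k < \<bar>Y0 \<omega>\<bar>}"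
      by (intro measure_Un_le) auto
    finally show ?case using elim k by linarith
  qed
  then show ?thesis by blast
qed

text \<open>At least half of the sample stays in \<open>[-S, S]\<close>. A centre outside puts all
  of it at distance at least \<open>\<bar>\<theta> n\<bar> - S\<close>, and since the peak is
  already bounded, the tail bound makes the log-likelihood fall linearly in that distance,
  eventually below \<open>L0 - 1\<close>.\<close>

lemma centre_bounded: "\<exists>T. \<forall>\<^sub>F n in sequentially. \<bar>\<theta> n\<bar> \<le> T"
proof -
  obtain C where C: "\<forall>\<^sub>F n in sequentially. ln (g n 0) \<le> C" using peak_bounded by blast
  obtain S where S: "\<forall>\<^sub>F n in sequentially. 1 / 2 \<le> prob {\<omega> \<in> space N. \<bar>Y n \<omega>\<bar> \<le> S}"
    using Y_tight by blast
  \<comment> \<open>From \<open>L0 - 1 \<le> C + 1 - q / 2\<close> with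
    \<open>q = (\<bar>\<theta> n\<bar> - S) / R\<close>, solved for
    \<open>\<bar>\<theta> n\<bar>\<close>; the maximum with \<open>S\<close> keeps \<open>q\<close>
    positive.\<close>
  define T where "T = max S (S + 2 * R * (C + 2 - L0))"
  have "\<forall>\<^sub>F n in sequentially. \<bar>\<theta> n\<bar> \<le> T"
    using C S A_ge decay
  proof eventually_elim
    case (elim n)
    show ?case
    proof (rule ccontr)
      assume "\<not> \<bar>\<theta> n\<bar> \<le> T"
      then have T: "S < \<bar>\<theta> n\<bar>" "S + 2 * R * (C + 2 - L0) < \<bar>\<theta> n\<bar>" by (auto simp: T_def)
      define q where "q = (\<bar>\<theta> n\<bar> - S) / R"
      have q: "0 < q" using T R_pos by (simp add: q_def)
      let ?E = "{\<omega> \<in> space N. \<bar>Y n \<omega>\<bar> \<le> S}"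
      have "A n \<le> (C + 1) + (- q) * prob ?E"
      proof (rule A_le_of_event)
        fix \<omega> assume p: "0 < g n (Y n \<omega> - \<theta> n)"
        have "ln (g n (Y n \<omega> - \<theta> n)) \<le> ln (exp (ln (g n 0) + 1 - \<bar>Y n \<omega> - \<theta> n\<bar> / R))"
          using elim(4) p by (subst ln_le_cancel_iff) auto
        then have le: "ln (g n (Y n \<omega> - \<theta> n)) \<le> C + 1 - \<bar>Y n \<omega> - \<theta> n\<bar> / R"
          using elim(1) by simp
        show "ln (g n (Y n \<omega> - \<theta> n)) \<le> (if \<bar>Y n \<omega>\<bar> \<le> S then C + 1 + - q else C + 1)"
        proof (cases "\<bar>Y n \<omega>\<bar> \<le> S")
          case True
          have "q \<le> \<bar>Y n \<omega> - \<theta> n\<bar> / R"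
            unfolding q_def using True R_pos by (intro divide_right_mono) auto
          then show ?thesis using le True by simp
        next
          case False
          have "0 \<le> \<bar>Y n \<omega> - \<theta> n\<bar> / R" using R_pos by simp
          then show ?thesis using le False by simp
        qed
      qed measurable
      moreover have "q * (1 / 2) \<le> q * prob ?E" using elim(2) q by (intro mult_left_mono) auto
      ultimately have "q \<le> 2 * (C + 2 - L0)" using elim(3) by simp
      then have "\<bar>\<theta> n\<bar> - S \<le> 2 * (C + 2 - L0) * R"
        unfolding q_def using R_pos by (simp add: pos_divide_le_eq)
      then show False using T by (simp add: mult_ac)
    qed
  qed
  then show ?thesis by blast
qed

end

section \<open>Identification of subsequential limits\<close>

lemma mono_isCont_ends:
  fixes H :: "real \<Rightarrow> real"
  assumes "mono H"
  shows "\<exists>y<x. isCont H y" "\<exists>y>x. isCont H y"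
  using isCont_point_between[OF assms, of "x - 1" x "{1}"] isCont_point_between[OF assms, of x "x + 1" "{1}"]
  by (auto simp: greaterThanLessThan_iff)

lemma AE_isCont_mono_abs:
  fixes H :: "real \<Rightarrow> real"
  assumes "mono H"
  shows "AE x in lborel. isCont H (- \<bar>x - t\<bar>)"
proof -
  let ?D = "{x. \<not> isCont H x}"
  have "countable ((\<lambda>z. t + z) ` ?D \<union> (\<lambda>z. t - z) ` ?D)"
    using mono_ctble_discont[OF assms] by simp
  then have "(\<lambda>z. t + z) ` ?D \<union> (\<lambda>z. t - z) ` ?D \<in> null_sets lborel"
    by (rule countable_imp_null_set_lborel)
  then show ?thesis
  proof (rule AE_I')
    show "{x \<in> space lborel. \<not> isCont H (- \<bar>x - t\<bar>)} \<subseteq> (\<lambda>z. t + z) ` ?D \<union> (\<lambda>z. t - z) ` ?D"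
    proof
      fix x assume x: "x \<in> {x \<in> space lborel. \<not> isCont H (- \<bar>x - t\<bar>)}"
      show "x \<in> (\<lambda>z. t + z) ` ?D \<union> (\<lambda>z. t - z) ` ?D"
      proof (cases "t \<le> x")
        case True
        then show ?thesis using x by (intro UnI2 image_eqI[of _ _ "t - x"]) auto
      next
        case False
        then show ?thesis using x by (intro UnI1 image_eqI[of _ _ "x - t"]) auto
      qed
    qed
  qed
qed

context coupled_sample
begin

definition f0 :: "real \<Rightarrow> real" where
  "f0 x = g0 (x - \<theta>0)"

lemma f0_meas [measurable]: "f0 \<in> borel_measurable borel"
  unfolding f0_def by measurable

lemma f0_nonneg: "0 \<le> f0 x"
  by (simp add: f0_def slc_nonneg[OF g0])

lemma f0_int: "integrable lborel f0" "(\<integral>x. f0 x \<partial>lborel) = 1"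
proof -
  have "(\<integral>\<^sup>+x. ennreal (f0 x) \<partial>lborel) = ennreal 1"
    unfolding f0_def using nn_integral_lborel_shift[of "\<lambda>x. ennreal (g0 x)" \<theta>0] g0_int by simp
  then show "integrable lborel f0" "(\<integral>x. f0 x \<partial>lborel) = 1"
    by (auto intro!: integrableI_nn_integral_finite integral_eq_nn_integral[THEN trans] simp: f0_nonneg)
qed

lemma f0_ln: "integrable lborel (\<lambda>x. f0 x * ln (f0 x))" "(\<integral>x. f0 x * ln (f0 x) \<partial>lborel) = L0"
  using lborel_integrable_real_affine[OF slc_entropy_integrable(2)[OF g0 g0_int], of 1 "- \<theta>0"]
    lborel_integral_real_affine[of 1 "\<lambda>x. g0 x * ln (g0 x)" "- \<theta>0"]
  by (simp_all add: f0_def L0_def add.commute[of "- \<theta>0"] cong: Bochner_Integration.integral_cong)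

lemma expectation_Y0:
  assumes [measurable]: "\<phi> \<in> borel_measurable borel"
  shows "integrable N (\<lambda>\<omega>. \<phi> (Y0 \<omega>)) \<longleftrightarrow> integrable lborel (\<lambda>x. f0 x * \<phi> x)"
    and "(\<integral>\<omega>. \<phi> (Y0 \<omega>) \<partial>N) = (\<integral>x. f0 x * \<phi> x \<partial>lborel)"
proof -
  have d: "distr N borel Y0 = density lborel (\<lambda>x. ennreal (f0 x))" by (simp add: Y0_distr f0_def)
  show "integrable N (\<lambda>\<omega>. \<phi> (Y0 \<omega>)) \<longleftrightarrow> integrable lborel (\<lambda>x. f0 x * \<phi> x)"
    using integrable_distr_eq[OF Y0_meas, of \<phi>] unfolding d
    by (simp add: integrable_density f0_nonneg)
  show "(\<integral>\<omega>. \<phi> (Y0 \<omega>) \<partial>N) = (\<integral>x. f0 x * \<phi> x \<partial>lborel)"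
    using integral_distr[OF Y0_meas, of \<phi>] unfolding d
    by (simp add: integral_density f0_nonneg)
qed

text \<open>Fatou's lemma is used twice: the limit \<open>k\<close> has mass at most 1, and its expected log-likelihood is at
  least that of \<open>f0\<close>; the equality case of Gibbs' inequality then forces \<open>k = f0\<close>.\<close>

lemma subsequence_identify:
  assumes u: "strict_mono u" and t: "(\<lambda>n. \<theta> (u n)) \<longlonglongrightarrow> t"
    and H: "mono H"
    and conv: "\<And>x. isCont H x \<Longrightarrow> (\<lambda>n. left_branch (g (u n)) x) \<longlonglongrightarrow> H x"
    and peak: "\<And>n. ln (g (u n) 0) \<le> C"
  shows "AE x in lborel. H (- \<bar>x - t\<bar>) = f0 x" and "(\<lambda>n. A (u n)) \<longlonglongrightarrow> L0"
proof -
  define k where "k x = H (- \<bar>x - t\<bar>)" for x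
  have [measurable]: "H \<in> borel_measurable borel" by (rule borel_measurable_mono[OF H])
  have k_meas [measurable]: "k \<in> borel_measurable borel" unfolding k_def by measurable
  have peak': "g (u n) 0 \<le> exp C" for n
    using peak[of n] slc_pos0[OF g, of "u n"] by (metis exp_le_cancel_iff exp_ln)
  have H_nonneg: "0 \<le> H x" for x
  proof -
    obtain y where y: "y < x" "isCont H y" using mono_isCont_ends(1)[OF H] by blast
    have "0 \<le> H y" by (rule LIMSEQ_le_const[OF conv[OF y(2)]]) (auto simp: left_branch_bounds[OF g])
    also have "H y \<le> H x" using y by (intro monoD[OF H]) auto
    finally show ?thesis .
  qed
  have H_le: "H x \<le> exp C" for x
  proof -
    obtain y where y: "x < y" "isCont H y" using mono_isCont_ends(2)[OF H] by blast
    have "H x \<le> H y" using y by (intro monoD[OF H]) auto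
    also have "H y \<le> exp C"
      by (rule LIMSEQ_le_const2[OF conv[OF y(2)]]) (auto intro: order_trans[OF left_branch_bounds(2)[OF g] peak'])
    finally show ?thesis .
  qed
  have k_nonneg: "0 \<le> k x" for x by (simp add: k_def H_nonneg)

  \<comment> \<open>Only an inequality is claimed, because mass might escape in the limit; Gibbs'
    inequality needs no more.\<close>
  have fatou_k: "(\<integral>\<^sup>+x. ennreal (k x) \<partial>lborel) \<le> 1"
  proof -
    have "AE x in lborel. ennreal (k x) = liminf (\<lambda>n. ennreal (g (u n) (x - t)))"
      using AE_isCont_mono_abs[OF H, of t]
    proof eventually_elim
      case (elim x)
      have "(\<lambda>n. ennreal (g (u n) (x - t))) \<longlonglongrightarrow> ennreal (k x)"
        using conv[OF elim] unfolding k_def slc_left_branch[OF g, symmetric] by (rule tendsto_ennrealI)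
      then show ?case by (simp add: lim_imp_Liminf)
    qed
    then have "(\<integral>\<^sup>+x. ennreal (k x) \<partial>lborel) = (\<integral>\<^sup>+x. liminf (\<lambda>n. ennreal (g (u n) (x - t))) \<partial>lborel)"
      by (rule nn_integral_cong_AE)
    also have "\<dots> \<le> liminf (\<lambda>n. \<integral>\<^sup>+x. ennreal (g (u n) (x - t)) \<partial>lborel)"
      by (rule nn_integral_liminf) measurable
    also have "\<dots> = 1"
      using nn_integral_lborel_shift[of "\<lambda>x. ennreal (g (u _) x)" t] g_int by (simp add: Liminf_const)
    finally show ?thesis .
  qed
  have k_int: "integrable lborel k"
    by (rule integrableI_bounded) (use fatou_k in \<open>auto simp: k_nonneg intro: le_less_trans\<close>)
  have k_le_1: "(\<integral>x. k x \<partial>lborel) \<le> 1"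
    using fatou_k by (subst (asm) nn_integral_eq_integral[OF k_int]) (auto simp: k_nonneg ennreal_le_1)

  \<comment> \<open>\<open>C\<close> makes the integrand nonnegative, as Fatou's lemma requires.
    \<open>L0 + 2\<close> keeps \<open>C' - L0 - e'\<close> positive for every
    \<open>e' \<le> 1\<close>, so that inequalities in \<open>ennreal\<close> translate back to real
    ones.\<close>
  define C' where "C' = max C (L0 + 2)"
  define \<phi> where "\<phi> n \<omega> = ennreal (C' - ln (g (u n) (Y (u n) \<omega> - \<theta> (u n))))" for n \<omega>
  \<comment> \<open>The real logarithm does not become infinite at 0, so the value
    \<open>\<infinity>\<close> is assigned by hand. Finiteness of the integral of
    \<open>\<Phi>\<close> then shows that \<open>k\<close> is almost surely positive at
    \<open>Y0\<close>.\<close>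
  define \<Phi> where "\<Phi> \<omega> = (if 0 < k (Y0 \<omega>) then ennreal (C' - ln (k (Y0 \<omega>))) else \<infinity>)" for \<omega>
  have lim: "AE \<omega> in N. liminf (\<lambda>n. \<phi> n \<omega>) = \<Phi> \<omega>"
  proof -
    have "AE \<omega> in N. isCont H (- \<bar>Y0 \<omega> - t\<bar>)"
      by (rule AE_distrD[OF Y0_meas], unfold Y0_distr, subst AE_density)
         (use AE_isCont_mono_abs[OF H, of t] in \<open>auto elim: eventually_mono\<close>)
    moreover have "AE \<omega> in N. \<forall>n. 0 < g (u n) (Y (u n) \<omega> - \<theta> (u n))"
      unfolding AE_all_countable using pos by auto
    ultimately show ?thesis using AE_space
    proof eventually_elim
      case (elim \<omega>)
      have "(\<lambda>n. Y (u n) \<omega>) \<longlonglongrightarrow> Y0 \<omega>"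
        using LIMSEQ_subseq_LIMSEQ[OF Y_lim[OF elim(3)] u] by (simp add: o_def)
      then have "(\<lambda>n. - \<bar>Y (u n) \<omega> - \<theta> (u n)\<bar>) \<longlonglongrightarrow> - \<bar>Y0 \<omega> - t\<bar>"
        by (intro tendsto_intros t)
      then have "(\<lambda>n. left_branch (g (u n)) (- \<bar>Y (u n) \<omega> - \<theta> (u n)\<bar>)) \<longlonglongrightarrow> H (- \<bar>Y0 \<omega> - t\<bar>)"
        by (intro mono_tendsto_at_moving_point[OF _ H conv _ elim(1)] left_branch_mono[OF g])
      then have gl: "(\<lambda>n. g (u n) (Y (u n) \<omega> - \<theta> (u n))) \<longlonglongrightarrow> k (Y0 \<omega>)"
        unfolding slc_left_branch[OF g, symmetric] k_def .
      have "(\<lambda>n. \<phi> n \<omega>) \<longlonglongrightarrow> \<Phi> \<omega>"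
      proof (cases "0 < k (Y0 \<omega>)")
        case True
        then show ?thesis unfolding \<phi>_def \<Phi>_def using gl by (auto intro!: tendsto_intros)
      next
        case False
        then have "(\<lambda>n. g (u n) (Y (u n) \<omega> - \<theta> (u n))) \<longlonglongrightarrow> 0"
          using gl k_nonneg[of "Y0 \<omega>"] by simp
        then have "filterlim (\<lambda>n. g (u n) (Y (u n) \<omega> - \<theta> (u n))) (at_right 0) sequentially"
          using elim(2) by (auto simp: filterlim_at intro!: always_eventually) (metis less_irrefl)
        then have "filterlim (\<lambda>n. ln (g (u n) (Y (u n) \<omega> - \<theta> (u n)))) at_bot sequentially"
          by (rule filterlim_compose[OF ln_at_0])
        then have "filterlim (\<lambda>n. C' + - ln (g (u n) (Y (u n) \<omega> - \<theta> (u n)))) at_top sequentially"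
          by (intro filterlim_tendsto_add_at_top[OF tendsto_const]) (simp add: filterlim_uminus_at_top)
        then have "filterlim (\<lambda>n. C' - ln (g (u n) (Y (u n) \<omega> - \<theta> (u n)))) at_top sequentially"
          by simp
        then show ?thesis
          using False by (simp add: \<phi>_def \<Phi>_def ennreal_tendsto_top_eq_at_top)
      qed
      then show ?case by (simp add: lim_imp_Liminf)
    qed
  qed
  have \<phi>_int: "(\<integral>\<^sup>+\<omega>. \<phi> n \<omega> \<partial>N) = ennreal (C' - A (u n))" for n
  proof -
    have "(\<integral>\<^sup>+\<omega>. \<phi> n \<omega> \<partial>N) = ennreal (\<integral>\<omega>. C' - ln (g (u n) (Y (u n) \<omega> - \<theta> (u n))) \<partial>N)"
      unfolding \<phi>_def
    proof (rule nn_integral_eq_integral)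
      show "AE \<omega> in N. 0 \<le> C' - ln (g (u n) (Y (u n) \<omega> - \<theta> (u n)))"
        using pos[of "u n"]
      proof eventually_elim
        case (elim \<omega>)
        have "ln (g (u n) (Y (u n) \<omega> - \<theta> (u n))) \<le> ln (g (u n) 0)"
          using elim slc_le_0[OF g, of "u n"] slc_pos0[OF g, of "u n"] by simp
        then show ?case using peak[of n] by (simp add: C'_def)
      qed
    qed (use ln_int in auto)
    then show ?thesis using ln_int by (simp add: A_def prob_space)
  qed
  have fatou: "(\<integral>\<^sup>+\<omega>. \<Phi> \<omega> \<partial>N) \<le> liminf (\<lambda>n. ennreal (C' - A (u n)))"
  proof -
    have "(\<integral>\<^sup>+\<omega>. \<Phi> \<omega> \<partial>N) = (\<integral>\<^sup>+\<omega>. liminf (\<lambda>n. \<phi> n \<omega>) \<partial>N)"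
      using lim by (intro nn_integral_cong_AE) (auto elim: eventually_mono)
    also have "\<dots> \<le> liminf (\<lambda>n. \<integral>\<^sup>+\<omega>. \<phi> n \<omega> \<partial>N)"
      by (rule nn_integral_liminf) (simp add: \<phi>_def)
    finally show ?thesis unfolding \<phi>_int .
  qed
  have a_lim': "(\<lambda>n. a (u n)) \<longlonglongrightarrow> L0"
    using LIMSEQ_subseq_LIMSEQ[OF a_lim u] by (simp add: o_def L0_def)
  have "liminf (\<lambda>n. ennreal (C' - A (u n))) \<le> liminf (\<lambda>n. ennreal (C' - a (u n)))"
    by (intro Liminf_mono always_eventually allI ennreal_leI diff_left_mono) (simp add: A_def a_le)
  also have "\<dots> = ennreal (C' - L0)"
    by (intro lim_imp_Liminf tendsto_ennrealI tendsto_intros a_lim') auto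
  finally have \<Phi>_le: "(\<integral>\<^sup>+\<omega>. \<Phi> \<omega> \<partial>N) \<le> ennreal (C' - L0)" using fatou by simp
  have \<Phi>_meas [measurable]: "\<Phi> \<in> borel_measurable N" unfolding \<Phi>_def by measurable
  have "AE \<omega> in N. \<Phi> \<omega> \<noteq> \<infinity>"
    using \<Phi>_le by (intro nn_integral_PInf_AE) (auto simp: top_unique)
  then have k_pos: "AE \<omega> in N. 0 < k (Y0 \<omega>)"
    by eventually_elim (auto simp: \<Phi>_def split: if_splits)
  have \<Phi>_eq: "(\<integral>\<^sup>+\<omega>. ennreal (C' - ln (k (Y0 \<omega>))) \<partial>N) = (\<integral>\<^sup>+\<omega>. \<Phi> \<omega> \<partial>N)"
    using k_pos by (intro nn_integral_cong_AE) (auto simp: \<Phi>_def elim: eventually_mono)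
  have lnk_nonneg: "AE \<omega> in N. 0 \<le> C' - ln (k (Y0 \<omega>))"
    using k_pos
  proof eventually_elim
    case (elim \<omega>)
    have "ln (k (Y0 \<omega>)) \<le> ln (exp C)"
      using elim H_le[of "- \<bar>Y0 \<omega> - t\<bar>"] by (subst ln_le_cancel_iff) (auto simp: k_def)
    then show ?case by (simp add: C'_def)
  qed
  have "integrable N (\<lambda>\<omega>. C' - ln (k (Y0 \<omega>)))"
    by (rule integrableI_nonneg) (use lnk_nonneg \<Phi>_eq \<Phi>_le in \<open>auto intro: le_less_trans\<close>)
  then have "integrable N (\<lambda>\<omega>. C' - (C' - ln (k (Y0 \<omega>))))"
    by (rule Bochner_Integration.integrable_diff[OF integrable_const])
  then have lnk_int: "integrable N (\<lambda>\<omega>. ln (k (Y0 \<omega>)))"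
    by (simp only: diff_diff_eq2 add_diff_cancel_left')
  have \<Phi>_val: "(\<integral>\<^sup>+\<omega>. \<Phi> \<omega> \<partial>N) = ennreal (C' - (\<integral>\<omega>. ln (k (Y0 \<omega>)) \<partial>N))"
    using \<Phi>_eq nn_integral_eq_integral[OF _ lnk_nonneg] lnk_int by (simp add: prob_space)
  have "ennreal (C' - (\<integral>\<omega>. ln (k (Y0 \<omega>)) \<partial>N)) \<le> ennreal (C' - L0)"
    using \<Phi>_le \<Phi>_val by simp
  then have ge: "L0 \<le> (\<integral>\<omega>. ln (k (Y0 \<omega>)) \<partial>N)"
    by (subst (asm) ennreal_le_iff) (auto simp: C'_def)
  have "AE x in lborel. k x = f0 x"
  proof (rule gibbs_equality)
    have "AE x in distr N borel Y0. 0 < k x"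
      using k_pos by (subst AE_distr_iff) auto
    then show "AE x in lborel. 0 < f0 x \<longrightarrow> 0 < k x"
      unfolding Y0_distr by (subst (asm) AE_density) (auto simp: f0_def)
    show "integrable lborel (\<lambda>x. f0 x * ln (k x))"
      using expectation_Y0(1)[of "\<lambda>x. ln (k x)"] lnk_int by simp
    show "(\<integral>x. f0 x * ln (f0 x) \<partial>lborel) + (\<integral>x. k x \<partial>lborel) - (\<integral>x. f0 x \<partial>lborel)
            \<le> (\<integral>x. f0 x * ln (k x) \<partial>lborel)"
      using expectation_Y0(2)[of "\<lambda>x. ln (k x)"] ge k_le_1 f0_ln(2) f0_int(2) by simp
  qed (use f0_int f0_nonneg k_int k_nonneg f0_ln in auto)
  then show eq: "AE x in lborel. H (- \<bar>x - t\<bar>) = f0 x" by (simp add: k_def)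
  have "(\<integral>\<omega>. ln (k (Y0 \<omega>)) \<partial>N) = (\<integral>x. f0 x * ln (k x) \<partial>lborel)"
    by (rule expectation_Y0(2)) measurable
  also have "\<dots> = (\<integral>x. f0 x * ln (f0 x) \<partial>lborel)"
    using eq by (intro integral_cong_AE) (auto simp: k_def elim: eventually_mono)
  also have "\<dots> = L0" by (rule f0_ln(2))
  finally have val: "(\<integral>\<omega>. ln (k (Y0 \<omega>)) \<partial>N) = L0" .
  \<comment> \<open>Now that the limit is known to be \<open>f0\<close>, Fatou's bound for
    \<open>C' - A (u n)\<close> has the value \<open>C' - L0\<close> on its left side and bounds
    \<open>A (u n)\<close> from above; \<open>a (u n)\<close> bounds it from below.\<close>
  show "(\<lambda>n. A (u n)) \<longlonglongrightarrow> L0"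
  proof (rule LIMSEQ_I)
    fix e :: real assume e: "0 < e"
    define e' where "e' = min e 1"
    have "ennreal (C' - L0 - e') < ennreal (C' - L0)"
      using e by (intro ennreal_lessI) (auto simp: e'_def C'_def)
    then have "\<forall>\<^sub>F n in sequentially. ennreal (C' - L0 - e') < ennreal (C' - A (u n))"
      using fatou unfolding \<Phi>_val val le_Liminf_iff by blast
    moreover have "\<forall>\<^sub>F n in sequentially. L0 - e < a (u n)"
      by (rule order_tendstoD[OF a_lim']) (use e in auto)
    ultimately have "\<forall>\<^sub>F n in sequentially. norm (A (u n) - L0) < e"
    proof eventually_elim
      case (elim n)
      have "C' - L0 - e' < C' - A (u n)"
        using elim(1) by (subst (asm) ennreal_less_iff) (auto simp: e'_def C'_def)
      then have "A (u n) < L0 + e" by (simp add: e'_def)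
      moreover have "L0 - e < A (u n)" using elim(2) a_le[of "u n"] by (simp add: A_def)
      ultimately show ?case by (simp add: abs_less_iff)
    qed
    then show "\<exists>no. \<forall>n\<ge>no. norm (A (u n) - L0) < e" by (simp add: eventually_sequentially)
  qed
qed

text \<open>The limit is identified only almost everywhere and only as a function of
  \<open>x - t\<close>. Uniqueness of the centre gives \<open>t = \<theta>0\<close>, and
  right-continuity upgrades the rest to \<open>H = left_branch g0\<close> left of 0; the continuity
  points supplied by Helly's theorem are therefore those of \<open>left_branch g0\<close>.\<close>

lemma subsequence_limit:
  assumes r: "strict_mono r"
  shows "\<exists>s. strict_mono (s :: nat \<Rightarrow> nat) \<and> (\<lambda>n. \<theta> (r (s n))) \<longlonglongrightarrow> \<theta>0 \<and>
    (\<forall>x<0. isCont (left_branch g0) x \<longrightarrow> (\<lambda>n. g (r (s n)) x) \<longlonglongrightarrow> g0 x) \<and>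
    (\<lambda>n. A (r (s n))) \<longlonglongrightarrow> L0"
proof -
  obtain C where C: "\<forall>\<^sub>F n in sequentially. ln (g n 0) \<le> C" using peak_bounded by blast
  obtain T where T: "\<forall>\<^sub>F n in sequentially. \<bar>\<theta> n\<bar> \<le> T" using centre_bounded by blast
  obtain n0 where n0: "\<And>n. n0 \<le> n \<Longrightarrow> ln (g n 0) \<le> C \<and> \<bar>\<theta> n\<bar> \<le> T"
    using eventually_conj[OF C T] unfolding eventually_sequentially by blast
  \<comment> \<open>The first \<open>n0\<close> indices are dropped, so that bounds valid eventually
    hold for every index.\<close>
  define q where "q n = r (n + n0)" for n
  have q_ge: "n0 \<le> q n" for n
    using seq_suble[OF r, of "n + n0"] by (simp add: q_def)
  have "\<forall>n. \<theta> (q n) \<in> {- T..T}" using n0[OF q_ge] by (auto simp: abs_le_iff minus_le_iff)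
  then obtain t s1 where s1: "strict_mono s1" "((\<lambda>n. \<theta> (q n)) \<circ> s1) \<longlonglongrightarrow> t"
    using compact_imp_seq_compact[OF compact_Icc[of "- T" T]] unfolding seq_compact_def by metis
  have "\<exists>s2. strict_mono (s2 :: nat \<Rightarrow> nat) \<and> (\<exists>F. (\<forall>x. continuous (at_right x) F) \<and> mono F \<and>
      (\<forall>x. \<bar>F x\<bar> \<le> exp C) \<and>
      (\<forall>x. isCont F x \<longrightarrow> (\<lambda>n. left_branch (g (q (s1 (s2 n)))) x) \<longlonglongrightarrow> F x))"
  proof (rule Helly_selection)
    fix n x
    show "continuous (at_right x) (left_branch (g (q (s1 n))))" by (rule left_branch_rcont[OF g])
    show "mono (left_branch (g (q (s1 n))))" by (rule left_branch_mono[OF g])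
    have "g (q (s1 n)) 0 \<le> exp C"
      using n0[OF q_ge, of "s1 n"] slc_pos0[OF g, of "q (s1 n)"] by (metis exp_le_cancel_iff exp_ln)
    then show "\<bar>left_branch (g (q (s1 n))) x\<bar> \<le> exp C"
      using left_branch_bounds[OF g, of "q (s1 n)" x] by simp
  qed
  then obtain s2 H where s2: "strict_mono (s2 :: nat \<Rightarrow> nat)" and H: "\<And>x. continuous (at_right x) H" "mono H"
      "\<And>x. isCont H x \<Longrightarrow> (\<lambda>n. left_branch (g (q (s1 (s2 n)))) x) \<longlonglongrightarrow> H x"
    by blast
  define s where "s n = s1 (s2 n) + n0" for n
  have s: "strict_mono s"
    using s1(1) s2 by (auto simp: s_def strict_mono_def)
  have rs: "strict_mono (\<lambda>n. r (s n))" using r s by (auto simp: strict_mono_def)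
  have qrs: "q (s1 (s2 n)) = r (s n)" for n by (simp add: q_def s_def)
  have tl: "(\<lambda>n. \<theta> (r (s n))) \<longlonglongrightarrow> t"
    using LIMSEQ_subseq_LIMSEQ[OF s1(2) s2] by (simp add: o_def qrs)
  have peak: "ln (g (r (s n)) 0) \<le> C" for n using n0[OF q_ge] qrs by metis
  note H3 = H(3)[unfolded qrs]
  note id = subsequence_identify[OF rs tl H(2) H3 peak]
  have ident: "AE x in lborel. H (- \<bar>x - t\<bar>) = g0 (x - \<theta>0)" using id(1) by (simp add: f0_def)
  have t: "\<theta>0 = t"
    by (rule slc_centre_unique[OF g0 g0_int, of "\<lambda>y. H (- y)"]) (use ident in simp)
  have "AE y in lborel. H (- \<bar>\<theta>0 + 1 * y - t\<bar>) = g0 (\<theta>0 + 1 * y - \<theta>0)"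
    using ident borel_measurable_mono[OF H(2)] by (intro AE_borel_affine) (auto simp: pred_def)
  then have "AE y in lborel. y < 0 \<longrightarrow> H y = left_branch g0 y"
    by eventually_elim (auto simp: t left_branch_def)
  then have H_eq: "H x = left_branch g0 x" if "x < 0" for x
    using that by (intro right_continuous_eq_of_AE[where b=0] H left_branch_rcont[OF g0])
  have "(\<lambda>n. g (r (s n)) x) \<longlonglongrightarrow> g0 x" if x: "x < 0" "isCont (left_branch g0) x" for x
  proof -
    have "\<forall>\<^sub>F y in nhds x. y < 0" using x(1) by (intro eventually_nhds_in_open[of "{..<0}", simplified]) auto
    then have "\<forall>\<^sub>F y in nhds x. H y = left_branch g0 y" by (rule eventually_mono) (rule H_eq)
    then have "isCont H x" using x(2) by (simp add: isCont_cong)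
    from H3[OF this] show ?thesis using x H_eq[of x] by (simp add: left_branch_def)
  qed
  then show ?thesis using s tl id(2) t by blast
qed

text \<open>Every subsequence has a further one with the right limits. Evenness moves a continuity
  point \<open>x \<noteq> 0\<close> to \<open>- \<bar>x\<bar>\<close>, near which \<open>g0\<close>
  and \<open>left_branch g0\<close> coincide; at 0, where \<open>left_branch\<close> is cut off,
  \<open>slc_tendsto_0\<close> takes over.\<close>

theorem consistency:
  shows "\<theta> \<longlonglongrightarrow> \<theta>0" and "A \<longlonglongrightarrow> L0"
    and "\<And>x. isCont g0 x \<Longrightarrow> (\<lambda>n. g n x) \<longlonglongrightarrow> g0 x"
proof -
  show "\<theta> \<longlonglongrightarrow> \<theta>0" using subsequence_limit by (intro tendsto_if_subseq) blast
  show "A \<longlonglongrightarrow> L0" using subsequence_limit by (intro tendsto_if_subseq) blast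
  have neg: "(\<lambda>n. g n x) \<longlonglongrightarrow> g0 x" if x: "x < 0" "isCont (left_branch g0) x" for x
  proof (rule tendsto_if_subseq)
    fix r :: "nat \<Rightarrow> nat" assume "strict_mono r"
    from subsequence_limit[OF this] x
    show "\<exists>s. strict_mono (s :: nat \<Rightarrow> nat) \<and> (\<lambda>n. g (r (s n)) x) \<longlonglongrightarrow> g0 x" by blast
  qed
  show "(\<lambda>n. g n x) \<longlonglongrightarrow> g0 x" if x: "isCont g0 x" for x
  proof (cases "x = 0")
    case True
    then show ?thesis using slc_tendsto_0[OF g g0 g0_int neg] by simp
  next
    case False
    have c: "isCont g0 (- \<bar>x\<bar>)"
    proof (cases "x < 0")
      case False
      have "isCont (\<lambda>y. g0 (- y)) (- x)"
        by (rule isCont_o2[where f=uminus and g=g0]) (use x in auto)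
      then show ?thesis using False by (simp add: slc_sym[OF g0])
    qed (use x in simp)
    have "\<forall>\<^sub>F y in nhds (- \<bar>x\<bar>). y < 0" using False by (intro eventually_nhds_in_open[of "{..<0}", simplified]) auto
    then have "\<forall>\<^sub>F y in nhds (- \<bar>x\<bar>). g0 y = left_branch g0 y" by (rule eventually_mono) (simp add: left_branch_def)
    then have "isCont (left_branch g0) (- \<bar>x\<bar>)" using c by (simp add: isCont_cong)
    then have "(\<lambda>n. g n (- \<bar>x\<bar>)) \<longlonglongrightarrow> g0 (- \<bar>x\<bar>)" using False by (intro neg) auto
    then show ?thesis by (simp add: slc_sym[OF g] slc_sym[OF g0] slc_abs[OF g] slc_abs[OF g0])
  qed
qed

end

section \<open>Exponentially weighted convergence and one-sided bounds at jumps\<close>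

context coupled_sample
begin

text \<open>\<open>A n \<le> ln (g n 0)\<close> passes to the limit as
  \<open>L0 \<le> ln (g0 0)\<close>, so the radius that serves the estimators also serves
  \<open>g0\<close>, and both share one exponential envelope.\<close>

lemma R_g0: "exp (1 - ln (g0 0)) \<le> R"
proof -
  have "(\<lambda>n. ln (g n 0)) \<longlonglongrightarrow> ln (g0 0)"
    using consistency(3)[OF slc_isCont_0[OF g0 g0_int]] slc_pos0[OF g0] by (intro tendsto_ln) auto
  then have "L0 \<le> ln (g0 0)"
    by (rule LIMSEQ_le[OF consistency(2)]) (use A_le_peak in auto)
  then show ?thesis by (simp add: R_def)
qed

lemma eventually_dominated:
  "\<exists>K>0. \<forall>\<^sub>F n in sequentially. \<forall>x. \<bar>g n x - g0 x\<bar> \<le> K * exp (- \<bar>x\<bar> / R)"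
proof -
  obtain C where C: "\<forall>\<^sub>F n in sequentially. ln (g n 0) \<le> C" using peak_bounded by blast
  define D where "D = max C (ln (g0 0))"
  have g0_le: "g0 x \<le> exp (D + 1) * exp (- \<bar>x\<bar> / R)" for x
  proof -
    have "g0 x \<le> exp (ln (g0 0) + 1 - \<bar>x\<bar> / R)" by (rule slc_exp_decay[OF g0 g0_int R_g0])
    also have "\<dots> \<le> exp (D + 1 + - \<bar>x\<bar> / R)" by (simp add: D_def)
    finally show ?thesis by (simp only: exp_add)
  qed
  have "\<forall>\<^sub>F n in sequentially. \<forall>x. \<bar>g n x - g0 x\<bar> \<le> exp (D + 1) * exp (- \<bar>x\<bar> / R)"
    using C decay
  proof eventually_elim
    case (elim n)
    show ?case
    proof
      fix x
      have "g n x \<le> exp (ln (g n 0) + 1 - \<bar>x\<bar> / R)" using elim by blast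
      also have "\<dots> \<le> exp (D + 1 + - \<bar>x\<bar> / R)" using elim by (simp add: D_def)
      finally have "g n x \<le> exp (D + 1) * exp (- \<bar>x\<bar> / R)" by (simp only: exp_add)
      then show "\<bar>g n x - g0 x\<bar> \<le> exp (D + 1) * exp (- \<bar>x\<bar> / R)"
        using g0_le[of x] slc_nonneg[OF g, of n x] slc_nonneg[OF g0, of x] by (simp add: abs_le_iff)
    qed
  qed
  then show ?thesis by (intro exI[of _ "exp (D + 1)"]) auto
qed

text \<open>The weight consumes \<open>\<alpha>\<close> of the decay rate \<open>1 / R\<close>. What
  remains is positive exactly when \<open>\<alpha> < 1 / R\<close>, which is the origin of the
  threshold.\<close>

lemma eventually_weighted_dominated:
  "\<exists>K>0. \<forall>\<^sub>F n in sequentially. \<forall>x. exp (\<alpha> * \<bar>x\<bar>) * \<bar>g n x - g0 x\<bar> \<le> K * exp (- (1 / R - \<alpha>) * \<bar>x\<bar>)"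
proof -
  obtain K where K: "K > 0" "\<forall>\<^sub>F n in sequentially. \<forall>x. \<bar>g n x - g0 x\<bar> \<le> K * exp (- \<bar>x\<bar> / R)"
    using eventually_dominated by blast
  from K(2) have "\<forall>\<^sub>F n in sequentially. \<forall>x. exp (\<alpha> * \<bar>x\<bar>) * \<bar>g n x - g0 x\<bar> \<le> K * exp (- (1 / R - \<alpha>) * \<bar>x\<bar>)"
  proof eventually_elim
    case (elim n)
    show ?case
    proof
      fix x
      have "exp (\<alpha> * \<bar>x\<bar>) * \<bar>g n x - g0 x\<bar> \<le> exp (\<alpha> * \<bar>x\<bar>) * (K * exp (- \<bar>x\<bar> / R))"
        using elim by (intro mult_left_mono) auto
      also have "\<dots> = K * exp (- (1 / R - \<alpha>) * \<bar>x\<bar>)"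
        by (simp add: exp_add[symmetric] algebra_simps)
      finally show "exp (\<alpha> * \<bar>x\<bar>) * \<bar>g n x - g0 x\<bar> \<le> K * exp (- (1 / R - \<alpha>) * \<bar>x\<bar>)" .
    qed
  qed
  with K(1) show ?thesis by blast
qed

lemma weighted_L1_convergence:
  assumes "\<alpha> < 1 / R"
  shows "(\<lambda>n. \<integral>\<^sup>+x. ennreal (exp (\<alpha> * \<bar>x\<bar>) * \<bar>g n x - g0 x\<bar>) \<partial>lborel) \<longlonglongrightarrow> 0"
proof -
  obtain K where K: "K > 0" "\<forall>\<^sub>F n in sequentially. \<forall>x. exp (\<alpha> * \<bar>x\<bar>) * \<bar>g n x - g0 x\<bar> \<le> K * exp (- (1 / R - \<alpha>) * \<bar>x\<bar>)"
    using eventually_weighted_dominated by blast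
  obtain n0 where n0: "\<And>n x. n0 \<le> n \<Longrightarrow> exp (\<alpha> * \<bar>x\<bar>) * \<bar>g n x - g0 x\<bar> \<le> K * exp (- (1 / R - \<alpha>) * \<bar>x\<bar>)"
    using K(2) unfolding eventually_sequentially by blast
  have "(\<lambda>n. \<integral>\<^sup>+x. ennreal (exp (\<alpha> * \<bar>x\<bar>) * \<bar>g (n + n0) x - g0 x\<bar>) \<partial>lborel) \<longlonglongrightarrow> (\<integral>\<^sup>+x. 0 \<partial>(lborel :: real measure))"
  proof (rule nn_integral_dominated_convergence[where w="\<lambda>x. ennreal (K * exp (- (1 / R - \<alpha>) * \<bar>x\<bar>))"])
    have "integrable lborel (\<lambda>x. K * exp (- (1 / R - \<alpha>) * \<bar>x\<bar>))"
      using assms by (intro integrable_mult_right integrable_exp_minus_abs) auto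
    then show "(\<integral>\<^sup>+x. ennreal (K * exp (- (1 / R - \<alpha>) * \<bar>x\<bar>)) \<partial>lborel) < \<infinity>"
      using K(1) by (subst nn_integral_eq_integral) auto
    show "AE x in lborel. (\<lambda>n. ennreal (exp (\<alpha> * \<bar>x\<bar>) * \<bar>g (n + n0) x - g0 x\<bar>)) \<longlonglongrightarrow> 0"
      using AE_isCont_mono_abs[OF left_branch_mono[OF g0], of 0]
    proof eventually_elim
      case (elim x)
      have "isCont (\<lambda>y. left_branch g0 (- \<bar>y\<bar>)) x"
        by (rule isCont_o2[where f="\<lambda>y. - \<bar>y\<bar>" and g="left_branch g0"]) (use elim in \<open>auto intro!: continuous_intros\<close>)
      then have "isCont g0 x" by (simp add: slc_left_branch[OF g0, symmetric])
      then have "(\<lambda>n. g (n + n0) x) \<longlonglongrightarrow> g0 x"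
        by (intro LIMSEQ_ignore_initial_segment consistency(3))
      then have "(\<lambda>n. exp (\<alpha> * \<bar>x\<bar>) * \<bar>g (n + n0) x - g0 x\<bar>) \<longlonglongrightarrow> exp (\<alpha> * \<bar>x\<bar>) * \<bar>g0 x - g0 x\<bar>"
        by (intro tendsto_intros)
      then have "(\<lambda>n. ennreal (exp (\<alpha> * \<bar>x\<bar>) * \<bar>g (n + n0) x - g0 x\<bar>)) \<longlonglongrightarrow> ennreal (exp (\<alpha> * \<bar>x\<bar>) * \<bar>g0 x - g0 x\<bar>)"
        by (rule tendsto_ennrealI)
      then show ?case by simp
    qed
    show "AE x in lborel. ennreal (exp (\<alpha> * \<bar>x\<bar>) * \<bar>g (n + n0) x - g0 x\<bar>)
        \<le> ennreal (K * exp (- (1 / R - \<alpha>) * \<bar>x\<bar>))" for n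
      by (intro AE_I2 ennreal_leI n0) simp
  qed measurable
  then show ?thesis by (simp add: LIMSEQ_offset[where k=n0])
qed

text \<open>If the bound failed at points \<open>x n\<close> for infinitely many \<open>n\<close>,
  these would accumulate at some \<open>z\<close>; along such a subsequence both
  \<open>g n (x n)\<close> and \<open>g0 (x n)\<close> tend to \<open>g0 z\<close>, by monotonicity
  of the branches and continuity of \<open>g0\<close>.\<close>

lemma uniform_on_bounded:
  assumes cont: "continuous_on UNIV g0" and "0 < e"
  shows "\<forall>\<^sub>F n in sequentially. \<forall>x\<in>{-T..T}. exp (\<alpha> * \<bar>x\<bar>) * \<bar>g n x - g0 x\<bar> < e"
proof -
  have c0: "isCont g0 x" for x using cont by (simp add: continuous_on_eq_continuous_at)
  define d where "d n x = exp (\<alpha> * \<bar>x\<bar>) * \<bar>g n x - g0 x\<bar>" for n x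
  define x where "x n = (if \<exists>y\<in>{-T..T}. e \<le> d n y then SOME y. y \<in> {-T..T} \<and> e \<le> d n y else 0)" for n
  have x1: "x n \<in> {-T..T} \<and> e \<le> d n (x n)" if "\<exists>y\<in>{-T..T}. e \<le> d n y" for n
  proof -
    have "\<exists>y. y \<in> {-T..T} \<and> e \<le> d n y" using that by blast
    from someI_ex[OF this] show ?thesis unfolding x_def if_P[OF that] .
  qed
  \<comment> \<open>The default value 0 of \<open>x n\<close> must lie in the compact interval even
    if \<open>T\<close> is negative.\<close>
  have xb: "x n \<in> {- max T 0..max T 0}" for n
    using x1[of n] by (cases "\<exists>y\<in>{-T..T}. e \<le> d n y") (auto simp: x_def)
  have "(\<lambda>n. d n (x n)) \<longlonglongrightarrow> 0"
  proof (rule tendsto_if_subseq)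
    fix r :: "nat \<Rightarrow> nat" assume r: "strict_mono r"
    obtain z s where s: "strict_mono s" "((\<lambda>n. x (r n)) \<circ> s) \<longlonglongrightarrow> z"
      using compact_imp_seq_compact[OF compact_Icc[of "- max T 0" "max T 0"]] xb unfolding seq_compact_def by metis
    then have z: "(\<lambda>n. x (r (s n))) \<longlonglongrightarrow> z" by (simp add: o_def)
    have rs: "strict_mono (\<lambda>n. r (s n))" using r s by (auto simp: strict_mono_def)
    have "(\<lambda>n. left_branch (g (r (s n))) (- \<bar>x (r (s n))\<bar>)) \<longlonglongrightarrow> left_branch g0 (- \<bar>z\<bar>)"
    proof (rule mono_tendsto_at_moving_point[where h="\<lambda>n. left_branch (g (r (s n)))" and H="left_branch g0"])
      show "(\<lambda>n. left_branch (g (r (s n))) y) \<longlonglongrightarrow> left_branch g0 y" for y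
        using LIMSEQ_subseq_LIMSEQ[OF consistency(3)[OF c0] rs] by (simp add: left_branch_def o_def)
      show "(\<lambda>n. - \<bar>x (r (s n))\<bar>) \<longlonglongrightarrow> - \<bar>z\<bar>" by (intro tendsto_intros z)
      have "isCont (\<lambda>y. g0 (min y 0)) (- \<bar>z\<bar>)"
        by (rule isCont_o2[where f="\<lambda>y. min y 0" and g=g0]) (auto intro!: continuous_intros c0)
      then show "isCont (left_branch g0) (- \<bar>z\<bar>)" by (simp add: left_branch_def[abs_def])
    qed (auto intro: left_branch_mono g g0)
    then have "(\<lambda>n. g (r (s n)) (x (r (s n)))) \<longlonglongrightarrow> g0 z"
      by (simp add: slc_left_branch[OF g, symmetric] slc_left_branch[OF g0, symmetric])
    moreover have "(\<lambda>n. g0 (x (r (s n)))) \<longlonglongrightarrow> g0 z"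
      by (rule isCont_tendsto_compose[OF c0 z])
    ultimately have "(\<lambda>n. d (r (s n)) (x (r (s n)))) \<longlonglongrightarrow> exp (\<alpha> * \<bar>z\<bar>) * \<bar>g0 z - g0 z\<bar>"
      unfolding d_def by (intro tendsto_intros z)
    then show "\<exists>s. strict_mono (s :: nat \<Rightarrow> nat) \<and> (\<lambda>n. d (r (s n)) (x (r (s n)))) \<longlonglongrightarrow> 0"
      using s by auto
  qed
  then have "\<forall>\<^sub>F n in sequentially. d n (x n) < e" using \<open>0 < e\<close> by (rule order_tendstoD)
  then show ?thesis
  proof eventually_elim
    case (elim n)
    then show ?case using x1[of n] unfolding d_def by (meson not_less)
  qed
qed

lemma weighted_sup_convergence:
  assumes cont: "continuous_on UNIV g0" and \<alpha>: "\<alpha> < 1 / R"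
  shows "(\<lambda>n. SUP x. ennreal (exp (\<alpha> * \<bar>x\<bar>) * \<bar>g n x - g0 x\<bar>)) \<longlonglongrightarrow> 0"
proof -
  obtain K where K: "K > 0" "\<forall>\<^sub>F n in sequentially. \<forall>x. exp (\<alpha> * \<bar>x\<bar>) * \<bar>g n x - g0 x\<bar> \<le> K * exp (- (1 / R - \<alpha>) * \<bar>x\<bar>)"
    using eventually_weighted_dominated by blast
  have small: "\<forall>\<^sub>F n in sequentially. (SUP x. ennreal (exp (\<alpha> * \<bar>x\<bar>) * \<bar>g n x - g0 x\<bar>)) \<le> ennreal e" if "0 < e" for e
  proof -
    define \<kappa> where "\<kappa> = 1 / R - \<alpha>"
    have \<kappa>: "0 < \<kappa>" using \<alpha> by (simp add: \<kappa>_def)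
    \<comment> \<open>The solution of \<open>K * exp (- \<kappa> * T) = e\<close>: beyond it the
      envelope suffices, inside it the uniform estimate.\<close>
    define T where "T = (ln K - ln e) / \<kappa>"
    have tail: "K * exp (- \<kappa> * \<bar>x\<bar>) \<le> e" if "T \<le> \<bar>x\<bar>" for x
    proof -
      have "ln K - ln e \<le> \<kappa> * \<bar>x\<bar>" using that \<kappa> by (simp add: T_def pos_divide_le_eq mult.commute)
      then have "exp (ln K + - \<kappa> * \<bar>x\<bar>) \<le> exp (ln e)" by simp
      then show ?thesis using K(1) \<open>0 < e\<close> by (simp only: exp_add exp_ln)
    qed
    show ?thesis
      using K(2) uniform_on_bounded[OF cont \<open>0 < e\<close>, of T \<alpha>]
    proof eventually_elim
      case (elim n)
      have "exp (\<alpha> * \<bar>x\<bar>) * \<bar>g n x - g0 x\<bar> \<le> e" for x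
      proof (cases "T \<le> \<bar>x\<bar>")
        case True
        have "exp (\<alpha> * \<bar>x\<bar>) * \<bar>g n x - g0 x\<bar> \<le> K * exp (- \<kappa> * \<bar>x\<bar>)"
          using elim(1) by (simp add: \<kappa>_def)
        then show ?thesis using tail[OF True] by linarith
      next
        case False
        then have "x \<in> {-T..T}" by auto
        then show ?thesis using elim(2) less_imp_le by blast
      qed
      then show ?case by (intro SUP_least ennreal_leI)
    qed
  qed
  show ?thesis
  proof (rule order_tendstoI)
    fix c :: ennreal assume "0 < c"
    then obtain y where y: "0 < y" "y < c" using dense by blast
    then obtain e where e: "y = ennreal e" "0 < e" by (cases y) auto
    show "\<forall>\<^sub>F n in sequentially. (SUP x. ennreal (exp (\<alpha> * \<bar>x\<bar>) * \<bar>g n x - g0 x\<bar>)) < c"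
      using small[OF e(2)] by (rule eventually_mono) (use y e in \<open>auto intro: le_less_trans\<close>)
  qed simp
qed

text \<open>Right-continuity at \<open>- \<bar>x\<bar>\<close> provides a continuity point
  \<open>y\<close> slightly closer to the centre with \<open>g0 y < g0 x + e\<close>; there
  \<open>g n\<close> converges, and \<open>g n x \<le> g n y\<close> carries the bound to
  \<open>x\<close>. Unlike convergence, this one-sided estimate survives at jumps, including end
  points of the support.\<close>

lemma eventually_less:
  assumes "0 < e"
  shows "\<forall>\<^sub>F n in sequentially. g n x < g0 x + e"
proof (cases "x = 0")
  case True
  then show ?thesis
    using order_tendstoD(2)[OF consistency(3)[OF slc_isCont_0[OF g0 g0_int]], of "g0 0 + e"] assms by simp
next
  case False
  have "(g0 \<longlongrightarrow> g0 (- \<bar>x\<bar>)) (at_right (- \<bar>x\<bar>))"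
    by (rule slc_rcont[OF g0]) (use False in auto)
  then have "\<forall>\<^sub>F y in at_right (- \<bar>x\<bar>). g0 y < g0 x + e"
    by (rule order_tendstoD) (use assms in \<open>simp add: slc_sym[OF g0] slc_abs[OF g0]\<close>)
  then obtain b where b: "- \<bar>x\<bar> < b" "\<And>y. - \<bar>x\<bar> < y \<Longrightarrow> y < b \<Longrightarrow> g0 y < g0 x + e"
    unfolding eventually_at_right_field by auto
  obtain y where y: "- \<bar>x\<bar> < y" "y < min b 0" "isCont (left_branch g0) y"
    using isCont_point_between[OF left_branch_mono[OF g0], of "- \<bar>x\<bar>" "min b 0" "{1}"] b False by auto
  have "isCont (\<lambda>z. left_branch g0 (- \<bar>z\<bar>)) y"
    by (rule isCont_o2[where f="\<lambda>y. - \<bar>y\<bar>" and g="left_branch g0"]) (use y in \<open>auto intro!: continuous_intros\<close>)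
  then have "isCont g0 y" by (simp add: slc_left_branch[OF g0, symmetric])
  then have "\<forall>\<^sub>F n in sequentially. g n y < g0 x + e"
    using b y by (intro order_tendstoD[OF consistency(3)]) auto
  then show ?thesis
  proof eventually_elim
    case (elim n)
    have "g n x \<le> g n y" using y by (intro slc_antimono[OF g]) auto
    then show ?case using elim by linarith
  qed
qed

end

section \<open>The criterion function and its maximizers\<close>

lemma exp_ext_log_ext: "0 \<le> y \<Longrightarrow> exp_ext (log_ext y) = y"
  by (auto simp: exp_ext_def log_ext_def)

lemma log_ext_exp_ext: "y < \<infinity> \<Longrightarrow> log_ext (exp_ext y) = y"
  by (cases y) (auto simp: exp_ext_def log_ext_def)

lemma exp_ext_nonneg: "0 \<le> exp_ext y"
  by (simp add: exp_ext_def)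

lemma exp_ext_pos_iff: "0 < exp_ext y \<longleftrightarrow> y \<noteq> -\<infinity>"
  by (simp add: exp_ext_def)

lemma ln_exp_ext: "y < \<infinity> \<Longrightarrow> ln (exp_ext y) = real_of_ereal y"
  by (cases y) (auto simp: exp_ext_def)

lemma exp_ext_mono: "x \<le> y \<Longrightarrow> y < \<infinity> \<Longrightarrow> exp_ext x \<le> exp_ext y"
  by (cases x; cases y) (auto simp: exp_ext_def)

lemma SC0_less_top: "\<psi> \<in> SC0 \<Longrightarrow> \<psi> x < \<infinity>"
  by (simp add: SC0_def CC_def)

lemma SC0_sym: "\<psi> \<in> SC0 \<Longrightarrow> \<psi> (- x) = \<psi> x"
  by (simp add: SC0_def)

lemma SC0_concave:
  assumes "\<psi> \<in> SC0" "ereal r \<le> \<psi> x" "ereal s \<le> \<psi> y" "0 \<le> t" "t \<le> 1"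
  shows "ereal ((1 - t) * r + t * s) \<le> \<psi> ((1 - t) * x + t * y)"
proof -
  have "convex (hypograph \<psi>)" using assms(1) by (simp add: SC0_def CC_def)
  then have "(1 - t) *\<^sub>R (x, r) + t *\<^sub>R (y, s) \<in> hypograph \<psi>"
    using assms unfolding convex_alt by (auto simp: hypograph_def)
  then show ?thesis by (simp add: hypograph_def)
qed

lemma SC0_slc:
  assumes \<psi>: "\<psi> \<in> SC0"
  shows "slc (\<lambda>x. exp_ext (\<psi> x))"
proof -
  have fin: "\<psi> x = ereal (real_of_ereal (\<psi> x))" if "\<psi> x \<noteq> -\<infinity>" for x
    using that SC0_less_top[OF \<psi>, of x] by (cases "\<psi> x") auto
  \<comment> \<open>Such a \<open>y\<close> is a convex combination of \<open>x\<close> and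
    \<open>- x\<close>, where \<open>\<psi>\<close> takes equal values.\<close>
  have mid: "\<psi> x \<le> \<psi> y" if "\<bar>y\<bar> \<le> - x" "x < 0" for x y
  proof (cases "\<psi> x = -\<infinity>")
    case False
    define t where "t = (y - x) / (- 2 * x)"
    have t: "0 \<le> t" "t \<le> 1" using that by (auto simp: t_def divide_simps)
    have eq: "(1 - t) * x + t * (- x) = y" using that by (simp add: t_def field_simps)
    show ?thesis
      using SC0_concave[OF \<psi>, of "real_of_ereal (\<psi> x)" x "real_of_ereal (\<psi> x)" "- x" t] t fin[OF False]
      unfolding eq by (simp add: SC0_sym[OF \<psi>] algebra_simps)
  qed simp
  have "\<psi> 0 \<noteq> -\<infinity>"
  proof -
    obtain x where x: "\<psi> x \<noteq> -\<infinity>" using \<psi> by (auto simp: SC0_def CC_def effective_domain_def)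
    have "\<psi> x \<le> \<psi> 0"
    proof (cases "x = 0")
      case False
      have "\<psi> (- \<bar>x\<bar>) \<le> \<psi> 0" by (rule mid) (use False in auto)
      then show ?thesis using SC0_sym[OF \<psi>, of x] by (auto simp: abs_if split: if_splits)
    qed simp
    then show ?thesis using x by auto
  qed
  moreover have "exp ((1 - t) * ln (exp_ext (\<psi> x)) + t * ln (exp_ext (\<psi> y))) \<le> exp_ext (\<psi> ((1 - t) * x + t * y))"
    if "0 < exp_ext (\<psi> x)" "0 < exp_ext (\<psi> y)" "0 \<le> t" "t \<le> 1" for x y t
  proof -
    have "ereal ((1 - t) * real_of_ereal (\<psi> x) + t * real_of_ereal (\<psi> y)) \<le> \<psi> ((1 - t) * x + t * y)"
      using that fin[of x] fin[of y] by (intro SC0_concave[OF \<psi>]) (auto simp: exp_ext_pos_iff)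
    from exp_ext_mono[OF this SC0_less_top[OF \<psi>]] that show ?thesis
      by (simp add: ln_exp_ext SC0_less_top[OF \<psi>] exp_ext_def split: if_splits)
  qed
  moreover have "((\<lambda>x. exp_ext (\<psi> x)) \<longlongrightarrow> exp_ext (\<psi> x)) (at_right x)" if x: "x < 0" for x
  proof (rule order_tendstoI)
    fix c assume c: "c < exp_ext (\<psi> x)"
    show "\<forall>\<^sub>F y in at_right x. c < exp_ext (\<psi> y)"
      unfolding eventually_at_right_field
    proof (intro exI[of _ "- x"] conjI allI impI)
      fix y assume "x < y" "y < - x"
      then have "\<psi> x \<le> \<psi> y" using x by (intro mid) auto
      then show "c < exp_ext (\<psi> y)" using c exp_ext_mono[OF _ SC0_less_top[OF \<psi>]] less_le_trans by blast
    qed (use x in auto)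
  next
    fix c assume c: "exp_ext (\<psi> x) < c"
    then have c0: "0 < c" using exp_ext_nonneg[of "\<psi> x"] by linarith
    have "ln c \<le> r \<longleftrightarrow> c \<le> exp r" for r
      using c0 exp_le_cancel_iff[of "ln c" r] by simp
    then have iff: "ereal (ln c) \<le> \<psi> y \<longleftrightarrow> c \<le> exp_ext (\<psi> y)" for y
      using c0 SC0_less_top[OF \<psi>, of y] by (cases "\<psi> y") (auto simp: exp_ext_def)
    \<comment> \<open>The section of the hypograph at height \<open>ln c\<close> is the set where
      \<open>exp_ext (\<psi> y) \<ge> c\<close>. Its closedness is upper semicontinuity, one half of
      right-continuity at \<open>x < 0\<close>; the other half was monotonicity, from
      \<open>mid\<close>.\<close>
    have "closed ((\<lambda>y. (y, ln c)) -` hypograph \<psi>)"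
      using \<psi> by (intro closed_vimage continuous_intros) (simp add: SC0_def CC_def)
    then have "open {y. exp_ext (\<psi> y) < c}"
      by (simp add: hypograph_def vimage_def iff closed_def Collect_neg_eq[symmetric] not_le)
    then have "\<forall>\<^sub>F y in nhds x. y \<in> {y. exp_ext (\<psi> y) < c}"
      using c by (intro eventually_nhds_in_open) auto
    then show "\<forall>\<^sub>F y in at_right x. exp_ext (\<psi> y) < c"
      by (simp add: eventually_nhds_conv_at eventually_at_split)
  qed
  ultimately show ?thesis
    unfolding slc_def using SC0_sym[OF \<psi>] by (auto simp: exp_ext_nonneg exp_ext_pos_iff)
qed

lemma SC0_add_const:
  assumes "\<psi> \<in> SC0"
  shows "(\<lambda>x. \<psi> x + ereal c) \<in> SC0"
proof -
  have eq: "hypograph (\<lambda>x. \<psi> x + ereal c) = (+) (0, c) ` hypograph \<psi>"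
  proof (intro set_eqI iffI)
    fix p assume "p \<in> hypograph (\<lambda>x. \<psi> x + ereal c)"
    then obtain x r where p: "p = (x, r)" "ereal r \<le> \<psi> x + ereal c" by (auto simp: hypograph_def)
    have "ereal (r - c) \<le> \<psi> x" using p(2) by (cases "\<psi> x") auto
    then show "p \<in> (+) (0, c) ` hypograph \<psi>"
      unfolding p by (intro image_eqI[of _ _ "(x, r - c)"]) (auto simp: hypograph_def)
  next
    fix p assume "p \<in> (+) (0, c) ` hypograph \<psi>"
    then obtain x r where p: "p = (x, c + r)" "ereal r \<le> \<psi> x" by (auto simp: hypograph_def)
    then show "p \<in> hypograph (\<lambda>x. \<psi> x + ereal c)"
      by (cases "\<psi> x") (auto simp: hypograph_def)
  qed
  have lt: "\<psi> x + ereal c < \<infinity>" for x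
    using assms SC0_less_top[OF assms, of x] by (cases "\<psi> x") auto
  have dom: "effective_domain (\<lambda>x. \<psi> x + ereal c) = effective_domain \<psi>"
  proof -
    have "-\<infinity> < \<psi> x + ereal c \<longleftrightarrow> -\<infinity> < \<psi> x" for x by (cases "\<psi> x") auto
    then show ?thesis by (simp add: effective_domain_def)
  qed
  show ?thesis
    using assms unfolding SC0_def CC_def
    by (auto simp: eq lt dom intro: convex_translation closed_translation)
qed

text \<open>The upper bound \<open>C\<close> makes the positive part integrable against a
  probability measure, so only the negative part decides between \<open>-\<infinity>\<close> and a
  real value.\<close>

lemma ext_integral_real:
  assumes "prob_space \<mu>" and [measurable]: "h \<in> borel_measurable \<mu>" and le: "\<And>x. h x \<le> ereal C"
  shows "ext_integral \<mu> h \<noteq> -\<infinity> \<Longrightarrow> (AE x in \<mu>. h x \<noteq> -\<infinity>) \<and> integrable \<mu> (\<lambda>x. real_of_ereal (h x))"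
    and "AE x in \<mu>. h x \<noteq> -\<infinity> \<Longrightarrow> integrable \<mu> (\<lambda>x. real_of_ereal (h x)) \<Longrightarrow>
      ext_integral \<mu> h = ereal (\<integral>x. real_of_ereal (h x) \<partial>\<mu>)"
proof -
  interpret prob_space \<mu> by fact
  have eq: "e2ennreal (h x) = ennreal (real_of_ereal (h x)) \<and> e2ennreal (- h x) = ennreal (- real_of_ereal (h x))"
    if "h x \<noteq> -\<infinity>" for x
    using that le[of x] by (cases "h x") (auto simp: ennreal.abs_eq e2ennreal_def ennreal_def)
  have p: "(\<integral>\<^sup>+x. e2ennreal (h x) \<partial>\<mu>) < \<infinity>"
  proof -
    have "(\<integral>\<^sup>+x. e2ennreal (h x) \<partial>\<mu>) \<le> (\<integral>\<^sup>+x. e2ennreal (ereal C) \<partial>\<mu>)"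
      by (intro nn_integral_mono e2ennreal_mono le)
    also have "\<dots> < \<infinity>" by (simp add: emeasure_space_1 less_top[symmetric])
    finally show ?thesis .
  qed
  have split: "(\<integral>\<^sup>+x. e2ennreal (h x) \<partial>\<mu>) = (\<integral>\<^sup>+x. ennreal (real_of_ereal (h x)) \<partial>\<mu>) \<and>
      (\<integral>\<^sup>+x. e2ennreal (- h x) \<partial>\<mu>) = (\<integral>\<^sup>+x. ennreal (- real_of_ereal (h x)) \<partial>\<mu>)"
    if "AE x in \<mu>. h x \<noteq> -\<infinity>"
    using that by (intro conjI nn_integral_cong_AE) (auto elim!: eventually_mono simp: eq)
  show "(AE x in \<mu>. h x \<noteq> -\<infinity>) \<and> integrable \<mu> (\<lambda>x. real_of_ereal (h x))" if ne: "ext_integral \<mu> h \<noteq> -\<infinity>"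
  proof -
    have q: "(\<integral>\<^sup>+x. e2ennreal (- h x) \<partial>\<mu>) \<noteq> \<infinity>"
    proof
      assume "(\<integral>\<^sup>+x. e2ennreal (- h x) \<partial>\<mu>) = \<infinity>"
      then have "ext_integral \<mu> h = -\<infinity>"
        using p by (cases "\<integral>\<^sup>+x. e2ennreal (h x) \<partial>\<mu>") (auto simp: ext_integral_def)
      with ne show False ..
    qed
    then have "AE x in \<mu>. e2ennreal (- h x) \<noteq> \<infinity>" by (intro nn_integral_PInf_AE) auto
    then have ae: "AE x in \<mu>. h x \<noteq> -\<infinity>" by eventually_elim auto
    then show ?thesis using split p q by (auto simp: real_integrable_def)
  qed
  assume ae: "AE x in \<mu>. h x \<noteq> -\<infinity>" and int: "integrable \<mu> (\<lambda>x. real_of_ereal (h x))"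
  obtain a b where ab: "0 \<le> a" "0 \<le> b" "(\<integral>\<^sup>+x. ennreal (real_of_ereal (h x)) \<partial>\<mu>) = ennreal a"
      "(\<integral>\<^sup>+x. ennreal (- real_of_ereal (h x)) \<partial>\<mu>) = ennreal b"
    using int unfolding real_integrable_def by (metis ennreal_cases infinity_ennreal_def)
  show "ext_integral \<mu> h = ereal (\<integral>x. real_of_ereal (h x) \<partial>\<mu>)"
    using ab split[OF ae] by (simp add: ext_integral_def real_lebesgue_integral_def[OF int])
qed

text \<open>The bridge from extended to real arithmetic. The first part is applied to pairs known to
  do at least as well as the true one, whose criterion therefore is not \<open>-\<infinity>\<close>;
  the second evaluates the criterion, with the shift removed from the integral of
  \<open>exp \<psi>\<close>.\<close>

lemma Psi_real:
  assumes \<mu>: "prob_space \<mu>" "interval_measure F = \<mu>" and \<psi>: "\<psi> \<in> SC0"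
    and g: "g = (\<lambda>x. exp_ext (\<psi> x))"
  shows "Psi \<theta> \<psi> F \<noteq> -\<infinity> \<Longrightarrow> (AE x in \<mu>. 0 < g (x - \<theta>)) \<and> integrable \<mu> (\<lambda>x. ln (g (x - \<theta>))) \<and> integrable lborel g"
    and "AE x in \<mu>. 0 < g (x - \<theta>) \<Longrightarrow> integrable \<mu> (\<lambda>x. ln (g (x - \<theta>))) \<Longrightarrow> integrable lborel g \<Longrightarrow>
      Psi \<theta> \<psi> F = ereal ((\<integral>x. ln (g (x - \<theta>)) \<partial>\<mu>) - (\<integral>x. g x \<partial>lborel))"
proof -
  have sets [measurable_cong]: "sets \<mu> = sets borel" using \<mu>(2) by auto
  have slc: "slc g" unfolding g by (rule SC0_slc[OF \<psi>])
  have gm [measurable]: "g \<in> borel_measurable borel" by (rule slc_measurable[OF slc])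
  have psi_eq: "\<psi> x = log_ext (g x)" for x by (simp only: g log_ext_exp_ext[OF SC0_less_top[OF \<psi>]])
  have hm [measurable]: "(\<lambda>x. \<psi> (x - \<theta>)) \<in> borel_measurable \<mu>"
    unfolding psi_eq log_ext_def by measurable
  have le: "\<psi> (x - \<theta>) \<le> ereal (ln (g 0))" for x
    using slc_le_0[OF slc, of "x - \<theta>"] slc_pos0[OF slc] slc_nonneg[OF slc, of "x - \<theta>"]
    by (auto simp: psi_eq log_ext_def)
  have ln: "real_of_ereal (\<psi> x) = ln (g x)" for x by (simp only: g ln_exp_ext[OF SC0_less_top[OF \<psi>]])
  have pos: "\<psi> x \<noteq> -\<infinity> \<longleftrightarrow> 0 < g x" for x by (simp add: g exp_ext_pos_iff)
  note E = ext_integral_real[OF \<mu>(1) hm le, unfolded ln pos]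
  have I: "(\<integral>\<^sup>+x. ennreal (exp_ext (\<psi> (x - \<theta>))) \<partial>lborel) = (\<integral>\<^sup>+x. ennreal (g x) \<partial>lborel)"
    using nn_integral_lborel_shift[of "\<lambda>x. ennreal (g x)" \<theta>, OF measurable_compose[OF gm measurable_ennreal]]
    by (simp add: g)
  have Psi: "Psi \<theta> \<psi> F = ext_integral \<mu> (\<lambda>x. \<psi> (x - \<theta>)) - enn2ereal (\<integral>\<^sup>+x. ennreal (g x) \<partial>lborel)"
    unfolding Psi_def I \<mu>(2) ..
  show "(AE x in \<mu>. 0 < g (x - \<theta>)) \<and> integrable \<mu> (\<lambda>x. ln (g (x - \<theta>))) \<and> integrable lborel g"
    if ne: "Psi \<theta> \<psi> F \<noteq> -\<infinity>"
  proof -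
    have 1: "ext_integral \<mu> (\<lambda>x. \<psi> (x - \<theta>)) \<noteq> -\<infinity>"
    proof
      assume "ext_integral \<mu> (\<lambda>x. \<psi> (x - \<theta>)) = -\<infinity>"
      then have "Psi \<theta> \<psi> F = -\<infinity>"
        unfolding Psi by (cases "enn2ereal (\<integral>\<^sup>+x. ennreal (g x) \<partial>lborel)") (auto simp: minus_ereal_def)
      with ne show False ..
    qed
    obtain e where e: "ext_integral \<mu> (\<lambda>x. \<psi> (x - \<theta>)) = ereal e" using E(1)[OF 1] E(2) by blast
    have "(\<integral>\<^sup>+x. ennreal (g x) \<partial>lborel) \<noteq> \<infinity>"
      using ne unfolding Psi e by auto
    then have "integrable lborel g"
      by (intro integrableI_nonneg) (auto simp: slc_nonneg[OF slc] less_top)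
    then show ?thesis using E(1)[OF 1] by blast
  qed
  assume *: "AE x in \<mu>. 0 < g (x - \<theta>)" "integrable \<mu> (\<lambda>x. ln (g (x - \<theta>)))" "integrable lborel g"
  have "(\<integral>\<^sup>+x. ennreal (g x) \<partial>lborel) = ennreal (\<integral>x. g x \<partial>lborel)"
    by (rule nn_integral_eq_integral[OF *(3)]) (simp add: slc_nonneg[OF slc])
  then show "Psi \<theta> \<psi> F = ereal ((\<integral>x. ln (g (x - \<theta>)) \<partial>\<mu>) - (\<integral>x. g x \<partial>lborel))"
    unfolding Psi E(2)[OF *(1,2)] by (simp add: slc_nonneg[OF slc])
qed

lemma maximizerD:
  assumes "is_maximizer F (\<theta>, \<psi>)"
  shows "\<psi> \<in> SC0" and "\<And>\<theta>' \<psi>'. \<psi>' \<in> SC0 \<Longrightarrow> Psi \<theta>' \<psi>' F \<le> Psi \<theta> \<psi> F"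
    and "L_crit F = Psi \<theta> \<psi> F"
proof -
  show \<psi>: "\<psi> \<in> SC0" and le: "\<And>\<theta>' \<psi>'. \<psi>' \<in> SC0 \<Longrightarrow> Psi \<theta>' \<psi>' F \<le> Psi \<theta> \<psi> F"
    using assms unfolding is_maximizer_def is_arg_max_def by (auto simp: not_less)
  show "L_crit F = Psi \<theta> \<psi> F"
    unfolding L_crit_def by (rule antisym) (use \<psi> le in \<open>auto intro!: SUP_least SUP_upper2[of "(\<theta>, \<psi>)"]\<close>)
qed

text \<open>Replacing \<open>\<psi>\<close> by \<open>\<psi> + c\<close> changes the criterion by \<open>c - (exp c - 1) * I\<close>, where \<open>I\<close> is the integral of
  \<open>exp \<psi>\<close>; this is nonpositive for all \<open>c\<close> only if \<open>I = 1\<close>.\<close>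

lemma maximizer_normalized:
  assumes max: "is_maximizer F (\<theta>, \<psi>)" and \<mu>: "prob_space \<mu>" "interval_measure F = \<mu>"
    and ne: "Psi \<theta> \<psi> F \<noteq> -\<infinity>"
  shows "(\<integral>x. exp_ext (\<psi> x) \<partial>lborel) = 1"
proof -
  interpret prob_space \<mu> by (rule \<mu>(1))
  have \<psi>: "\<psi> \<in> SC0" by (rule maximizerD(1)[OF max])
  define g where "g x = exp_ext (\<psi> x)" for x
  have geq: "g = (\<lambda>x. exp_ext (\<psi> x))" by (simp add: g_def fun_eq_iff)
  have slc: "slc g" unfolding geq by (rule SC0_slc[OF \<psi>])
  note fin = Psi_real(1)[OF \<mu> \<psi> geq ne]
  define A where "A = (\<integral>x. ln (g (x - \<theta>)) \<partial>\<mu>)"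
  define I where "I = (\<integral>x. g x \<partial>lborel)"
  have val: "Psi \<theta> \<psi> F = ereal (A - I)" using Psi_real(2)[OF \<mu> \<psi> geq] fin by (simp add: A_def I_def)
  have I0: "0 \<le> I" unfolding I_def by (rule Bochner_Integration.integral_nonneg) (rule slc_nonneg[OF slc])
  have le: "A + c - exp c * I \<le> A - I" for c
  proof -
    define g' where "g' x = exp_ext (\<psi> x + ereal c)" for x
    have g': "g' x = exp c * g x" for x
      using SC0_less_top[OF \<psi>, of x] by (cases "\<psi> x") (auto simp: g'_def g_def exp_ext_def exp_add)
    have geq': "g' = (\<lambda>x. exp_ext (\<psi> x + ereal c))" by (simp add: g'_def fun_eq_iff)
    have ln: "AE x in \<mu>. ln (g' (x - \<theta>)) = c + ln (g (x - \<theta>))"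
      using fin[THEN conjunct1] by eventually_elim (simp add: g' ln_mult)
    have int': "integrable \<mu> (\<lambda>x. ln (g' (x - \<theta>)))"
    proof (subst integrable_cong_AE[OF _ _ ln])
      have "(\<lambda>x. exp c * g x) \<in> borel_measurable borel"
        using slc_measurable[OF slc] by simp
      then have "g' \<in> borel_measurable borel"
        by (simp only: g'[abs_def])
      moreover have "sets \<mu> = sets borel" using \<mu>(2) by auto
      ultimately show "(\<lambda>x. ln (g' (x - \<theta>))) \<in> borel_measurable \<mu>"
        by (auto intro!: borel_measurable_ln simp: measurable_cong_sets[of \<mu> borel borel borel])
    qed (use fin in auto)
    have A': "(\<integral>x. ln (g' (x - \<theta>)) \<partial>\<mu>) = c + A"
    proof -
      have "(\<integral>x. ln (g' (x - \<theta>)) \<partial>\<mu>) = (\<integral>x. c + ln (g (x - \<theta>)) \<partial>\<mu>)"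
        using int' fin by (intro integral_cong_AE ln) auto
      then show ?thesis using fin by (simp add: A_def prob_space)
    qed
    have "Psi \<theta> (\<lambda>x. \<psi> x + ereal c) F = ereal ((\<integral>x. ln (g' (x - \<theta>)) \<partial>\<mu>) - (\<integral>x. g' x \<partial>lborel))"
    proof (rule Psi_real(2)[OF \<mu> SC0_add_const[OF \<psi>] geq' _ int'])
      show "AE x in \<mu>. 0 < g' (x - \<theta>)" using fin[THEN conjunct1] by eventually_elim (simp add: g')
      show "integrable lborel g'" using fin by (simp add: g'[abs_def])
    qed
    moreover have "(\<integral>x. g' x \<partial>lborel) = exp c * I" by (simp add: g' I_def)
    ultimately have "ereal (c + A - exp c * I) \<le> ereal (A - I)"
      using maximizerD(2)[OF max SC0_add_const[OF \<psi>, of c], of \<theta>] by (simp only: A' val)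
    then show ?thesis by simp
  qed
  \<comment> \<open>For \<open>I = 0\<close> the choice \<open>c = 1\<close> would improve the
    criterion.\<close>
  have "I \<noteq> 0" using le[of 1] by auto
  then have I: "0 < I" using I0 by simp
  \<comment> \<open>\<open>c = - ln I\<close> rescales to mass 1 and yields
    \<open>I - 1 \<le> ln I\<close>; the reverse inequality always holds, with equality only at
    1.\<close>
  have "ln I = I - 1"
    using le[of "- ln I"] I ln_le_minus_one[OF I] by (simp add: exp_minus)
  then show ?thesis using ln_eq_minus_one[OF I] by (simp add: I_def g_def)
qed

lemma slc_eq_of_AE:
  assumes g: "slc g" "(\<integral>\<^sup>+x. ennreal (g x) \<partial>lborel) = 1"
    and h: "slc h" "(\<integral>\<^sup>+x. ennreal (h x) \<partial>lborel) = 1" and ae: "AE x in lborel. g x = h x"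
  shows "g = h"
proof -
  have "AE x in lborel. x < 0 \<longrightarrow> left_branch g x = left_branch h x"
    using ae by eventually_elim (auto simp: left_branch_def)
  then have neg: "left_branch g x = left_branch h x" if "x < 0" for x
    using that by (intro right_continuous_eq_of_AE[where b=0] left_branch_rcont g h)
  have ne: "g x = h x" if "x \<noteq> 0" for x
    using neg[of "- \<bar>x\<bar>"] that by (simp add: slc_left_branch[OF g(1), symmetric] slc_left_branch[OF h(1), symmetric])
  have "(h \<longlongrightarrow> h 0) (at 0)" using slc_isCont_0[OF h] by (simp add: isCont_def)
  then have "(g \<longlongrightarrow> h 0) (at 0)"
    by (rule Lim_transform_eventually) (auto simp: ne eventually_at intro!: exI[of _ 1])
  moreover have "(g \<longlongrightarrow> g 0) (at 0)" using slc_isCont_0[OF g] by (simp add: isCont_def)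
  ultimately have "g 0 = h 0" using tendsto_unique[OF at_neq_bot] by blast
  then show ?thesis using ne by (metis ext)
qed

text \<open>For any competitor, a criterion value of at least \<open>L0 - 1\<close> is exactly the
  hypothesis \<open>ge\<close> of \<open>gibbs_equality\<close>, with the competitor's own mass in
  it. This forces the shifted densities to agree almost everywhere, then the centres, then the
  functions pointwise.\<close>

lemma unique_maximizer:
  fixes g0 :: "real \<Rightarrow> real"
  assumes \<psi>0: "\<psi>0 \<in> SC0" and g0: "g0 = (\<lambda>x. exp_ext (\<psi>0 x))" and g0_int: "(\<integral>\<^sup>+x. ennreal (g0 x) \<partial>lborel) = 1"
    and F: "interval_measure F = density lborel (\<lambda>x. ennreal (g0 (x - \<theta>0)))"
  shows "is_maximizer F p \<longleftrightarrow> p = (\<theta>0, \<psi>0)"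
    and "L_crit F = ereal ((\<integral>x. g0 x * ln (g0 x) \<partial>lborel) - 1)"
proof -
  define f0 where "f0 x = g0 (x - \<theta>0)" for x
  define \<mu> where "\<mu> = density lborel (\<lambda>x. ennreal (f0 x))"
  have F\<mu>: "interval_measure F = \<mu>" using F by (simp add: \<mu>_def f0_def)
  have slc0: "slc g0" unfolding g0 by (rule SC0_slc[OF \<psi>0])
  have [measurable]: "g0 \<in> borel_measurable borel" by (rule slc_measurable[OF slc0])
  have f0m [measurable]: "f0 \<in> borel_measurable borel" unfolding f0_def by measurable
  have f0_nonneg: "0 \<le> f0 x" for x by (simp add: f0_def slc_nonneg[OF slc0])
  have f0_nn: "(\<integral>\<^sup>+x. ennreal (f0 x) \<partial>lborel) = 1"
    using nn_integral_lborel_shift[of "\<lambda>x. ennreal (g0 x)" \<theta>0] g0_int by (simp add: f0_def)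
  have f0_int: "integrable lborel f0" "(\<integral>x. f0 x \<partial>lborel) = 1"
    using f0_nn f0_nonneg
    by (auto intro!: integrableI_nn_integral_finite[where x=1] integral_eq_nn_integral[THEN trans])
  have g0_I: "integrable lborel g0" "(\<integral>x. g0 x \<partial>lborel) = 1"
    using g0_int slc_nonneg[OF slc0]
    by (auto intro!: integrableI_nn_integral_finite[where x=1] integral_eq_nn_integral[THEN trans])
  have \<mu>: "prob_space \<mu>"
    by (rule prob_spaceI) (simp add: \<mu>_def emeasure_density f0_nn)
  define L0 where "L0 = (\<integral>x. g0 x * ln (g0 x) \<partial>lborel)"
  have f0_ln: "integrable lborel (\<lambda>x. f0 x * ln (f0 x))" "(\<integral>x. f0 x * ln (f0 x) \<partial>lborel) = L0"
    using lborel_integrable_real_affine[OF slc_entropy_integrable(2)[OF slc0 g0_int], of 1 "- \<theta>0"]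
      lborel_integral_real_affine[of 1 "\<lambda>x. g0 x * ln (g0 x)" "- \<theta>0"]
    by (simp_all add: f0_def L0_def add.commute[of "- \<theta>0"] cong: Bochner_Integration.integral_cong)
  have val0: "Psi \<theta>0 \<psi>0 F = ereal (L0 - 1)"
  proof -
    have "Psi \<theta>0 \<psi>0 F = ereal ((\<integral>x. ln (g0 (x - \<theta>0)) \<partial>\<mu>) - (\<integral>x. g0 x \<partial>lborel))"
    proof (rule Psi_real(2)[OF \<mu> F\<mu> \<psi>0 g0])
      show "AE x in \<mu>. 0 < g0 (x - \<theta>0)" unfolding \<mu>_def by (subst AE_density) (auto simp: f0_def)
      show "integrable \<mu> (\<lambda>x. ln (g0 (x - \<theta>0)))"
        unfolding \<mu>_def using f0_ln(1) by (subst integrable_density) (auto simp: f0_nonneg, simp add: f0_def)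
    qed (rule g0_I)
    also have "(\<integral>x. ln (g0 (x - \<theta>0)) \<partial>\<mu>) = L0"
      unfolding \<mu>_def using f0_ln(2) by (subst integral_density) (auto simp: f0_nonneg, simp add: f0_def)
    finally show ?thesis using g0_I by simp
  qed
  \<comment> \<open>This gives both halves: a strictly better pair would have to be the true one,
    and so would any other maximizer.\<close>
  have eq: "\<theta> = \<theta>0 \<and> \<psi> = \<psi>0" if \<psi>: "\<psi> \<in> SC0" and ge: "ereal (L0 - 1) \<le> Psi \<theta> \<psi> F" for \<theta> \<psi>
  proof -
    define g where "g x = exp_ext (\<psi> x)" for x
    have geq: "g = (\<lambda>x. exp_ext (\<psi> x))" by (simp add: g_def fun_eq_iff)
    have slc: "slc g" unfolding geq by (rule SC0_slc[OF \<psi>])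
    have [measurable]: "g \<in> borel_measurable borel" by (rule slc_measurable[OF slc])
    have "Psi \<theta> \<psi> F \<noteq> -\<infinity>" using ge by auto
    note fin = Psi_real(1)[OF \<mu> F\<mu> \<psi> geq this]
    have ge': "L0 - 1 \<le> (\<integral>x. ln (g (x - \<theta>)) \<partial>\<mu>) - (\<integral>x. g x \<partial>lborel)"
      using ge Psi_real(2)[OF \<mu> F\<mu> \<psi> geq] fin by simp
    define k where "k x = g (x - \<theta>)" for x
    have [measurable]: "k \<in> borel_measurable borel" unfolding k_def by measurable
    have k_nonneg: "0 \<le> k x" for x by (simp add: k_def slc_nonneg[OF slc])
    have k_int: "integrable lborel k" "(\<integral>x. k x \<partial>lborel) = (\<integral>x. g x \<partial>lborel)"
      using lborel_integrable_real_affine[of g 1 "- \<theta>"] lborel_integral_real_affine[of 1 g "- \<theta>"] fin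
      by (simp_all add: k_def[abs_def] add.commute[of "- \<theta>"] cong: Bochner_Integration.integral_cong)
    have ae: "AE x in lborel. k x = f0 x"
    proof (rule gibbs_equality)
      show "AE x in lborel. 0 < f0 x \<longrightarrow> 0 < k x"
        using fin[THEN conjunct1] unfolding \<mu>_def by (subst (asm) AE_density) (auto simp: k_def)
      show "integrable lborel (\<lambda>x. f0 x * ln (k x))"
        using fin[THEN conjunct2, THEN conjunct1] unfolding \<mu>_def
        by (subst (asm) integrable_density) (auto simp: f0_nonneg k_def)
      have "(\<integral>x. ln (g (x - \<theta>)) \<partial>\<mu>) = (\<integral>x. f0 x * ln (k x) \<partial>lborel)"
        unfolding \<mu>_def by (subst integral_density) (auto simp: f0_nonneg k_def)
      then show "(\<integral>x. f0 x * ln (f0 x) \<partial>lborel) + (\<integral>x. k x \<partial>lborel) - (\<integral>x. f0 x \<partial>lborel)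
              \<le> (\<integral>x. f0 x * ln (k x) \<partial>lborel)"
        using ge' by (simp add: f0_ln f0_int k_int)
    qed (use f0_int f0_nonneg k_int f0_ln k_nonneg in auto)
    have th: "\<theta>0 = \<theta>"
    proof (rule slc_centre_unique[OF slc0 g0_int, of g])
      show "AE x in lborel. g \<bar>x - \<theta>\<bar> = g0 (x - \<theta>0)"
        using ae by eventually_elim (simp add: k_def f0_def slc_abs[OF slc])
    qed
    have "AE x in lborel. k (\<theta>0 + 1 * x) = f0 (\<theta>0 + 1 * x)"
      using ae by (intro AE_borel_affine) auto
    then have ae': "AE x in lborel. g x = g0 x" by (simp add: k_def f0_def th)
    have "(\<integral>\<^sup>+x. ennreal (g x) \<partial>lborel) = (\<integral>\<^sup>+x. ennreal (g0 x) \<partial>lborel)"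
      using ae' by (intro nn_integral_cong_AE) (auto elim: eventually_mono)
    then have "g = g0" using slc_eq_of_AE[OF slc _ slc0 g0_int ae'] g0_int by simp
    then have "exp_ext (\<psi> x) = exp_ext (\<psi>0 x)" for x by (simp add: geq g0 fun_eq_iff)
    then have "\<psi> x = \<psi>0 x" for x
      using log_ext_exp_ext[OF SC0_less_top[OF \<psi>]] log_ext_exp_ext[OF SC0_less_top[OF \<psi>0]] by metis
    then show ?thesis using th by auto
  qed
  have max0: "is_maximizer F (\<theta>0, \<psi>0)"
    unfolding is_maximizer_def is_arg_max_def
  proof (intro conjI notI)
    assume "\<exists>y. y \<in> UNIV \<times> SC0 \<and> (case (\<theta>0, \<psi>0) of (\<theta>, \<psi>) \<Rightarrow> Psi \<theta> \<psi> F) < (case y of (\<theta>, \<psi>) \<Rightarrow> Psi \<theta> \<psi> F)"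
    then obtain \<theta> \<psi> where y: "\<psi> \<in> SC0" "Psi \<theta>0 \<psi>0 F < Psi \<theta> \<psi> F" by auto
    then have "\<theta> = \<theta>0 \<and> \<psi> = \<psi>0" by (intro eq) (auto simp: val0)
    then show False using y(2) by simp
  qed (use \<psi>0 in auto)
  show "L_crit F = ereal ((\<integral>x. g0 x * ln (g0 x) \<partial>lborel) - 1)"
    using maximizerD(3)[OF max0] val0 by (simp add: L0_def)
  show "is_maximizer F p \<longleftrightarrow> p = (\<theta>0, \<psi>0)"
  proof
    assume max: "is_maximizer F p"
    obtain \<theta> \<psi> where p: "p = (\<theta>, \<psi>)" by force
    have "\<theta> = \<theta>0 \<and> \<psi> = \<psi>0"
      using maximizerD(1,2)[OF max[unfolded p]] \<psi>0 val0 by (intro eq) metis+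
    then show "p = (\<theta>0, \<psi>0)" using p by simp
  qed (use max0 in simp)
qed

section \<open>Empirical distributions\<close>

lemma interval_measure_cdf:
  assumes "real_distribution \<mu>"
  shows "interval_measure (cdf \<mu>) = \<mu>"
proof -
  interpret real_distribution \<mu> by fact
  show ?thesis
    by (intro cdf_unique assms real_distribution_interval_measure cdf_interval_measure
        cdf_nondecreasing cdf_is_right_cont cdf_lim_at_bot cdf_lim_at_top_prob)
qed

text \<open>The law of \<open>X I\<close> for an index \<open>I\<close> uniform on
  \<open>{1..n}\<close>. In this form it is a probability measure at once, and integrals are sample
  means even when observations coincide.\<close>

definition empirical :: "(nat \<Rightarrow> 'a \<Rightarrow> real) \<Rightarrow> nat \<Rightarrow> 'a \<Rightarrow> real measure" where
  "empirical X n \<omega> = distr (measure_pmf (pmf_of_set {1..n})) borel (\<lambda>i. X i \<omega>)"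

lemma empirical_distribution: "real_distribution (empirical X n \<omega>)"
  unfolding empirical_def by (rule prob_space.real_distribution_distr[OF measure_pmf.prob_space_axioms]) simp

lemma cdf_empirical:
  assumes "1 \<le> n"
  shows "cdf (empirical X n \<omega>) = ecdf X n \<omega>"
proof
  fix x
  have "cdf (empirical X n \<omega>) x = measure (measure_pmf (pmf_of_set {1..n})) {i. X i \<omega> \<le> x}"
    unfolding cdf_def empirical_def by (subst measure_distr) (auto simp: vimage_def)
  also have "\<dots> = ecdf X n \<omega> x"
    using assms by (subst measure_pmf_of_set) (auto simp: ecdf_def Int_def)
  finally show "cdf (empirical X n \<omega>) x = ecdf X n \<omega> x" .
qed

lemma interval_measure_ecdf: "1 \<le> n \<Longrightarrow> interval_measure (ecdf X n \<omega>) = empirical X n \<omega>"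
  using interval_measure_cdf[OF empirical_distribution] cdf_empirical by metis

lemma empirical_expectation:
  assumes "1 \<le> n" and [measurable]: "\<phi> \<in> borel_measurable borel"
  shows "integrable (empirical X n \<omega>) \<phi>"
    and "(\<integral>x. \<phi> x \<partial>empirical X n \<omega>) = (\<Sum>i\<in>{1..n}. \<phi> (X i \<omega>)) / real n"
proof -
  have fin: "finite (set_pmf (pmf_of_set {1..n}))" using assms(1) by (subst set_pmf_of_set) auto
  show "integrable (empirical X n \<omega>) \<phi>"
    unfolding empirical_def by (subst integrable_distr_eq) (simp, simp, rule integrable_measure_pmf_finite[OF fin])
  show "(\<integral>x. \<phi> x \<partial>empirical X n \<omega>) = (\<Sum>i\<in>{1..n}. \<phi> (X i \<omega>)) / real n"
    unfolding empirical_def using assms(1) by (subst integral_distr) (auto simp: integral_pmf_of_set)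
qed

lemma AE_empirical:
  assumes "1 \<le> n" and [measurable]: "Measurable.pred borel P" and "\<And>i. 1 \<le> i \<Longrightarrow> P (X i \<omega>)"
  shows "AE x in empirical X n \<omega>. P x"
  unfolding empirical_def using assms by (subst AE_distr_iff) (auto simp: AE_measure_pmf_iff)

section \<open>Strong laws for the sample and construction of the coupling\<close>

lemma (in prob_space) strong_law_identically_distributed:
  fixes X :: "nat \<Rightarrow> 'a \<Rightarrow> real" and \<phi> :: "real \<Rightarrow> real"
  assumes indep: "indep_vars (\<lambda>_. borel) X {1..}"
    and dist: "\<And>i. 1 \<le> i \<Longrightarrow> distr M borel (X i) = \<mu>"
    and [measurable]: "\<phi> \<in> borel_measurable borel" and nonneg: "\<And>x. 0 \<le> \<phi> x"
    and sq: "integrable \<mu> (\<lambda>x. (\<phi> x)\<^sup>2)"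
  shows "AE \<omega> in M. (\<lambda>n. (\<Sum>i\<in>{1..n}. \<phi> (X i \<omega>)) / real n) \<longlonglongrightarrow> (\<integral>x. \<phi> x \<partial>\<mu>)"
proof (rule strong_law_nonneg_square_integrable[where v="\<integral>x. (\<phi> x)\<^sup>2 \<partial>\<mu>"])
  show "indep_vars (\<lambda>_. borel) (\<lambda>i \<omega>. \<phi> (X i \<omega>)) {1..}"
    by (rule indep_vars_compose2[OF indep]) auto
  fix i :: nat assume i: "1 \<le> i"
  have X [measurable]: "X i \<in> borel_measurable M" using indep i unfolding indep_vars_def by auto
  show "integrable M (\<lambda>\<omega>. (\<phi> (X i \<omega>))\<^sup>2)"
    using sq unfolding dist[OF i, symmetric] by (subst (asm) integrable_distr_eq) auto
  show "expectation (\<lambda>\<omega>. \<phi> (X i \<omega>)) = (\<integral>x. \<phi> x \<partial>\<mu>)"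
    unfolding dist[OF i, symmetric] by (subst integral_distr) auto
  show "expectation (\<lambda>\<omega>. (\<phi> (X i \<omega>))\<^sup>2) = (\<integral>x. (\<phi> x)\<^sup>2 \<partial>\<mu>)"
    unfolding dist[OF i, symmetric] by (subst integral_distr) auto
qed (rule nonneg)

text \<open>Reduces convergence of distribution functions to countably many points, hence to
  countably many almost sure events.\<close>

lemma mono_tendsto_of_rationals:
  fixes F :: "nat \<Rightarrow> real \<Rightarrow> real"
  assumes mono: "\<And>n. mono (F n)" and conv: "\<And>q. q \<in> \<rat> \<Longrightarrow> (\<lambda>n. F n q) \<longlonglongrightarrow> G q" and cont: "isCont G x"
  shows "(\<lambda>n. F n x) \<longlonglongrightarrow> G x"
proof (rule LIMSEQ_I)
  fix e :: real assume "0 < e"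
  obtain d where d: "d > 0" "\<And>y. \<bar>y - x\<bar> < d \<Longrightarrow> \<bar>G y - G x\<bar> < e / 2"
    using cont \<open>0 < e\<close> unfolding continuous_at_eps_delta dist_real_def by (metis half_gt_zero)
  obtain p where p: "p \<in> \<rat>" "x - d < p" "p < x" using Rats_dense_in_real[of "x - d" x] d by auto
  obtain q where q: "q \<in> \<rat>" "x < q" "q < x + d" using Rats_dense_in_real[of x "x + d"] d by auto
  have "\<forall>\<^sub>F n in sequentially. \<bar>F n p - G p\<bar> < e / 2" "\<forall>\<^sub>F n in sequentially. \<bar>F n q - G q\<bar> < e / 2"
    using tendstoD[OF conv[OF p(1)], of "e/2"] tendstoD[OF conv[OF q(1)], of "e/2"] \<open>0 < e\<close>
    by (simp_all add: dist_real_def)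
  then have "\<forall>\<^sub>F n in sequentially. norm (F n x - G x) < e"
  proof eventually_elim
    case (elim n)
    have "F n p \<le> F n x" "F n x \<le> F n q" using p q by (auto intro!: monoD[OF mono])
    moreover have "\<bar>G p - G x\<bar> < e / 2" "\<bar>G q - G x\<bar> < e / 2" using p q d(2)[of p] d(2)[of q] by auto
    ultimately show ?case unfolding real_norm_def using elim by linarith
  qed
  then show "\<exists>no. \<forall>n\<ge>no. norm (F n x - G x) < e" by (simp add: eventually_sequentially)
qed

text \<open>Indices are shifted by 2 because a single observation admits no maximizer: uniform
  densities on ever shorter intervals around it have unbounded criterion. The true pair has
  criterion \<open>a n - 1\<close>. The maximizer has total mass 1, so its criterion is its mean
  log-likelihood minus the same 1, and optimality becomes \<open>a n \<le> A n\<close>.\<close>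

lemma coupled_sample_exists:
  fixes X :: "nat \<Rightarrow> 'a \<Rightarrow> real" and \<omega> :: 'a
  assumes \<psi>0: "\<psi>0 \<in> SC0" and g0: "g0 = (\<lambda>x. exp_ext (\<psi>0 x))" and g0_int: "(\<integral>\<^sup>+x. ennreal (g0 x) \<partial>lborel) = 1"
    and P0: "real_distribution (density lborel (\<lambda>x. ennreal (g0 (x - \<theta>0))))" "F0 = cdf (density lborel (\<lambda>x. ennreal (g0 (x - \<theta>0))))"
    and max: "\<And>n. 2 \<le> n \<Longrightarrow> is_maximizer (ecdf X n \<omega>) (\<theta> n, \<psi> n)"
    and cdf_lim: "\<And>q. q \<in> \<rat> \<Longrightarrow> (\<lambda>n. ecdf X n \<omega> q) \<longlonglongrightarrow> F0 q"
    and ln_lim: "(\<lambda>n. (\<Sum>i\<in>{1..n}. ln (g0 (X i \<omega> - \<theta>0))) / real n) \<longlonglongrightarrow> (\<integral>x. g0 x * ln (g0 x) \<partial>lborel)"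
    and X_pos: "\<And>i. 1 \<le> i \<Longrightarrow> 0 < g0 (X i \<omega> - \<theta>0)"
  shows "\<exists>(N :: real measure) Y Y0. coupled_sample N Y Y0 g0 \<theta>0 (\<lambda>n x. exp_ext (\<psi> (n + 2) x)) (\<lambda>n. \<theta> (n + 2))
            (\<lambda>n. (\<Sum>i\<in>{1..n+2}. ln (g0 (X i \<omega> - \<theta>0))) / real (n + 2)) \<and>
          (\<forall>n. L_crit (ecdf X (n + 2) \<omega>)
              = ereal (coupled_sample.A N Y (\<lambda>n x. exp_ext (\<psi> (n + 2) x)) (\<lambda>n. \<theta> (n + 2)) n - 1))"
proof -
  let ?P0 = "density lborel (\<lambda>x. ennreal (g0 (x - \<theta>0)))"
  let ?\<mu> = "\<lambda>n. empirical X (n + 2) \<omega>"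
  have slc0: "slc g0" unfolding g0 by (rule SC0_slc[OF \<psi>0])
  have [measurable]: "g0 \<in> borel_measurable borel" by (rule slc_measurable[OF slc0])
  have g0_I: "integrable lborel g0" "(\<integral>x. g0 x \<partial>lborel) = 1"
    using g0_int slc_nonneg[OF slc0]
    by (auto intro!: integrableI_nn_integral_finite[where x=1] integral_eq_nn_integral[THEN trans])
  have "weak_conv_m ?\<mu> ?P0"
    unfolding weak_conv_m_def weak_conv_def
  proof (intro allI impI)
    fix x assume c: "isCont (cdf ?P0) x"
    have "(\<lambda>n. cdf (empirical X (n + 2) \<omega>) x) \<longlonglongrightarrow> cdf ?P0 x"
    proof (rule mono_tendsto_of_rationals[OF _ _ c])
      show "mono (cdf (empirical X (n + 2) \<omega>))" for n
        using real_distribution.finite_borel_measure_M[OF empirical_distribution]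
        by (intro monoI finite_borel_measure.cdf_nondecreasing) auto
      show "(\<lambda>n. cdf (empirical X (n + 2) \<omega>) q) \<longlonglongrightarrow> cdf ?P0 q" if "q \<in> \<rat>" for q
        using LIMSEQ_ignore_initial_segment[OF cdf_lim[OF that], of 2] by (simp add: cdf_empirical P0(2))
    qed
    then show "(\<lambda>n. cdf (?\<mu> n) x) \<longlonglongrightarrow> cdf ?P0 x" .
  qed
  from Skorohod[OF empirical_distribution P0(1) this]
  obtain N :: "real measure" and Y Y0 where N: "prob_space N" and Ym: "\<And>n. Y n \<in> measurable N borel"
    and Yd: "\<And>n. distr N borel (Y n) = ?\<mu> n" and Y0m: "Y0 \<in> measurable N lborel"
    and Y0d: "distr N borel Y0 = ?P0" and lim: "\<And>x. x \<in> space N \<Longrightarrow> (\<lambda>n. Y n x) \<longlonglongrightarrow> Y0 x"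
    by blast
  define g where "g n x = exp_ext (\<psi> (n + 2) x)" for n x
  define t where "t n = \<theta> (n + 2)" for n
  define a where "a n = (\<Sum>i\<in>{1..n+2}. ln (g0 (X i \<omega> - \<theta>0))) / real (n + 2)" for n
  have SC: "\<psi> (n + 2) \<in> SC0" for n by (rule maximizerD(1)[OF max]) simp
  have geq: "g n = (\<lambda>x. exp_ext (\<psi> (n + 2) x))" for n by (simp add: g_def fun_eq_iff)
  have slc: "slc (g n)" for n unfolding geq by (rule SC0_slc[OF SC])
  have gm [measurable]: "g n \<in> borel_measurable borel" for n by (rule slc_measurable[OF slc])
  have \<mu>: "prob_space (?\<mu> n)" for n
    using empirical_distribution[of X "n + 2" \<omega>] by (simp add: real_distribution_def)
  have \<mu>F: "interval_measure (ecdf X (n + 2) \<omega>) = ?\<mu> n" for n by (rule interval_measure_ecdf) simp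
  \<comment> \<open>Positivity at all observations makes this value finite, so the maximizer cannot
    have criterion \<open>-\<infinity>\<close>.\<close>
  have Psi0: "Psi \<theta>0 \<psi>0 (ecdf X (n + 2) \<omega>) = ereal (a n - 1)" for n
  proof -
    have "Psi \<theta>0 \<psi>0 (ecdf X (n + 2) \<omega>) = ereal ((\<integral>x. ln (g0 (x - \<theta>0)) \<partial>?\<mu> n) - (\<integral>x. g0 x \<partial>lborel))"
      by (rule Psi_real(2)[OF \<mu> \<mu>F \<psi>0 g0])
         (auto intro!: AE_empirical empirical_expectation g0_I X_pos)
    then show ?thesis using g0_I by (subst (asm) empirical_expectation(2)) (auto simp: a_def)
  qed
  have Psi_ge: "ereal (a n - 1) \<le> Psi (t n) (\<psi> (n + 2)) (ecdf X (n + 2) \<omega>)" for n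
    using maximizerD(2)[OF max \<psi>0, of "n + 2" \<theta>0] Psi0[of n] by (simp add: t_def)
  have ne: "Psi (t n) (\<psi> (n + 2)) (ecdf X (n + 2) \<omega>) \<noteq> -\<infinity>" for n
  proof
    assume eq: "Psi (t n) (\<psi> (n + 2)) (ecdf X (n + 2) \<omega>) = -\<infinity>"
    show False using Psi_ge[of n] unfolding eq by simp
  qed
  have max': "is_maximizer (ecdf X (n + 2) \<omega>) (t n, \<psi> (n + 2))" for n
    using max[of "n + 2"] by (simp add: t_def)
  have g_I: "(\<integral>x. g n x \<partial>lborel) = 1" for n
    unfolding g_def by (rule maximizer_normalized[OF max' \<mu> \<mu>F ne])
  note fin = Psi_real(1)[OF \<mu> \<mu>F SC geq ne]
  have g_int: "(\<integral>\<^sup>+x. ennreal (g n x) \<partial>lborel) = 1" for n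
    using nn_integral_eq_integral[of lborel "g n"] fin g_I slc_nonneg[OF slc] by simp
  have val: "Psi (t n) (\<psi> (n + 2)) (ecdf X (n + 2) \<omega>) = ereal ((\<integral>x. ln (g n (x - t n)) \<partial>?\<mu> n) - 1)" for n
    using Psi_real(2)[OF \<mu> \<mu>F SC geq, of n "t n"] fin[of n] g_I[of n] by simp
  have tr: "(\<integral>x. ln (g n (x - t n)) \<partial>?\<mu> n) = (\<integral>x. ln (g n (Y n x - t n)) \<partial>N)" for n
    unfolding Yd[symmetric] by (subst integral_distr[OF Ym]) auto
  interpret C: coupled_sample N Y Y0 g0 \<theta>0 g t a
  proof (intro coupled_sample.intro coupled_sample_axioms.intro)
    show "AE x in N. 0 < g n (Y n x - t n)" for n
      using fin[of n, THEN conjunct1] unfolding Yd[symmetric] by (subst (asm) AE_distr_iff[OF Ym]) auto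
    show "integrable N (\<lambda>x. ln (g n (Y n x - t n)))" for n
      using fin[of n, THEN conjunct2, THEN conjunct1] unfolding Yd[symmetric]
      by (subst (asm) integrable_distr_eq[OF Ym]) auto
    show "a n \<le> (\<integral>x. ln (g n (Y n x - t n)) \<partial>N)" for n
      using Psi_ge[of n] unfolding val tr by simp
    show "a \<longlonglongrightarrow> (\<integral>x. g0 x * ln (g0 x) \<partial>lborel)"
      using LIMSEQ_ignore_initial_segment[OF ln_lim, of 2] unfolding a_def[abs_def] .
    show "Y0 \<in> borel_measurable N" using Y0m by simp
  qed (use N Ym Y0d lim slc0 g0_int slc g_int in auto)
  have "L_crit (ecdf X (n + 2) \<omega>) = ereal (C.A n - 1)" for n
    using maximizerD(3)[OF max', of n] unfolding val tr C.A_def .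
  then show ?thesis
    using C.coupled_sample_axioms unfolding g_def[abs_def] t_def[abs_def] a_def[abs_def] by blast
qed

lemma log_ext_less_iff:
  assumes "0 \<le> y"
  shows "log_ext y < ereal c \<longleftrightarrow> y < exp c"
proof (cases "y = 0")
  case False
  then have "ln y < c \<longleftrightarrow> exp (ln y) < exp c" by simp
  then show ?thesis using False assms by (simp add: log_ext_def)
qed (simp add: log_ext_def)

text \<open>\<open>log_concave\<close> places the true pair among the competitors. Pointwise
  convergence of \<open>ghat\<close> is asserted at continuity points of \<open>g0\<close>: uniform
  densities on intervals growing to \<open>[-1, 1]\<close> converge everywhere except at the two
  jumps, where closedness gives the limit its upper value.\<close>

theorem corollary4:
  fixes M :: "'a measure" and X :: "nat \<Rightarrow> 'a \<Rightarrow> real"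
    and F0 f0 g0 :: "real \<Rightarrow> real" and \<psi>0 :: "real \<Rightarrow> ereal" and \<theta>0 :: real
    and \<theta>hat :: "nat \<Rightarrow> 'a \<Rightarrow> real" and \<psi>hat :: "nat \<Rightarrow> 'a \<Rightarrow> real \<Rightarrow> ereal"
    and ghat :: "nat \<Rightarrow> 'a \<Rightarrow> real \<Rightarrow> real"
  assumes "prob_space M"
    and "prob_space.indep_vars M (\<lambda>_. borel) X {1..}"
    and "\<And>i. i \<ge> 1 \<Longrightarrow> cdf (distr M borel (X i)) = F0"
    and "F0 = cdf (density lborel (\<lambda>x. ennreal (f0 x)))"
    and "f0 \<in> P1"
    and "\<And>x. f0 (\<theta>0 + x) = f0 (\<theta>0 - x)"
    and g0_def: "g0 = (\<lambda>x. f0 (x + \<theta>0))"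
    and psi0_def: "\<psi>0 = (\<lambda>x. log_ext (g0 x))"
    and log_concave: "\<psi>0 \<in> SC0"
    and mle: "AE \<omega> in M. \<forall>n\<ge>2. is_maximizer (ecdf X n \<omega>) (\<theta>hat n \<omega>, \<psi>hat n \<omega>)"
    and ghat_def: "ghat = (\<lambda>n \<omega> x. exp_ext (\<psi>hat n \<omega> x))"
  shows "((\<exists>!p. is_maximizer F0 p) \<and> theta_star F0 = \<theta>0 \<and> f_star F0 = f0
           \<and> g_star F0 = g0 \<and> psi_star F0 = \<psi>0)
    \<and> (AE \<omega> in M. (\<lambda>n. L_crit (ecdf X n \<omega>)) \<longlonglongrightarrow> L_crit F0)
    \<and> (AE \<omega> in M. (\<lambda>n. \<theta>hat n \<omega>) \<longlonglongrightarrow> \<theta>0)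
    \<and> (AE \<omega> in M. \<forall>x \<in> interior (effective_domain \<psi>0). (\<lambda>n. \<psi>hat n \<omega> x) \<longlonglongrightarrow> \<psi>0 x)
    \<and> (AE \<omega> in M. \<forall>x. limsup (\<lambda>n. \<psi>hat n \<omega> x) \<le> \<psi>0 x)
    \<and> (AE \<omega> in M. \<forall>x. isCont g0 x \<longrightarrow> (\<lambda>n. ghat n \<omega> x) \<longlonglongrightarrow> g0 x)
    \<and> (\<exists>\<alpha>>0. \<forall>\<alpha>1<\<alpha>.
          (AE \<omega> in M. (\<lambda>n. \<integral>\<^sup>+ x. ennreal (exp (\<alpha>1 * \<bar>x\<bar>) * \<bar>ghat n \<omega> x - g0 x\<bar>) \<partial>lborel) \<longlonglongrightarrow> 0)
          \<and> (continuous_on UNIV g0 \<longrightarrow>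
              (AE \<omega> in M. (\<lambda>n. SUP x. ennreal (exp (\<alpha>1 * \<bar>x\<bar>) * \<bar>ghat n \<omega> x - g0 x\<bar>)) \<longlonglongrightarrow> 0)))"
proof -
  interpret prob_space M by fact
  define P0 where "P0 = density lborel (\<lambda>x. ennreal (f0 x))"
  have f0_meas [measurable]: "f0 \<in> borel_measurable borel" and f0_nonneg: "0 \<le> f0 x"
    and f0_int: "(\<integral>\<^sup>+x. ennreal (f0 x) \<partial>lborel) = 1" for x
    using assms(5) by (auto simp: P1_def)
  have P0: "real_distribution P0"
  proof -
    have "prob_space P0" by (rule prob_spaceI) (simp add: P0_def emeasure_density f0_int)
    then show ?thesis by (simp add: real_distribution_def real_distribution_axioms_def P0_def)
  qed
  have F0: "F0 = cdf P0" unfolding P0_def by (rule assms(4))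
  have g0_nonneg: "0 \<le> g0 x" for x by (simp add: g0_def f0_nonneg)
  have g0_exp: "g0 = (\<lambda>x. exp_ext (\<psi>0 x))" by (simp add: psi0_def exp_ext_log_ext g0_nonneg)
  have slc0: "slc g0" unfolding g0_exp by (rule SC0_slc[OF log_concave])
  have [measurable]: "g0 \<in> borel_measurable borel" by (rule slc_measurable[OF slc0])
  have f0_eq: "f0 = (\<lambda>x. g0 (x - \<theta>0))" by (simp add: g0_def)
  have g0_int: "(\<integral>\<^sup>+x. ennreal (g0 x) \<partial>lborel) = 1"
    using nn_integral_lborel_shift[of "\<lambda>x. ennreal (g0 x)" \<theta>0] f0_int by (simp add: f0_eq)
  have P0_g0: "P0 = density lborel (\<lambda>x. ennreal (g0 (x - \<theta>0)))" by (simp add: P0_def f0_eq)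
  define L0 where "L0 = (\<integral>x. g0 x * ln (g0 x) \<partial>lborel)"

  have F0_meas: "interval_measure F0 = density lborel (\<lambda>x. ennreal (g0 (x - \<theta>0)))"
    using interval_measure_cdf[OF P0] by (simp add: F0 P0_g0)
  note uniq = unique_maximizer[OF log_concave g0_exp g0_int F0_meas]
  \<comment> \<open>\<open>arg_max\<close> is a choice among maximizers; uniqueness determines
    it.\<close>
  have star: "star F0 = (\<theta>0, \<psi>0)"
  proof -
    have "star F0 = (SOME p. is_maximizer F0 p)"
      by (simp add: star_def arg_max_def is_maximizer_def)
    then show ?thesis by (simp add: uniq(1))
  qed
  have g_star: "g_star F0 = g0"
    using g0_exp by (simp add: g_star_def[abs_def] psi_star_def star)
  have part0: "(\<exists>!p. is_maximizer F0 p) \<and> theta_star F0 = \<theta>0 \<and> f_star F0 = f0 \<and> g_star F0 = g0 \<and> psi_star F0 = \<psi>0"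
    using g_star f0_eq by (simp add: uniq(1) theta_star_def psi_star_def star f_star_def[abs_def])

  have X_meas [measurable]: "X i \<in> borel_measurable M" if "1 \<le> i" for i
    using assms(2) that unfolding indep_vars_def by auto
  have dist: "distr M borel (X i) = P0" if "1 \<le> i" for i
    using assms(3)[OF that] F0 P0 X_meas[OF that]
    by (intro cdf_unique real_distribution_distr) auto
  have ev_pos: "AE \<omega> in M. \<forall>i\<ge>1. 0 < g0 (X i \<omega> - \<theta>0)"
  proof -
    have "AE \<omega> in M. 1 \<le> i \<longrightarrow> 0 < g0 (X i \<omega> - \<theta>0)" for i
    proof (cases "1 \<le> i")
      case True
      have "AE x in P0. 0 < g0 (x - \<theta>0)"
        unfolding P0_g0 by (subst AE_density) auto
      then have "AE x in distr M borel (X i). 0 < g0 (x - \<theta>0)" by (simp only: dist[OF True])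
      from AE_distrD[OF X_meas[OF True] this] show ?thesis by simp
    qed simp
    then show ?thesis by (simp add: AE_all_countable)
  qed
  \<comment> \<open>Countability of the rationals allows one exceptional null set for all
    \<open>q\<close>.\<close>
  have ev_cdf: "AE \<omega> in M. \<forall>q\<in>\<rat>. (\<lambda>n. ecdf X n \<omega> q) \<longlonglongrightarrow> F0 q"
  proof (rule AE_ball_countable')
    interpret P0: real_distribution P0 by (rule P0)
    fix q :: real
    have "(indicat_real {..q} x)\<^sup>2 = indicat_real {..q} x" for x :: real
      by (simp add: indicator_def)
    then have "AE \<omega> in M. (\<lambda>n. (\<Sum>i\<in>{1..n}. indicat_real {..q} (X i \<omega>)) / real n) \<longlonglongrightarrow> (\<integral>x. indicat_real {..q} x \<partial>P0)"
      by (intro strong_law_identically_distributed[OF assms(2) dist])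
         (auto intro!: integrable_real_indicator simp: less_top[symmetric])
    moreover have "(\<Sum>i\<in>{1..n}. indicat_real {..q} (X i \<omega>)) / real n = ecdf X n \<omega> q" for n \<omega>
      by (simp add: ecdf_def indicator_def sum.If_cases Int_def)
    moreover have "(\<integral>x. indicat_real {..q} x \<partial>P0) = F0 q"
      by (simp add: F0 cdf_def)
    ultimately show "AE \<omega> in M. (\<lambda>n. ecdf X n \<omega> q) \<longlonglongrightarrow> F0 q" by simp
  qed (rule countable_rat)
  have ev_ln: "AE \<omega> in M. (\<lambda>n. (\<Sum>i\<in>{1..n}. ln (g0 (X i \<omega> - \<theta>0))) / real n) \<longlonglongrightarrow> L0"
  proof -
    interpret P0: real_distribution P0 by (rule P0)
    \<comment> \<open>Makes \<open>c - ln g0\<close> nonnegative for the strong law. The maximum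
      with 0 covers points with \<open>g0 = 0\<close>, where the real \<open>ln\<close> has the
      default value 0.\<close>
    define c where "c = max 0 (ln (g0 0))"
    have dens: "integrable P0 (\<lambda>x. \<phi> (x - \<theta>0)) \<longleftrightarrow> integrable lborel (\<lambda>x. g0 x * \<phi> x)"
        "(\<integral>x. \<phi> (x - \<theta>0) \<partial>P0) = (\<integral>x. g0 x * \<phi> x \<partial>lborel)"
      if [measurable]: "\<phi> \<in> borel_measurable borel" for \<phi> :: "real \<Rightarrow> real"
      unfolding P0_g0
      using lborel_integrable_real_affine_iff[of 1 "\<lambda>x. g0 x * \<phi> x" "- \<theta>0"]
        lborel_integral_real_affine[of 1 "\<lambda>x. g0 x * \<phi> x" "- \<theta>0"]
      by (simp_all add: integrable_density integral_density g0_nonneg add.commute[of "- \<theta>0"]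
          cong: Bochner_Integration.integral_cong)
    have sq: "integrable P0 (\<lambda>x. (ln (g0 (x - \<theta>0)))\<^sup>2)" and int: "integrable P0 (\<lambda>x. ln (g0 (x - \<theta>0)))"
      using dens(1)[of "\<lambda>x. (ln (g0 x))\<^sup>2"] dens(1)[of "\<lambda>x. ln (g0 x)"] slc_entropy_integrable[OF slc0 g0_int]
      by auto
    have "AE \<omega> in M. (\<lambda>n. (\<Sum>i\<in>{1..n}. c - ln (g0 (X i \<omega> - \<theta>0))) / real n) \<longlonglongrightarrow> (\<integral>x. c - ln (g0 (x - \<theta>0)) \<partial>P0)"
    proof (rule strong_law_identically_distributed[OF assms(2) dist])
      show "0 \<le> c - ln (g0 (x - \<theta>0))" for x
      proof (cases "0 < g0 (x - \<theta>0)")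
        case True
        then have "ln (g0 (x - \<theta>0)) \<le> ln (g0 0)" using slc_le_0[OF slc0, of "x - \<theta>0"] by simp
        then show ?thesis by (simp add: c_def)
      next
        case False
        then have "g0 (x - \<theta>0) = 0" using g0_nonneg[of "x - \<theta>0"] by simp
        then show ?thesis by (simp add: c_def)
      qed
      show "integrable P0 (\<lambda>x. (c - ln (g0 (x - \<theta>0)))\<^sup>2)"
        using sq int by (simp add: power2_diff)
    qed auto
    then show ?thesis
    proof eventually_elim
      case (elim \<omega>)
      have lim: "(\<integral>x. c - ln (g0 (x - \<theta>0)) \<partial>P0) = c - L0"
        using int dens(2)[of "\<lambda>x. ln (g0 x)"] by (simp add: L0_def P0.prob_space[simplified])
      have "(\<lambda>n. c - (\<Sum>i\<in>{1..n}. c - ln (g0 (X i \<omega> - \<theta>0))) / real n) \<longlonglongrightarrow> c - (c - L0)"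
        by (intro tendsto_intros elim[unfolded lim])
      moreover have "\<forall>\<^sub>F n in sequentially. c - (\<Sum>i\<in>{1..n}. c - ln (g0 (X i \<omega> - \<theta>0))) / real n
          = (\<Sum>i\<in>{1..n}. ln (g0 (X i \<omega> - \<theta>0))) / real n"
        using eventually_gt_at_top[of 0]
        by eventually_elim (simp add: sum_subtractf diff_divide_distrib)
      ultimately show ?case by (auto dest: Lim_transform_eventually)
    qed
  qed

  \<comment> \<open>Equal to \<open>1 / R\<close> in every coupling. It depends on \<open>g0\<close>
    only, so it can be fixed before the sample path.\<close>
  define \<alpha> where "\<alpha> = 1 / exp (2 - L0)"
  have path: "(\<lambda>n. L_crit (ecdf X n \<omega>)) \<longlonglongrightarrow> L_crit F0 \<and> (\<lambda>n. \<theta>hat n \<omega>) \<longlonglongrightarrow> \<theta>0 \<and>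
      (\<forall>x. isCont g0 x \<longrightarrow> (\<lambda>n. ghat n \<omega> x) \<longlonglongrightarrow> g0 x) \<and>
      (\<forall>x. \<forall>e>0. \<forall>\<^sub>F n in sequentially. ghat n \<omega> x < g0 x + e) \<and>
      (\<forall>n\<ge>2. \<psi>hat n \<omega> \<in> SC0) \<and>
      (\<forall>\<alpha>1<\<alpha>. (\<lambda>n. \<integral>\<^sup>+ x. ennreal (exp (\<alpha>1 * \<bar>x\<bar>) * \<bar>ghat n \<omega> x - g0 x\<bar>) \<partial>lborel) \<longlonglongrightarrow> 0 \<and>
        (continuous_on UNIV g0 \<longrightarrow> (\<lambda>n. SUP x. ennreal (exp (\<alpha>1 * \<bar>x\<bar>) * \<bar>ghat n \<omega> x - g0 x\<bar>)) \<longlonglongrightarrow> 0))"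
    if max: "\<forall>n\<ge>2. is_maximizer (ecdf X n \<omega>) (\<theta>hat n \<omega>, \<psi>hat n \<omega>)"
      and pos: "\<forall>i\<ge>1. 0 < g0 (X i \<omega> - \<theta>0)" and cdf: "\<forall>q\<in>\<rat>. (\<lambda>n. ecdf X n \<omega> q) \<longlonglongrightarrow> F0 q"
      and lnl: "(\<lambda>n. (\<Sum>i\<in>{1..n}. ln (g0 (X i \<omega> - \<theta>0))) / real n) \<longlonglongrightarrow> L0" for \<omega>
  proof -
    let ?a = "\<lambda>n. (\<Sum>i\<in>{1..n+2}. ln (g0 (X i \<omega> - \<theta>0))) / real (n + 2)"
    have gh: "(\<lambda>n x. exp_ext (\<psi>hat (n + 2) \<omega> x)) = (\<lambda>n. ghat (n + 2) \<omega>)" by (simp add: ghat_def)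
    obtain N :: "real measure" and Y Y0
      where C: "coupled_sample N Y Y0 g0 \<theta>0 (\<lambda>n. ghat (n + 2) \<omega>) (\<lambda>n. \<theta>hat (n + 2) \<omega>) ?a"
        and crit: "\<And>n. L_crit (ecdf X (n + 2) \<omega>)
            = ereal (coupled_sample.A N Y (\<lambda>n. ghat (n + 2) \<omega>) (\<lambda>n. \<theta>hat (n + 2) \<omega>) n - 1)"
      using coupled_sample_exists[OF log_concave g0_exp g0_int P0[unfolded P0_g0] F0[unfolded P0_g0],
          of X \<omega> "\<lambda>n. \<theta>hat n \<omega>" "\<lambda>n. \<psi>hat n \<omega>", unfolded gh] max pos cdf lnl
      by (auto simp: L0_def)
    interpret C: coupled_sample N Y Y0 g0 \<theta>0 "\<lambda>n. ghat (n + 2) \<omega>" "\<lambda>n. \<theta>hat (n + 2) \<omega>" ?a by (rule C)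
    have \<alpha>R: "\<alpha> = 1 / C.R" by (simp add: \<alpha>_def C.R_def C.L0_def L0_def)
    show ?thesis
    proof (intro conjI allI impI)
      have "(\<lambda>n. L_crit (ecdf X (n + 2) \<omega>)) \<longlonglongrightarrow> L_crit F0"
        unfolding crit uniq(2) C.L0_def[symmetric] by (intro tendsto_intros C.consistency(2))
      then show "(\<lambda>n. L_crit (ecdf X n \<omega>)) \<longlonglongrightarrow> L_crit F0" by (rule LIMSEQ_offset)
      show "(\<lambda>n. \<theta>hat n \<omega>) \<longlonglongrightarrow> \<theta>0" by (rule LIMSEQ_offset[OF C.consistency(1)])
      show "(\<lambda>n. ghat n \<omega> x) \<longlonglongrightarrow> g0 x" if "isCont g0 x" for x
        by (rule LIMSEQ_offset[OF C.consistency(3)[OF that]])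
      show "\<forall>\<^sub>F n in sequentially. ghat n \<omega> x < g0 x + e" if "0 < e" for x e
        using C.eventually_less[OF that, of x]
          eventually_sequentially_seg[of "\<lambda>n. ghat n \<omega> x < g0 x + e" 2] by blast
      show "\<psi>hat n \<omega> \<in> SC0" if "2 \<le> n" for n
        using max that by (intro maximizerD(1)) auto
      fix \<alpha>1 assume "\<alpha>1 < \<alpha>"
      then have \<alpha>1: "\<alpha>1 < 1 / C.R" by (simp add: \<alpha>R)
      show "(\<lambda>n. \<integral>\<^sup>+ x. ennreal (exp (\<alpha>1 * \<bar>x\<bar>) * \<bar>ghat n \<omega> x - g0 x\<bar>) \<partial>lborel) \<longlonglongrightarrow> 0"
        by (rule LIMSEQ_offset[OF C.weighted_L1_convergence[OF \<alpha>1]])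
      show "(\<lambda>n. SUP x. ennreal (exp (\<alpha>1 * \<bar>x\<bar>) * \<bar>ghat n \<omega> x - g0 x\<bar>)) \<longlonglongrightarrow> 0"
        if "continuous_on UNIV g0"
        by (rule LIMSEQ_offset[OF C.weighted_sup_convergence[OF that \<alpha>1]])
    qed
  qed
  have good: "AE \<omega> in M. (\<forall>n\<ge>2. is_maximizer (ecdf X n \<omega>) (\<theta>hat n \<omega>, \<psi>hat n \<omega>)) \<and>
      (\<forall>i\<ge>1. 0 < g0 (X i \<omega> - \<theta>0)) \<and> (\<forall>q\<in>\<rat>. (\<lambda>n. ecdf X n \<omega> q) \<longlonglongrightarrow> F0 q) \<and>
      (\<lambda>n. (\<Sum>i\<in>{1..n}. ln (g0 (X i \<omega> - \<theta>0))) / real n) \<longlonglongrightarrow> L0"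
    using mle ev_pos ev_cdf ev_ln by eventually_elim blast
  have psi_eq: "\<psi>hat n \<omega> x = log_ext (ghat n \<omega> x)" if "\<psi>hat n \<omega> \<in> SC0" for n \<omega> x
    by (simp only: ghat_def log_ext_exp_ext[OF SC0_less_top[OF that]])

  have ghat_nonneg: "0 \<le> ghat n \<omega> x" for n \<omega> x by (simp add: ghat_def exp_ext_nonneg)

  have part_b: "(\<lambda>n. \<psi>hat n \<omega> x) \<longlonglongrightarrow> \<psi>0 x"
    if x: "x \<in> interior (effective_domain \<psi>0)" and SC: "\<forall>n\<ge>2. \<psi>hat n \<omega> \<in> SC0"
      and lim: "\<forall>x. isCont g0 x \<longrightarrow> (\<lambda>n. ghat n \<omega> x) \<longlonglongrightarrow> g0 x" for \<omega> x
  proof -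
    \<comment> \<open>The interior of the effective domain is where
      \<open>slc_isCont_interior\<close> gives continuity, and \<open>ln\<close> is continuous at
      the positive limit.\<close>
    have dom: "effective_domain \<psi>0 = {x. 0 < g0 x}"
      using g0_nonneg by (auto simp: effective_domain_def psi0_def log_ext_def order_less_le)
    have pos: "0 < g0 x" using x interior_subset unfolding dom by blast
    have l: "(\<lambda>n. ghat n \<omega> x) \<longlonglongrightarrow> g0 x" using lim slc_isCont_interior[OF slc0] x unfolding dom by blast
    then have "(\<lambda>n. ereal (ln (ghat n \<omega> x))) \<longlonglongrightarrow> ereal (ln (g0 x))"
      using pos by (intro tendsto_intros) auto
    moreover have "\<forall>\<^sub>F n in sequentially. ereal (ln (ghat n \<omega> x)) = \<psi>hat n \<omega> x"
      using order_tendstoD(1)[OF l pos] eventually_ge_at_top[of 2]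
    proof eventually_elim
      case (elim n)
      then show ?case using SC by (simp add: psi_eq log_ext_def)
    qed
    ultimately have "(\<lambda>n. \<psi>hat n \<omega> x) \<longlonglongrightarrow> ereal (ln (g0 x))" by (rule Lim_transform_eventually)
    then show ?thesis using pos by (simp add: psi0_def log_ext_def)
  qed
  have part_c: "limsup (\<lambda>n. \<psi>hat n \<omega> x) \<le> \<psi>0 x"
    if SC: "\<forall>n\<ge>2. \<psi>hat n \<omega> \<in> SC0"
      and less: "\<forall>x. \<forall>e>0. \<forall>\<^sub>F n in sequentially. ghat n \<omega> x < g0 x + e" for \<omega> x
    unfolding Limsup_le_iff
  proof (intro allI impI)
    fix y assume y: "\<psi>0 x < y"
    show "\<forall>\<^sub>F n in sequentially. \<psi>hat n \<omega> x < y"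
    \<comment> \<open>A real bound \<open>y = c\<close> turns into \<open>g0 x < exp c\<close>,
      which also makes sense if \<open>\<psi>0 x\<close> is \<open>-\<infinity>\<close>; the bound
      \<open>\<infinity>\<close> is trivial for members of \<open>SC0\<close>.\<close>
    proof (cases y)
      case (real c)
      then have "g0 x < exp c" using y by (simp add: psi0_def log_ext_less_iff g0_nonneg)
      then have "\<forall>\<^sub>F n in sequentially. ghat n \<omega> x < g0 x + (exp c - g0 x)"
        by (intro less[rule_format]) simp
      then show ?thesis using eventually_ge_at_top[of 2]
      proof eventually_elim
        case (elim n)
        then show ?case
          using SC by (simp add: psi_eq real log_ext_less_iff ghat_nonneg)
      qed
    next
      case PInf
      show ?thesis using eventually_ge_at_top[of 2]
      proof eventually_elim
        case (elim n)
        then show ?case using SC SC0_less_top PInf by simp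
      qed
    qed (use y in simp)
  qed
  show ?thesis
  proof (intro conjI)
    show "\<exists>\<alpha>>0. \<forall>\<alpha>1<\<alpha>.
          (AE \<omega> in M. (\<lambda>n. \<integral>\<^sup>+ x. ennreal (exp (\<alpha>1 * \<bar>x\<bar>) * \<bar>ghat n \<omega> x - g0 x\<bar>) \<partial>lborel) \<longlonglongrightarrow> 0)
          \<and> (continuous_on UNIV g0 \<longrightarrow>
              (AE \<omega> in M. (\<lambda>n. SUP x. ennreal (exp (\<alpha>1 * \<bar>x\<bar>) * \<bar>ghat n \<omega> x - g0 x\<bar>)) \<longlonglongrightarrow> 0))"
    proof (intro exI[of _ \<alpha>] conjI allI impI)
      show "0 < \<alpha>" by (simp add: \<alpha>_def)
      fix \<alpha>1 assume \<alpha>1: "\<alpha>1 < \<alpha>"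
      show "AE \<omega> in M. (\<lambda>n. \<integral>\<^sup>+ x. ennreal (exp (\<alpha>1 * \<bar>x\<bar>) * \<bar>ghat n \<omega> x - g0 x\<bar>) \<partial>lborel) \<longlonglongrightarrow> 0"
        using good by eventually_elim (use path \<alpha>1 in blast)
      show "AE \<omega> in M. (\<lambda>n. SUP x. ennreal (exp (\<alpha>1 * \<bar>x\<bar>) * \<bar>ghat n \<omega> x - g0 x\<bar>)) \<longlonglongrightarrow> 0"
        if "continuous_on UNIV g0"
        using good by eventually_elim (use path \<alpha>1 that in blast)
    qed
    show "AE \<omega> in M. \<forall>x \<in> interior (effective_domain \<psi>0). (\<lambda>n. \<psi>hat n \<omega> x) \<longlonglongrightarrow> \<psi>0 x"
      using good by eventually_elim (intro ballI part_b; use path in blast)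
    show "AE \<omega> in M. \<forall>x. limsup (\<lambda>n. \<psi>hat n \<omega> x) \<le> \<psi>0 x"
      using good by eventually_elim (intro allI part_c; use path in blast)
    show "AE \<omega> in M. (\<lambda>n. L_crit (ecdf X n \<omega>)) \<longlonglongrightarrow> L_crit F0"
      using good by eventually_elim (use path in blast)
    show "AE \<omega> in M. (\<lambda>n. \<theta>hat n \<omega>) \<longlonglongrightarrow> \<theta>0"
      using good by eventually_elim (use path in blast)
    show "AE \<omega> in M. \<forall>x. isCont g0 x \<longrightarrow> (\<lambda>n. ghat n \<omega> x) \<longlonglongrightarrow> g0 x"
      using good by eventually_elim (use path in blast)
  qed (use part0 in auto)
qed

end
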